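(* Let $\mathcal D$ be a compactly generated triangulated category. Every smashing subcategory of $\mathcal D$ satisfies the principle of infinite dévissage with respect to a set of Milnor colimits of compact objects; that is, every smashing subcategory $\mathcal X$ of $\mathcal D$ is of the form $\mathcal X=\mathrm{Tria}(\mathcal P)$, where $\mathcal P$ is a set of Milnor colimits of sequences of morphisms between compact objects.
   Context: $\mathcal D$ compactly generated: it has small coproducts and a set of compact objects (objects $P$ with $\mathcal D(P,?)$ preserving small coproducts) such that $M=0$ whenever all shifts of these objects have no non-zero morphisms to $M$. A smashing subcategory of $\mathcal D$ is a (strictly) full triangulated subcategory $\mathcal X$ whose inclusion functor has a right adjoint and such that $\mathcal X^\perp=\{M:\mathcal D(X,M)=0\ \forall X\in\mathcal X\}$ is closed under small coproducts in $\mathcal D$. $\mathrm{Tria}(\mathcal P)$ is the smallest full triangulated subcategory of $\mathcal D$ containing $\mathcal P$ and closed under small coproducts; a triangulated category $\mathcal X$ satisfies the principle of infinite dévissage with respect to $\mathcal P$ if $\mathcal X=\mathrm{Tria}(\mathcal P)$. The Milnor colimit of a sequence $M_0\xrightarrow{f_0}M_1\xrightarrow{f_1}M_2\to\cdots$ is the object $C$ (unique up to non-unique isomorphism) in a triangle $\coprod_{n\ge0}M_n\xrightarrow{1-\sigma}\coprod_{n\ge0}M_n\to C\to\coprod_{n\ge0}M_n[1]$, where $\sigma$ has components $M_n\xrightarrow{f_n}M_{n+1}\to\coprod_pM_p$. *)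

theory Defs
  imports "HOL-Algebra.Free_Abelian_Groups" "HOL-Library.Equipollence"
begin

section \<open>Small sets\<close>

text \<open>
  "Small" is relative to a set \<open>U\<close> of inaccessible cardinality, in the way smallness is relative to
  a Grothendieck universe: a set of any type is small iff it is strictly smaller than \<open>U\<close>.
  Collections of objects and arrows of a category are not required to be small.
\<close>

locale universe =
  fixes U :: "'u set"
  assumes nat_small: "(UNIV :: nat set) \<prec> U"
    and Pow_small: "\<And>A :: 'u set. A \<prec> U \<Longrightarrow> Pow A \<prec> U"
    and Union_small: "\<And>(I :: 'u set) (A :: 'u \<Rightarrow> 'u set).
      \<lbrakk> I \<prec> U; \<And>i. i \<in> I \<Longrightarrow> A i \<prec> U \<rbrakk> \<Longrightarrow> (\<Union>i\<in>I. A i) \<prec> U"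


section \<open>Categories, functors and adjunctions\<close>

text \<open>\<open>g \<cdot> f\<close> means first \<open>f\<close>, then \<open>g\<close>.\<close>

record ('o, 'm) category_data =
  Ob :: "'o set"
  Arr :: "'m set"
  Dom :: "'m \<Rightarrow> 'o"
  Cod :: "'m \<Rightarrow> 'o"
  Id :: "'o \<Rightarrow> 'm"
  Comp :: "'m \<Rightarrow> 'm \<Rightarrow> 'm"  (infixr \<open>\<cdot>\<index>\<close> 72)

definition Hom :: "('o, 'm, 'x) category_data_scheme \<Rightarrow> 'o \<Rightarrow> 'o \<Rightarrow> 'm set" where
  "Hom C X Y = {f \<in> Arr C. Dom C f = X \<and> Cod C f = Y}"

locale category =
  fixes C :: "('o, 'm, 'x) category_data_scheme" (structure)
  assumes Dom_in_Ob: "f \<in> Arr C \<Longrightarrow> Dom C f \<in> Ob C"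
    and Cod_in_Ob: "f \<in> Arr C \<Longrightarrow> Cod C f \<in> Ob C"
    and Id_in_Hom: "X \<in> Ob C \<Longrightarrow> Id C X \<in> Hom C X X"
    and Comp_in_Hom: "\<lbrakk> f \<in> Hom C X Y; g \<in> Hom C Y Z \<rbrakk> \<Longrightarrow> g \<cdot> f \<in> Hom C X Z"
    and Comp_Id: "f \<in> Hom C X Y \<Longrightarrow> f \<cdot> Id C X = f"
    and Id_Comp: "f \<in> Hom C X Y \<Longrightarrow> Id C Y \<cdot> f = f"
    and Comp_assoc: "\<lbrakk> f \<in> Hom C W X; g \<in> Hom C X Y; h \<in> Hom C Y Z \<rbrakk>
      \<Longrightarrow> (h \<cdot> g) \<cdot> f = h \<cdot> (g \<cdot> f)"

definition is_iso :: "('o, 'm, 'x) category_data_scheme \<Rightarrow> 'o \<Rightarrow> 'o \<Rightarrow> 'm \<Rightarrow> bool" where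
  "is_iso C X Y f \<longleftrightarrow> f \<in> Hom C X Y \<and>
     (\<exists>g\<in>Hom C Y X. g \<cdot>\<^bsub>C\<^esub> f = Id C X \<and> f \<cdot>\<^bsub>C\<^esub> g = Id C Y)"

definition isomorphic :: "('o, 'm, 'x) category_data_scheme \<Rightarrow> 'o \<Rightarrow> 'o \<Rightarrow> bool" where
  "isomorphic C X Y \<longleftrightarrow> (\<exists>f. is_iso C X Y f)"

definition zero_object :: "('o, 'm, 'x) category_data_scheme \<Rightarrow> 'o \<Rightarrow> bool" where
  "zero_object C Z \<longleftrightarrow> Z \<in> Ob C \<and>
     (\<forall>X\<in>Ob C. (\<exists>!f. f \<in> Hom C X Z) \<and> (\<exists>!f. f \<in> Hom C Z X))"

definition is_coproduct ::
  "('o, 'm, 'x) category_data_scheme \<Rightarrow> 'i set \<Rightarrow> ('i \<Rightarrow> 'o) \<Rightarrow> 'o \<Rightarrow> ('i \<Rightarrow> 'm) \<Rightarrow> bool" where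
  "is_coproduct C I M S \<iota> \<longleftrightarrow>
     S \<in> Ob C \<and> (\<forall>i\<in>I. M i \<in> Ob C \<and> \<iota> i \<in> Hom C (M i) S) \<and>
     (\<forall>Y\<in>Ob C. \<forall>g. (\<forall>i\<in>I. g i \<in> Hom C (M i) Y) \<longrightarrow>
        (\<exists>!h. h \<in> Hom C S Y \<and> (\<forall>i\<in>I. h \<cdot>\<^bsub>C\<^esub> \<iota> i = g i)))"

definition is_functor ::
  "('o, 'm, 'x) category_data_scheme \<Rightarrow> ('p, 'n, 'y) category_data_scheme
   \<Rightarrow> ('o \<Rightarrow> 'p) \<Rightarrow> ('m \<Rightarrow> 'n) \<Rightarrow> bool" where
  "is_functor C D Fo Fa \<longleftrightarrow>
     (\<forall>X\<in>Ob C. Fo X \<in> Ob D \<and> Fa (Id C X) = Id D (Fo X)) \<and>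
     (\<forall>X\<in>Ob C. \<forall>Y\<in>Ob C. \<forall>f\<in>Hom C X Y. Fa f \<in> Hom D (Fo X) (Fo Y)) \<and>
     (\<forall>X\<in>Ob C. \<forall>Y\<in>Ob C. \<forall>Z\<in>Ob C. \<forall>f\<in>Hom C X Y. \<forall>g\<in>Hom C Y Z.
        Fa (g \<cdot>\<^bsub>C\<^esub> f) = Fa g \<cdot>\<^bsub>D\<^esub> Fa f)"

definition equivalence_functor ::
  "('o, 'm, 'x) category_data_scheme \<Rightarrow> ('p, 'n, 'y) category_data_scheme
   \<Rightarrow> ('o \<Rightarrow> 'p) \<Rightarrow> ('m \<Rightarrow> 'n) \<Rightarrow> bool" where
  "equivalence_functor C D Fo Fa \<longleftrightarrow> is_functor C D Fo Fa \<and>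
     (\<forall>X\<in>Ob C. \<forall>Y\<in>Ob C. bij_betw Fa (Hom C X Y) (Hom D (Fo X) (Fo Y))) \<and>
     (\<forall>Y\<in>Ob D. \<exists>X\<in>Ob C. isomorphic D (Fo X) Y)"

text \<open>\<open>(Go, Ga)\<close> is right adjoint to \<open>(Fo, Fa)\<close>.\<close>

definition adjoint_functors ::
  "('o, 'm, 'x) category_data_scheme \<Rightarrow> ('p, 'n, 'y) category_data_scheme
   \<Rightarrow> ('o \<Rightarrow> 'p) \<Rightarrow> ('m \<Rightarrow> 'n) \<Rightarrow> ('p \<Rightarrow> 'o) \<Rightarrow> ('n \<Rightarrow> 'm) \<Rightarrow> bool" where
  "adjoint_functors C D Fo Fa Go Ga \<longleftrightarrow>
     is_functor C D Fo Fa \<and> is_functor D C Go Ga \<and>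
     (\<exists>\<phi> :: 'o \<Rightarrow> 'p \<Rightarrow> 'n \<Rightarrow> 'm.
        (\<forall>X\<in>Ob C. \<forall>Y\<in>Ob D. bij_betw (\<phi> X Y) (Hom D (Fo X) Y) (Hom C X (Go Y))) \<and>
        (\<forall>X\<in>Ob C. \<forall>X'\<in>Ob C. \<forall>Y\<in>Ob D. \<forall>Y'\<in>Ob D.
           \<forall>f\<in>Hom C X' X. \<forall>g\<in>Hom D Y Y'. \<forall>h\<in>Hom D (Fo X) Y.
             \<phi> X' Y' (g \<cdot>\<^bsub>D\<^esub> h \<cdot>\<^bsub>D\<^esub> Fa f) = Ga g \<cdot>\<^bsub>C\<^esub> \<phi> X Y h \<cdot>\<^bsub>C\<^esub> f))"

definition has_right_adjoint ::
  "('o, 'm, 'x) category_data_scheme \<Rightarrow> ('p, 'n, 'y) category_data_scheme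
   \<Rightarrow> ('o \<Rightarrow> 'p) \<Rightarrow> ('m \<Rightarrow> 'n) \<Rightarrow> bool" where
  "has_right_adjoint C D Fo Fa \<longleftrightarrow> (\<exists>Go Ga. adjoint_functors C D Fo Fa Go Ga)"

text \<open>A full subcategory is given by its set of objects.\<close>

definition full_subcategory ::
  "('o, 'm, 'x) category_data_scheme \<Rightarrow> 'o set \<Rightarrow> ('o, 'm, 'x) category_data_scheme" where
  "full_subcategory C \<X> =
     C \<lparr> Ob := \<X>, Arr := {f \<in> Arr C. Dom C f \<in> \<X> \<and> Cod C f \<in> \<X>} \<rparr>"


section \<open>Triangulated categories\<close>

text \<open>
  \<open>Shift_ob\<close> and \<open>Shift_arr\<close> are the two components of the shift functor \<open>?[1]\<close>. The triple
  \<open>(u, v, w) \<in> Tri D\<close> stands for the distinguished triangle with these arrows, whose objects are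
  \<open>Dom u\<close>, \<open>Cod u\<close>, \<open>Cod v\<close> and \<open>(Dom u)[1]\<close>.
\<close>

record ('o, 'm) triangulated_data = "('o, 'm) category_data" +
  Plus :: "'m \<Rightarrow> 'm \<Rightarrow> 'm"
  Zero :: "'o \<Rightarrow> 'o \<Rightarrow> 'm"
  Shift_ob :: "'o \<Rightarrow> 'o"
  Shift_arr :: "'m \<Rightarrow> 'm"
  Tri :: "('m \<times> 'm \<times> 'm) set"

definition hom_group ::
  "('o, 'm, 'x) triangulated_data_scheme \<Rightarrow> 'o \<Rightarrow> 'o \<Rightarrow> 'm monoid" where
  "hom_group D X Y = \<lparr> carrier = Hom D X Y, monoid.mult = Plus D, one = Zero D X Y \<rparr>"

definition Neg :: "('o, 'm, 'x) triangulated_data_scheme \<Rightarrow> 'm \<Rightarrow> 'm" where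
  "Neg D f = inv\<^bsub>hom_group D (Dom D f) (Cod D f)\<^esub> f"

locale additive_category = category D
  for D :: "('o, 'm, 'x) triangulated_data_scheme" (structure) +
  assumes comm_group_Hom: "\<lbrakk> X \<in> Ob D; Y \<in> Ob D \<rbrakk> \<Longrightarrow> comm_group (hom_group D X Y)"
    and Comp_Plus: "\<lbrakk> f \<in> Hom D X Y; f' \<in> Hom D X Y; g \<in> Hom D Y Z \<rbrakk>
      \<Longrightarrow> g \<cdot> Plus D f f' = Plus D (g \<cdot> f) (g \<cdot> f')"
    and Plus_Comp: "\<lbrakk> f \<in> Hom D X Y; g \<in> Hom D Y Z; g' \<in> Hom D Y Z \<rbrakk>
      \<Longrightarrow> Plus D g g' \<cdot> f = Plus D (g \<cdot> f) (g' \<cdot> f)"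
    and has_zero_object: "\<exists>Z. zero_object D Z"
    and has_binary_coproducts: "\<lbrakk> X \<in> Ob D; Y \<in> Ob D \<rbrakk>
      \<Longrightarrow> \<exists>S \<iota>. is_coproduct D (UNIV :: bool set) (\<lambda>b. if b then X else Y) S \<iota>"

definition triangle_shape ::
  "('o, 'm, 'x) triangulated_data_scheme \<Rightarrow> 'o \<Rightarrow> 'o \<Rightarrow> 'o \<Rightarrow> 'm \<Rightarrow> 'm \<Rightarrow> 'm \<Rightarrow> bool" where
  "triangle_shape D X Y Z u v w \<longleftrightarrow>
     X \<in> Ob D \<and> Y \<in> Ob D \<and> Z \<in> Ob D \<and>
     u \<in> Hom D X Y \<and> v \<in> Hom D Y Z \<and> w \<in> Hom D Z (Shift_ob D X)"

definition dist_triangle ::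
  "('o, 'm, 'x) triangulated_data_scheme \<Rightarrow> 'o \<Rightarrow> 'o \<Rightarrow> 'o \<Rightarrow> 'm \<Rightarrow> 'm \<Rightarrow> 'm \<Rightarrow> bool" where
  "dist_triangle D X Y Z u v w \<longleftrightarrow> triangle_shape D X Y Z u v w \<and> (u, v, w) \<in> Tri D"

text \<open>Verdier's axioms; the shift is only required to be an additive autoequivalence.\<close>

locale triangulated_category = additive_category D
  for D :: "('o, 'm, 'x) triangulated_data_scheme" (structure) +
  assumes shift_equivalence: "equivalence_functor D D (Shift_ob D) (Shift_arr D)"
    and shift_additive: "\<lbrakk> f \<in> Hom D X Y; g \<in> Hom D X Y \<rbrakk>
      \<Longrightarrow> Shift_arr D (Plus D f g) = Plus D (Shift_arr D f) (Shift_arr D g)"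
    and Tri_shape: "(u, v, w) \<in> Tri D \<Longrightarrow> \<exists>X Y Z. triangle_shape D X Y Z u v w"
    and Tri_iso: "\<lbrakk> dist_triangle D X Y Z u v w; triangle_shape D X' Y' Z' u' v' w';
        is_iso D X X' a; is_iso D Y Y' b; is_iso D Z Z' c;
        b \<cdot> u = u' \<cdot> a; c \<cdot> v = v' \<cdot> b; Shift_arr D a \<cdot> w = w' \<cdot> c \<rbrakk>
      \<Longrightarrow> dist_triangle D X' Y' Z' u' v' w'"
    and Tri_Id: "\<lbrakk> X \<in> Ob D; zero_object D Z \<rbrakk>
      \<Longrightarrow> dist_triangle D X X Z (Id D X) (Zero D X Z) (Zero D Z (Shift_ob D X))"
    and Tri_extend: "\<lbrakk> X \<in> Ob D; Y \<in> Ob D; u \<in> Hom D X Y \<rbrakk>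
      \<Longrightarrow> \<exists>Z v w. dist_triangle D X Y Z u v w"
    and Tri_rotate: "triangle_shape D X Y Z u v w \<Longrightarrow>
      dist_triangle D X Y Z u v w \<longleftrightarrow>
      dist_triangle D Y Z (Shift_ob D X) v w (Neg D (Shift_arr D u))"
    and Tri_complete: "\<lbrakk> dist_triangle D X Y Z u v w; dist_triangle D X' Y' Z' u' v' w';
        a \<in> Hom D X X'; b \<in> Hom D Y Y'; b \<cdot> u = u' \<cdot> a \<rbrakk>
      \<Longrightarrow> \<exists>c\<in>Hom D Z Z'. c \<cdot> v = v' \<cdot> b \<and> Shift_arr D a \<cdot> w = w' \<cdot> c"
    and Tri_octahedral: "\<lbrakk> dist_triangle D X Y A f a a'; dist_triangle D Y Z B g b b';
        dist_triangle D X Z E (g \<cdot> f) c c' \<rbrakk>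
      \<Longrightarrow> \<exists>u v. dist_triangle D A E B u v (Shift_arr D a \<cdot> b') \<and>
            u \<cdot> a = c \<cdot> g \<and> c' \<cdot> u = a' \<and> v \<cdot> c = b \<and> b' \<cdot> v = Shift_arr D f \<cdot> c'"

text \<open>
  \<open>Q\<close> is isomorphic to \<open>P[m - n]\<close> for some \<open>m, n\<close>. In this form negative shifts need no choice of a
  quasi-inverse of the shift functor.
\<close>

definition is_shift :: "('o, 'm, 'x) triangulated_data_scheme \<Rightarrow> 'o \<Rightarrow> 'o \<Rightarrow> bool" where
  "is_shift D P Q \<longleftrightarrow> Q \<in> Ob D \<and>
     (\<exists>m n :: nat. isomorphic D ((Shift_ob D ^^ m) P) ((Shift_ob D ^^ n) Q))"

text \<open>The set of objects of a strictly full triangulated subcategory.\<close>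

definition triangulated_subcategory ::
  "('o, 'm, 'x) triangulated_data_scheme \<Rightarrow> 'o set \<Rightarrow> bool" where
  "triangulated_subcategory D \<X> \<longleftrightarrow>
     \<X> \<subseteq> Ob D \<and> (\<exists>Z\<in>\<X>. zero_object D Z) \<and>
     (\<forall>X\<in>\<X>. \<forall>Y\<in>Ob D. isomorphic D X Y \<longrightarrow> Y \<in> \<X>) \<and>
     (\<forall>X\<in>Ob D. X \<in> \<X> \<longleftrightarrow> Shift_ob D X \<in> \<X>) \<and>
     (\<forall>X Y Z u v w. dist_triangle D X Y Z u v w \<longrightarrow> X \<in> \<X> \<longrightarrow> Y \<in> \<X> \<longrightarrow> Z \<in> \<X>)"


section \<open>Small coproducts, compact generation and smashing subcategories\<close>

text \<open>
  Every small set is in bijection with some \<open>I :: 'u set\<close> such that \<open>I \<prec> U\<close>, so these sets suffice to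
  index the small coproducts.
\<close>

definition has_small_coproducts ::
  "('o, 'm, 'x) category_data_scheme \<Rightarrow> 'u set \<Rightarrow> bool" where
  "has_small_coproducts C U \<longleftrightarrow>
     (\<forall>(I :: 'u set) M. I \<prec> U \<and> (\<forall>i\<in>I. M i \<in> Ob C) \<longrightarrow> (\<exists>S \<iota>. is_coproduct C I M S \<iota>))"

definition closed_under_small_coproducts ::
  "('o, 'm, 'x) category_data_scheme \<Rightarrow> 'u set \<Rightarrow> 'o set \<Rightarrow> bool" where
  "closed_under_small_coproducts C U \<X> \<longleftrightarrow>
     (\<forall>(I :: 'u set) M S \<iota>. I \<prec> U \<and> (\<forall>i\<in>I. M i \<in> \<X>) \<and> is_coproduct C I M S \<iota> \<longrightarrow> S \<in> \<X>)"

text \<open>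
  The functor \<open>D(P, ?)\<close> into abelian groups preserves a coproduct iff the canonical map from the
  direct sum of the groups \<open>D(P, M i)\<close> to \<open>D(P, S)\<close> is an isomorphism.
\<close>

definition compact_object ::
  "('o, 'm, 'x) triangulated_data_scheme \<Rightarrow> 'u set \<Rightarrow> 'o \<Rightarrow> bool" where
  "compact_object D U P \<longleftrightarrow> P \<in> Ob D \<and>
     (\<forall>(I :: 'u set) M S \<iota>. I \<prec> U \<and> is_coproduct D I M S \<iota> \<longrightarrow>
        (\<lambda>x. gfinprod (hom_group D P S) (\<lambda>i. \<iota> i \<cdot>\<^bsub>D\<^esub> x i) I)
          \<in> iso (sum_group I (\<lambda>i. hom_group D P (M i))) (hom_group D P S))"

locale compactly_generated_triangulated_category = triangulated_category D + universe U
  for D :: "('o, 'm, 'x) triangulated_data_scheme" (structure) and U :: "'u set" +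
  assumes locally_small: "\<lbrakk> X \<in> Ob D; Y \<in> Ob D \<rbrakk> \<Longrightarrow> Hom D X Y \<prec> U"
    and small_coproducts: "has_small_coproducts D U"
    and compact_generators: "\<exists>\<G>. \<G> \<prec> U \<and> (\<forall>P\<in>\<G>. compact_object D U P) \<and>
      (\<forall>M\<in>Ob D. (\<forall>P\<in>\<G>. \<forall>Q. is_shift D P Q \<longrightarrow> Hom D Q M = {Zero D Q M}) \<longrightarrow> zero_object D M)"

definition right_orthogonal ::
  "('o, 'm, 'x) triangulated_data_scheme \<Rightarrow> 'o set \<Rightarrow> 'o set" where
  "right_orthogonal D \<X> = {M \<in> Ob D. \<forall>X\<in>\<X>. Hom D X M = {Zero D X M}}"

definition smashing_subcategory ::
  "('o, 'm, 'x) triangulated_data_scheme \<Rightarrow> 'u set \<Rightarrow> 'o set \<Rightarrow> bool" where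
  "smashing_subcategory D U \<X> \<longleftrightarrow>
     triangulated_subcategory D \<X> \<and>
     has_right_adjoint (full_subcategory D \<X>) D (\<lambda>X. X) (\<lambda>f. f) \<and>
     closed_under_small_coproducts D U (right_orthogonal D \<X>)"

definition Tria :: "('o, 'm, 'x) triangulated_data_scheme \<Rightarrow> 'u set \<Rightarrow> 'o set \<Rightarrow> 'o set" where
  "Tria D U \<P> = \<Inter> {\<Y>. triangulated_subcategory D \<Y> \<and>
     closed_under_small_coproducts D U \<Y> \<and> \<P> \<subseteq> \<Y>}"

definition is_Milnor_colimit ::
  "('o, 'm, 'x) triangulated_data_scheme \<Rightarrow> (nat \<Rightarrow> 'o) \<Rightarrow> (nat \<Rightarrow> 'm) \<Rightarrow> 'o \<Rightarrow> bool" where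
  "is_Milnor_colimit D M f C \<longleftrightarrow>
     (\<forall>n. f n \<in> Hom D (M n) (M (Suc n))) \<and>
     (\<exists>S \<iota> \<sigma> v w. is_coproduct D UNIV M S \<iota> \<and>
        \<sigma> \<in> Hom D S S \<and> (\<forall>n. \<sigma> \<cdot>\<^bsub>D\<^esub> \<iota> n = \<iota> (Suc n) \<cdot>\<^bsub>D\<^esub> f n) \<and>
        dist_triangle D S S C (Plus D (Id D S) (Neg D \<sigma>)) v w)"

end

theory Submission
  imports Defs
begin

text \<open>
  Write \<open>L\<close> for the reflection onto the right orthogonal of the smashing subcategory \<open>\<X>\<close>; it fits into
  triangles \<open>G \<rightarrow> N \<rightarrow> L N \<rightarrow> \<Sigma> G\<close> with \<open>G\<close> in \<open>\<X>\<close>. That \<open>\<X>\<close> is smashing means that \<open>L\<close> commutes with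
  small coproducts. Let \<open>\<T>\<close> be the triangulated subcategory generated by a small set of compact
  generators; it consists of compact objects and has a small skeleton.

  The heart of the proof is that an arrow \<open>f : C \<rightarrow> M\<close> with \<open>C\<close> in \<open>\<T>\<close> and \<open>M\<close> in \<open>\<X>\<close> factors as
  \<open>C \<rightarrow> K \<rightarrow> M\<close> with \<open>K\<close> in \<open>\<T>\<close> and with a first arrow that factors through an object of \<open>\<X>\<close>
  (\<open>factor_through_X\<close>). For a fixed \<open>C\<close> in \<open>\<T>\<close>, the functor \<open>D(C, L ?)\<close> is homological and preserves
  coproducts. Hence its value at any \<open>N\<close> is the filtered colimit of its values at the objects of \<open>\<T>\<close>
  over \<open>N\<close>, since this is true for \<open>N\<close> in \<open>\<T>\<close> and passes to extensions and coproducts. Now the unit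
  \<open>C \<rightarrow> L C\<close> is sent by \<open>f\<close> to zero in \<open>D(C, L M)\<close>, because \<open>L M = 0\<close>; so it vanishes already in
  \<open>D(C, L K)\<close> for some factorization \<open>C \<rightarrow> K \<rightarrow> M\<close>, which says that \<open>C \<rightarrow> K \<rightarrow> L K\<close> is zero and that
  \<open>C \<rightarrow> K\<close> comes from the object of \<open>\<X>\<close> in the triangle of \<open>K\<close>. The
  surjectivity and the injectivity of the comparison of the colimit with \<open>D(C, L N)\<close> are the
  predicates \<open>T_onto\<close> and \<open>T_into\<close>.

  Iterating this produces a sequence \<open>C = C\<^sub>0 \<rightarrow> C\<^sub>1 \<rightarrow> \<dots>\<close> of compact objects over \<open>M\<close> whose arrows all
  factor through \<open>\<X>\<close>. Its Milnor colimit lies in \<open>\<X>\<close> (\<open>Milnor_colimit_in_X\<close>), and \<open>f\<close> factors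
  through it. Up to isomorphism there is only a small set \<open>\<P>\<close> of such Milnor colimits, as \<open>\<T>\<close> has a
  small skeleton.

  So every arrow from \<open>\<T>\<close> to an object \<open>M\<close> of \<open>\<X>\<close> factors through an object of \<open>\<P>\<close>, and this already
  implies \<open>\<X> = Tria(\<P>)\<close> (\<open>devissage\<close>, \<open>Tria_eqI\<close>), although the objects of \<open>\<P>\<close> need not be compact: \<open>M\<close> is
  reconstructed as a Milnor colimit of objects \<open>F\<^sub>n\<close> of \<open>Tria(\<P>)\<close> over \<open>M\<close>, where \<open>F\<^sub>0\<close> is a coproduct
  of objects of \<open>\<P>\<close> to which all arrows from \<open>\<T>\<close> to \<open>M\<close> lift, and \<open>F\<^sub>n \<rightarrow> F\<^bsub>n+1\<^esub>\<close> kills all arrows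
  from \<open>\<T>\<close> to \<open>F\<^sub>n\<close> that vanish in \<open>M\<close>. Arrows from compact objects to the Milnor colimit come from
  the \<open>F\<^sub>n\<close>, so it has the same arrows from \<open>\<T>\<close> as \<open>M\<close>, and \<open>\<T>\<close> generates the category. The same criterion with \<open>\<X>\<close> the whole category shows that a
  class closed under shifts, extensions and coproducts that contains \<open>\<T>\<close> contains every object,
  which was used above.
\<close>

section \<open>Small sets of arbitrary type\<close>

context universe
begin

lemma infinite_U: "infinite U"
  using nat_small infinite_le_lepoll lesspoll_imp_lepoll by blast

lemma countable_lepoll_nat: "countable A \<Longrightarrow> A \<lesssim> (UNIV :: nat set)"
  by (metis countable_def lepoll_def subset_UNIV)

lemma countable_small: "countable A \<Longrightarrow> A \<prec> U"
  using nat_small countable_lepoll_nat lesspoll_trans1 by blast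

lemma small_subset: "A \<subseteq> B \<Longrightarrow> B \<prec> U \<Longrightarrow> A \<prec> U"
  using lesspoll_trans1 subset_imp_lepoll by blast

lemma small_image: "A \<prec> U \<Longrightarrow> f ` A \<prec> U"
  using image_lepoll lesspoll_trans1 by blast

text \<open>Small coproducts are indexed by sets of the element type of \<open>U\<close>; through such a bijection they
  can be indexed by any small set.\<close>

lemma small_index:
  assumes "A \<prec> U"
  obtains I :: "'u set" and b where "I \<prec> U" "bij_betw b I A"
proof -
  obtain f where f: "inj_on f A" "f ` A \<subseteq> U"
    using assms unfolding lesspoll_def lepoll_def by blast
  have "bij_betw (inv_into A f) (f ` A) A"
    by (simp add: bij_betw_inv_into f(1) inj_on_imp_bij_betw)
  moreover have "f ` A \<prec> U" using assms small_image by blast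
  ultimately show thesis using that by blast
qed

text \<open>Since \<open>U \<times> U\<close> injects into \<open>U\<close>, a disjoint union of small sets can be embedded as a union of
  small subsets of \<open>U\<close>, to which the closure of the universe under unions applies.\<close>

lemma small_Sigma:
  fixes I :: "'i set" and A :: "'i \<Rightarrow> 'a set"
  assumes I: "I \<prec> U" and A: "\<And>i. i \<in> I \<Longrightarrow> A i \<prec> U"
  shows "Sigma I A \<prec> U"
proof -
  have "U \<times> U \<lesssim> U"
    using card_of_Times_same_infinite[OF infinite_U] eqpoll_iff_card_of_ordIso eqpoll_imp_lepoll
    by blast
  then obtain p where p: "inj_on p (U \<times> U)" "p ` (U \<times> U) \<subseteq> U"
    unfolding lepoll_def by blast
  obtain g where g: "inj_on g I" "g ` I \<subseteq> U"
    using I unfolding lesspoll_def lepoll_def by blast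
  have "\<forall>i\<in>I. \<exists>f. inj_on f (A i) \<and> f ` A i \<subseteq> U"
    using A unfolding lesspoll_def lepoll_def by blast
  then obtain f where f: "\<And>i. i \<in> I \<Longrightarrow> inj_on (f i) (A i) \<and> f i ` A i \<subseteq> U" by metis
  define B where "B j = (\<lambda>a. p (j, f (inv_into I g j) a)) ` A (inv_into I g j)" for j
  have "B j \<prec> U" if "j \<in> g ` I" for j
    unfolding B_def by (rule small_image) (use that A in \<open>simp add: inv_into_into\<close>)
  then have UB: "(\<Union>j\<in>g ` I. B j) \<prec> U"
    using Union_small[of "g ` I" B] small_image[OF I] by blast
  have "inj_on (\<lambda>(i, a). p (g i, f i a)) (Sigma I A)"
  proof (rule inj_onI, clarify)
    fix i a i' a' assume *: "i \<in> I" "a \<in> A i" "i' \<in> I" "a' \<in> A i'" "p (g i, f i a) = p (g i', f i' a')"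
    then have "(g i, f i a) \<in> U \<times> U" "(g i', f i' a') \<in> U \<times> U" using g f by blast+
    then have "(g i, f i a) = (g i', f i' a')" using *(5) p(1) by (meson inj_onD)
    then show "i = i' \<and> a = a'"
      using * g(1) f by (metis Pair_inject inj_onD)
  qed
  moreover have "(\<lambda>(i, a). p (g i, f i a)) ` Sigma I A \<subseteq> (\<Union>j\<in>g ` I. B j)"
    using g(1) by (force simp: B_def)
  ultimately have "Sigma I A \<lesssim> (\<Union>j\<in>g ` I. B j)" unfolding lepoll_def by blast
  then show ?thesis using UB lesspoll_trans1 by blast
qed

lemma small_Union:
  fixes I :: "'i set" and A :: "'i \<Rightarrow> 'a set"
  assumes "I \<prec> U" and "\<And>i. i \<in> I \<Longrightarrow> A i \<prec> U"
  shows "(\<Union>i\<in>I. A i) \<prec> U"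
proof -
  have "(\<Union>i\<in>I. A i) = snd ` Sigma I A" by force
  then show ?thesis using small_image[OF small_Sigma[OF assms], where f = snd] by (simp only:)
qed

lemma small_Un: "A \<prec> U \<Longrightarrow> B \<prec> U \<Longrightarrow> A \<union> B \<prec> U"
proof -
  assume "A \<prec> U" "B \<prec> U"
  then have "(\<Union>b. if b then A else B) \<prec> U"
    by (intro small_Union) (auto intro: countable_small[OF countable_finite])
  moreover have "A \<union> B = (\<Union>b. if b then A else B)" by auto
  ultimately show ?thesis by (simp only:)
qed

lemma small_Pow:
  assumes "A \<prec> U" shows "Pow A \<prec> U"
proof -
  obtain I :: "'u set" and b where "I \<prec> U" "bij_betw b I A" using small_index[OF assms] .
  then have "Pow A = (`) b ` Pow I" by (metis bij_betw_def image_Pow_surj)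
  then show ?thesis using small_image[OF Pow_small[OF \<open>I \<prec> U\<close>], where f = "(`) b"] by (simp only:)
qed

text \<open>A sequence is determined by its graph, a subset of a small set.\<close>

lemma small_sequences:
  assumes "A \<prec> U" shows "{a :: nat \<Rightarrow> 'a. range a \<subseteq> A} \<prec> U"
proof -
  let ?gr = "\<lambda>a :: nat \<Rightarrow> 'a. range (\<lambda>n. (n, a n))"
  have 1: "inj_on ?gr {a. range a \<subseteq> A}"
  proof (rule inj_onI, rule ext)
    fix a a' :: "nat \<Rightarrow> 'a" and n assume eq: "?gr a = ?gr a'"
    have "(n, a n) \<in> ?gr a" by (rule rangeI)
    then show "a n = a' n" unfolding eq by clarify
  qed
  have 2: "?gr ` {a. range a \<subseteq> A} \<subseteq> Pow (UNIV \<times> A)" by auto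
  have "{a :: nat \<Rightarrow> 'a. range a \<subseteq> A} \<lesssim> Pow ((UNIV :: nat set) \<times> A)"
    unfolding lepoll_def using 1 2 by (intro exI[of _ ?gr] conjI)
  also have "Pow ((UNIV :: nat set) \<times> A) \<prec> U"
    by (rule small_Pow, rule small_Sigma[OF nat_small assms])
  finally show ?thesis .
qed

end

section \<open>Calculus of arrows\<close>

context category
begin

lemma Hom_iff [simp]: "f \<in> Hom C X Y \<longleftrightarrow> f \<in> Arr C \<and> Dom C f = X \<and> Cod C f = Y"
  by (auto simp: Hom_def)

lemma Hom_Ob: "f \<in> Hom C X Y \<Longrightarrow> X \<in> Ob C \<and> Y \<in> Ob C"
  using Dom_in_Ob Cod_in_Ob by auto

lemma comp_Arr [simp]:
  assumes "f \<in> Arr C" "g \<in> Arr C" "Dom C g = Cod C f"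
  shows "g \<cdot> f \<in> Arr C" "Dom C (g \<cdot> f) = Dom C f" "Cod C (g \<cdot> f) = Cod C g"
  using Comp_in_Hom[of f "Dom C f" "Cod C f" g "Cod C g"] assms by auto

lemma Id_Arr [simp]:
  assumes "X \<in> Ob C" shows "Id C X \<in> Arr C" "Dom C (Id C X) = X" "Cod C (Id C X) = X"
  using Id_in_Hom[OF assms] by auto

lemma comp_Id [simp]: "f \<in> Arr C \<Longrightarrow> Dom C f = X \<Longrightarrow> f \<cdot> Id C X = f"
  using Comp_Id[of f X "Cod C f"] by auto

lemma Id_comp [simp]: "f \<in> Arr C \<Longrightarrow> Cod C f = X \<Longrightarrow> Id C X \<cdot> f = f"
  using Id_Comp[of f "Dom C f" X] by auto

lemma assoc [simp]:
  "\<lbrakk> f \<in> Arr C; g \<in> Arr C; h \<in> Arr C; Dom C g = Cod C f; Dom C h = Cod C g \<rbrakk>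
   \<Longrightarrow> (h \<cdot> g) \<cdot> f = h \<cdot> (g \<cdot> f)"
  using Comp_assoc[of f "Dom C f" "Cod C f" g "Cod C g" h "Cod C h"] by auto

text \<open>Composites are kept associated to the right; this rewrites with an equation of composites
  inside a longer composite.\<close>

lemma assoc_subst:
  assumes "g \<cdot> f = h" "f \<in> Hom C X Y" "g \<in> Hom C Y Z"
  shows "k \<in> Arr C \<Longrightarrow> Cod C k = X \<Longrightarrow> g \<cdot> (f \<cdot> k) = h \<cdot> k"
  using assms by (simp flip: assoc)

lemma iso_obtain:
  assumes "isomorphic C X Y"
  obtains f g where "f \<in> Hom C X Y" "g \<in> Hom C Y X" "g \<cdot> f = Id C X" "f \<cdot> g = Id C Y"
  using assms unfolding isomorphic_def is_iso_def by blast

lemma isoI: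
  assumes "f \<in> Hom C X Y" "g \<in> Hom C Y X" "g \<cdot> f = Id C X" "f \<cdot> g = Id C Y"
  shows "is_iso C X Y f" "isomorphic C X Y"
  using assms unfolding isomorphic_def is_iso_def by blast+

lemma iso_Id: "X \<in> Ob C \<Longrightarrow> is_iso C X X (Id C X)"
  by (rule isoI[of _ _ _ "Id C X"]) auto

lemma iso_refl: "X \<in> Ob C \<Longrightarrow> isomorphic C X X"
  using iso_Id unfolding isomorphic_def by blast

lemma iso_sym: "isomorphic C X Y \<Longrightarrow> isomorphic C Y X"
  using iso_obtain isoI(2) by metis

lemma iso_trans:
  assumes "isomorphic C X Y" "isomorphic C Y Z" shows "isomorphic C X Z"
proof -
  obtain f g where 1: "f \<in> Hom C X Y" "g \<in> Hom C Y X" "g \<cdot> f = Id C X" "f \<cdot> g = Id C Y"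
    using iso_obtain[OF assms(1)] .
  obtain f' g' where 2: "f' \<in> Hom C Y Z" "g' \<in> Hom C Z Y" "g' \<cdot> f' = Id C Y" "f' \<cdot> g' = Id C Z"
    using iso_obtain[OF assms(2)] .
  show ?thesis
    by (rule isoI(2)[of "f' \<cdot> f" _ _ "g \<cdot> g'"])
      (use 1 2 in \<open>auto simp: assoc_subst[OF 1(4)] assoc_subst[OF 2(3)]\<close>)
qed

lemma iso_Ob: "isomorphic C X Y \<Longrightarrow> X \<in> Ob C \<and> Y \<in> Ob C"
  using iso_obtain Hom_Ob by metis

lemma coproduct_ex1:
  assumes "is_coproduct C I M S \<iota>" "Y \<in> Ob C" "\<And>i. i \<in> I \<Longrightarrow> g i \<in> Hom C (M i) Y"
  shows "\<exists>!h. h \<in> Hom C S Y \<and> (\<forall>i\<in>I. h \<cdot> \<iota> i = g i)"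
proof -
  have "\<forall>g. (\<forall>i\<in>I. g i \<in> Hom C (M i) Y) \<longrightarrow> (\<exists>!h. h \<in> Hom C S Y \<and> (\<forall>i\<in>I. h \<cdot> \<iota> i = g i))"
    using assms(1,2) unfolding is_coproduct_def by blast
  then show ?thesis using assms(3) by (elim allE[of _ g] impE) blast+
qed

lemma coproduct_Hom:
  assumes "is_coproduct C I M S \<iota>"
  shows "S \<in> Ob C" "i \<in> I \<Longrightarrow> M i \<in> Ob C" "i \<in> I \<Longrightarrow> \<iota> i \<in> Hom C (M i) S"
  using assms unfolding is_coproduct_def by auto

lemma coproduct_unique:
  assumes "is_coproduct C I M S \<iota>" "f \<in> Hom C S Y" "g \<in> Hom C S Y"
    and "\<And>i. i \<in> I \<Longrightarrow> f \<cdot> \<iota> i = g \<cdot> \<iota> i"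
  shows "f = g"
proof -
  have "\<exists>!h. h \<in> Hom C S Y \<and> (\<forall>i\<in>I. h \<cdot> \<iota> i = g \<cdot> \<iota> i)"
  proof (rule coproduct_ex1[OF assms(1)])
    show "Y \<in> Ob C" using assms(2) Hom_Ob by blast
    show "g \<cdot> \<iota> i \<in> Hom C (M i) Y" if "i \<in> I" for i
      using coproduct_Hom(3)[OF assms(1) that] assms(3) Comp_in_Hom by blast
  qed
  then show ?thesis using assms(2-4) by blast
qed

lemma coproduct_map:
  assumes "is_coproduct C I M S \<iota>" "Y \<in> Ob C" "\<And>i. i \<in> I \<Longrightarrow> g i \<in> Hom C (M i) Y"
  obtains h where "h \<in> Hom C S Y" "\<And>i. i \<in> I \<Longrightarrow> h \<cdot> \<iota> i = g i"
  using coproduct_ex1[of I M S \<iota> Y g, OF assms] by blast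

lemma is_coproductI:
  assumes "S \<in> Ob C" "\<And>i. i \<in> I \<Longrightarrow> \<iota> i \<in> Hom C (M i) S"
    and "\<And>Y g. Y \<in> Ob C \<Longrightarrow> (\<And>i. i \<in> I \<Longrightarrow> g i \<in> Hom C (M i) Y)
      \<Longrightarrow> \<exists>h. h \<in> Hom C S Y \<and> (\<forall>i\<in>I. h \<cdot> \<iota> i = g i)"
    and "\<And>Y f g. f \<in> Hom C S Y \<Longrightarrow> g \<in> Hom C S Y \<Longrightarrow> (\<And>i. i \<in> I \<Longrightarrow> f \<cdot> \<iota> i = g \<cdot> \<iota> i) \<Longrightarrow> f = g"
  shows "is_coproduct C I M S \<iota>"
  unfolding is_coproduct_def
proof (intro conjI ballI allI impI)
  show "S \<in> Ob C" by (fact assms(1))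
  show "M i \<in> Ob C" "\<iota> i \<in> Hom C (M i) S" if "i \<in> I" for i
    using assms(2)[OF that] Hom_Ob by blast+
  show "\<exists>!h. h \<in> Hom C S Y \<and> (\<forall>i\<in>I. h \<cdot> \<iota> i = g i)"
    if "Y \<in> Ob C" "\<forall>i\<in>I. g i \<in> Hom C (M i) Y" for Y g
  proof (rule ex_ex1I)
    show "\<exists>h. h \<in> Hom C S Y \<and> (\<forall>i\<in>I. h \<cdot> \<iota> i = g i)"
      by (rule assms(3)) (use that in blast)+
    show "f = f'" if "f \<in> Hom C S Y \<and> (\<forall>i\<in>I. f \<cdot> \<iota> i = g i)"
      "f' \<in> Hom C S Y \<and> (\<forall>i\<in>I. f' \<cdot> \<iota> i = g i)" for f f'
      by (rule assms(4)[of f Y f']) (use that in \<open>blast | metis\<close>)+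
  qed
qed

lemma coproduct_reindex:
  assumes "is_coproduct C I M S \<iota>" "bij_betw b J I"
  shows "is_coproduct C J (M \<circ> b) S (\<iota> \<circ> b)"
proof (rule is_coproductI)
  show "S \<in> Ob C" by (rule coproduct_Hom[OF assms(1)])
  show "(\<iota> \<circ> b) j \<in> Hom C ((M \<circ> b) j) S" if "j \<in> J" for j
    using coproduct_Hom(3)[OF assms(1), of "b j"] bij_betwE[OF assms(2)] that
    by (simp only: o_apply)
  show "\<exists>h. h \<in> Hom C S Y \<and> (\<forall>j\<in>J. h \<cdot> (\<iota> \<circ> b) j = g j)"
    if Y: "Y \<in> Ob C" and g: "\<And>j. j \<in> J \<Longrightarrow> g j \<in> Hom C ((M \<circ> b) j) Y" for Y g
  proof -
    let ?c = "inv_into J b"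
    have c: "?c i \<in> J" "b (?c i) = i" if "i \<in> I" for i
      using assms(2) that by (auto simp: bij_betw_def inv_into_into f_inv_into_f)
    have c': "?c (b j) = j" if "j \<in> J" for j
      using assms(2) that by (simp add: bij_betw_def)
    obtain h where h: "h \<in> Hom C S Y" "\<And>i. i \<in> I \<Longrightarrow> h \<cdot> \<iota> i = g (?c i)"
      by (rule coproduct_map[OF assms(1) Y, of "\<lambda>i. g (?c i)"]) (use g c in fastforce)+
    then show ?thesis using bij_betwE[OF assms(2)] c' by (intro exI[of _ h]) auto
  qed
  show "f = g" if "f \<in> Hom C S Y" "g \<in> Hom C S Y"
    "\<And>j. j \<in> J \<Longrightarrow> f \<cdot> (\<iota> \<circ> b) j = g \<cdot> (\<iota> \<circ> b) j" for Y f g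
  proof (rule coproduct_unique[OF assms(1) that(1,2)])
    fix i assume "i \<in> I"
    then obtain j where "j \<in> J" "i = b j" using assms(2) by (auto simp: bij_betw_def)
    then show "f \<cdot> \<iota> i = g \<cdot> \<iota> i" using that(3)[of j] by simp
  qed
qed

lemma small_coproduct_exists:
  fixes A :: "'i set" and U :: "'u set"
  assumes "has_small_coproducts C U" "universe U" "A \<prec> U" "\<And>i. i \<in> A \<Longrightarrow> M i \<in> Ob C"
  obtains S \<iota> where "is_coproduct C A M S \<iota>"
proof -
  obtain I :: "'u set" and b where I: "I \<prec> U" "bij_betw b I A"
    using universe.small_index[OF assms(2,3)] .
  have "\<forall>i\<in>I. (M \<circ> b) i \<in> Ob C" using assms(4) I(2) by (auto simp: bij_betw_def)
  then obtain S \<iota> where S: "is_coproduct C I (M \<circ> b) S \<iota>"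
    using assms(1) I(1) unfolding has_small_coproducts_def by blast
  have c: "bij_betw (inv_into I b) A I" using I(2) by (rule bij_betw_inv_into)
  have "is_coproduct C A ((M \<circ> b) \<circ> inv_into I b) S (\<iota> \<circ> inv_into I b)"
    by (rule coproduct_reindex[OF S c])
  moreover have "((M \<circ> b) \<circ> inv_into I b) i = M i" if "i \<in> A" for i
    using I(2) that by (simp add: bij_betw_def f_inv_into_f)
  ultimately have "is_coproduct C A M S (\<iota> \<circ> inv_into I b)"
    unfolding is_coproduct_def by simp
  then show thesis using that by blast
qed

lemma small_coproduct_closed:
  fixes A :: "'i set" and U :: "'u set"
  assumes "closed_under_small_coproducts C U \<Y>" "universe U" "A \<prec> U"
    and "is_coproduct C A M S \<iota>" "\<And>i. i \<in> A \<Longrightarrow> M i \<in> \<Y>"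
  shows "S \<in> \<Y>"
proof -
  obtain I :: "'u set" and b where I: "I \<prec> U" "bij_betw b I A"
    using universe.small_index[OF assms(2,3)] .
  then have "is_coproduct C I (M \<circ> b) S (\<iota> \<circ> b)" "\<forall>i\<in>I. (M \<circ> b) i \<in> \<Y>"
    using coproduct_reindex[OF assms(4)] assms(5) by (auto simp: bij_betw_def)
  then show ?thesis using assms(1) I(1) unfolding closed_under_small_coproducts_def by blast
qed

end

section \<open>Additive categories\<close>

context additive_category
begin

abbreviation add_arr (infixl \<open>\<boxplus>\<close> 65) where "f \<boxplus> g \<equiv> Plus D f g"
abbreviation sub_arr (infixl \<open>\<boxminus>\<close> 65) where "f \<boxminus> g \<equiv> Plus D f (Neg D g)"

lemma hom_group_simps [simp]:
  "carrier (hom_group D X Y) = Hom D X Y" "monoid.mult (hom_group D X Y) = Plus D"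
  "one (hom_group D X Y) = Zero D X Y"
  by (simp_all add: hom_group_def)

lemma zero_Arr [simp]:
  assumes "X \<in> Ob D" "Y \<in> Ob D"
  shows "Zero D X Y \<in> Arr D" "Dom D (Zero D X Y) = X" "Cod D (Zero D X Y) = Y"
proof -
  interpret comm_group "hom_group D X Y" by (rule comm_group_Hom[OF assms])
  show "Zero D X Y \<in> Arr D" "Dom D (Zero D X Y) = X" "Cod D (Zero D X Y) = Y"
    using one_closed by auto
qed

lemma plus_Arr [simp]:
  assumes "f \<in> Arr D" "g \<in> Arr D" "Dom D g = Dom D f" "Cod D g = Cod D f"
  shows "f \<boxplus> g \<in> Arr D" "Dom D (f \<boxplus> g) = Dom D f" "Cod D (f \<boxplus> g) = Cod D f"
proof -
  interpret comm_group "hom_group D (Dom D f) (Cod D f)"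
    by (rule comm_group_Hom) (use assms Dom_in_Ob Cod_in_Ob in auto)
  show "f \<boxplus> g \<in> Arr D" "Dom D (f \<boxplus> g) = Dom D f" "Cod D (f \<boxplus> g) = Cod D f"
    using m_closed[of f g] assms by auto
qed

lemma neg_Arr [simp]:
  assumes "f \<in> Arr D"
  shows "Neg D f \<in> Arr D" "Dom D (Neg D f) = Dom D f" "Cod D (Neg D f) = Cod D f"
proof -
  interpret comm_group "hom_group D (Dom D f) (Cod D f)"
    by (rule comm_group_Hom) (use assms Dom_in_Ob Cod_in_Ob in auto)
  show "Neg D f \<in> Arr D" "Dom D (Neg D f) = Dom D f" "Cod D (Neg D f) = Cod D f"
    using inv_closed[of f] assms by (auto simp: Neg_def)
qed

lemma plus_assoc:
  assumes "f \<in> Hom D X Y" "g \<in> Hom D X Y" "h \<in> Hom D X Y"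
  shows "(f \<boxplus> g) \<boxplus> h = f \<boxplus> (g \<boxplus> h)"
proof -
  interpret comm_group "hom_group D X Y" by (rule comm_group_Hom) (use assms Hom_Ob in blast)+
  show ?thesis using m_assoc[of f g h] assms by simp
qed

lemma plus_comm:
  assumes "f \<in> Hom D X Y" "g \<in> Hom D X Y" shows "f \<boxplus> g = g \<boxplus> f"
proof -
  interpret comm_group "hom_group D X Y" by (rule comm_group_Hom) (use assms Hom_Ob in blast)+
  show ?thesis using m_comm[of f g] assms by simp
qed

lemma plus_zero [simp]:
  assumes "f \<in> Arr D" "Dom D f = X" "Cod D f = Y"
  shows "f \<boxplus> Zero D X Y = f" "Zero D X Y \<boxplus> f = f"
proof -
  interpret comm_group "hom_group D X Y"
    by (rule comm_group_Hom) (use assms Dom_in_Ob Cod_in_Ob in auto)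
  show "f \<boxplus> Zero D X Y = f" "Zero D X Y \<boxplus> f = f" using r_one[of f] l_one[of f] assms by auto
qed

lemma minus_self [simp]:
  assumes "f \<in> Arr D"
  shows "f \<boxminus> f = Zero D (Dom D f) (Cod D f)" "Neg D f \<boxplus> f = Zero D (Dom D f) (Cod D f)"
proof -
  interpret comm_group "hom_group D (Dom D f) (Cod D f)"
    by (rule comm_group_Hom) (use assms Dom_in_Ob Cod_in_Ob in auto)
  show "f \<boxminus> f = Zero D (Dom D f) (Cod D f)" "Neg D f \<boxplus> f = Zero D (Dom D f) (Cod D f)"
    using r_inv[of f] l_inv[of f] assms by (auto simp: Neg_def)
qed

lemma minus_plus_cancel:
  assumes "f \<in> Hom D X Y" "g \<in> Hom D X Y"
  shows "(f \<boxminus> g) \<boxplus> g = f" "g \<boxplus> (f \<boxminus> g) = f" "(f \<boxplus> g) \<boxminus> g = f"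
proof -
  show 1: "(f \<boxminus> g) \<boxplus> g = f" using assms plus_assoc[of f X Y "Neg D g" g] by simp
  show "g \<boxplus> (f \<boxminus> g) = f" using assms 1 plus_comm[of g X Y "f \<boxminus> g"] by simp
  show "(f \<boxplus> g) \<boxminus> g = f" using assms plus_assoc[of f X Y g "Neg D g"] by simp
qed

lemma minus_eq_zeroD:
  assumes "f \<boxminus> g = Zero D X Y" "f \<in> Hom D X Y" "g \<in> Hom D X Y" shows "f = g"
  using minus_plus_cancel(1)[OF assms(2,3)] assms by simp

lemma plus_right_cancel:
  assumes "f \<boxplus> h = g \<boxplus> h" "f \<in> Hom D X Y" "g \<in> Hom D X Y" "h \<in> Hom D X Y" shows "f = g"
  using minus_plus_cancel(3)[OF assms(2,4)] minus_plus_cancel(3)[OF assms(3,4)] assms(1) by metis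

lemma neg_unique:
  assumes "f \<boxplus> g = Zero D X Y" "f \<in> Hom D X Y" "g \<in> Hom D X Y" shows "f = Neg D g"
  by (rule plus_right_cancel[of _ g]) (use assms in auto)

lemma comp_plus [simp]:
  "\<lbrakk> f \<in> Arr D; f' \<in> Arr D; g \<in> Arr D; Dom D f' = Dom D f; Cod D f' = Cod D f; Dom D g = Cod D f \<rbrakk>
   \<Longrightarrow> g \<cdot> (f \<boxplus> f') = g \<cdot> f \<boxplus> g \<cdot> f'"
  using Comp_Plus[of f "Dom D f" "Cod D f" f' g "Cod D g"] by auto

lemma plus_comp [simp]:
  "\<lbrakk> f \<in> Arr D; g \<in> Arr D; g' \<in> Arr D; Dom D g = Cod D f; Dom D g' = Cod D f; Cod D g' = Cod D g \<rbrakk>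
   \<Longrightarrow> (g \<boxplus> g') \<cdot> f = g \<cdot> f \<boxplus> g' \<cdot> f"
  using Plus_Comp[of f "Dom D f" "Cod D f" g "Cod D g" g'] by auto

lemma comp_zero [simp]:
  assumes "X \<in> Ob D" "g \<in> Arr D" "Dom D g = Y" shows "g \<cdot> Zero D X Y = Zero D X (Cod D g)"
proof -
  have Y: "Y \<in> Ob D" "Cod D g \<in> Ob D" using assms Dom_in_Ob Cod_in_Ob by auto
  let ?z = "g \<cdot> Zero D X Y"
  have "?z \<boxplus> ?z = g \<cdot> (Zero D X Y \<boxplus> Zero D X Y)"
    by (rule comp_plus[symmetric]) (use assms Y in auto)
  also have "Zero D X Y \<boxplus> Zero D X Y = Zero D X Y" using assms Y by simp
  finally show ?thesis
    by - (rule plus_right_cancel[of _ ?z], use assms Y in auto)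
qed

lemma zero_comp [simp]:
  assumes "Z \<in> Ob D" "f \<in> Arr D" "Cod D f = Y" shows "Zero D Y Z \<cdot> f = Zero D (Dom D f) Z"
proof -
  have Y: "Y \<in> Ob D" "Dom D f \<in> Ob D" using assms Dom_in_Ob Cod_in_Ob by auto
  let ?z = "Zero D Y Z \<cdot> f"
  have "?z \<boxplus> ?z = (Zero D Y Z \<boxplus> Zero D Y Z) \<cdot> f"
    by (rule plus_comp[symmetric]) (use assms Y in auto)
  also have "Zero D Y Z \<boxplus> Zero D Y Z = Zero D Y Z" using assms Y by simp
  finally show ?thesis
    by - (rule plus_right_cancel[of _ ?z], use assms Y in auto)
qed

lemma comp_neg [simp]:
  assumes "f \<in> Arr D" "g \<in> Arr D" "Dom D g = Cod D f" shows "g \<cdot> Neg D f = Neg D (g \<cdot> f)"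
proof (rule neg_unique)
  have "g \<cdot> (Neg D f \<boxplus> f) = Zero D (Dom D f) (Cod D g)"
    using assms Dom_in_Ob Cod_in_Ob by (simp del: comp_plus)
  then show "g \<cdot> Neg D f \<boxplus> g \<cdot> f = Zero D (Dom D f) (Cod D g)" using assms by (simp del: minus_self)
qed (use assms in auto)

lemma neg_comp [simp]:
  assumes "f \<in> Arr D" "g \<in> Arr D" "Dom D g = Cod D f" shows "Neg D g \<cdot> f = Neg D (g \<cdot> f)"
proof (rule neg_unique)
  have "(Neg D g \<boxplus> g) \<cdot> f = Zero D (Dom D f) (Cod D g)"
    using assms Dom_in_Ob Cod_in_Ob by (simp del: plus_comp)
  then show "Neg D g \<cdot> f \<boxplus> g \<cdot> f = Zero D (Dom D f) (Cod D g)" using assms by (simp del: minus_self)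
qed (use assms in auto)

lemma neg_zero [simp]: "X \<in> Ob D \<Longrightarrow> Y \<in> Ob D \<Longrightarrow> Neg D (Zero D X Y) = Zero D X Y"
  using neg_unique[of "Zero D X Y" "Zero D X Y" X Y] by simp

lemma neg_neg [simp]: "f \<in> Arr D \<Longrightarrow> Neg D (Neg D f) = f"
  using neg_unique[of f "Neg D f" "Dom D f" "Cod D f"] by simp

lemma neg_eq_zeroD: "Neg D f = Zero D X Y \<Longrightarrow> f \<in> Hom D X Y \<Longrightarrow> f = Zero D X Y"
  using Hom_Ob[of f X Y] neg_neg[of f] by auto

lemma zero_object_Hom:
  assumes "zero_object D Z" "f \<in> Hom D X Y" "X = Z \<or> Y = Z"
  shows "f = Zero D X Y"
proof -
  have "X \<in> Ob D" "Y \<in> Ob D" using assms Hom_Ob by blast+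
  moreover from this have "Zero D X Y \<in> Hom D X Y" by simp
  ultimately show ?thesis using assms unfolding zero_object_def by metis
qed

lemma zero_objectI:
  assumes "Z \<in> Ob D" "Id D Z = Zero D Z Z" shows "zero_object D Z"
proof -
  have "f = Zero D X Z" if "f \<in> Hom D X Z" for f X
    using that Hom_Ob[OF that] Id_comp[of f Z] zero_comp[of Z f Z] assms by auto
  moreover have "f = Zero D Z X" if "f \<in> Hom D Z X" for f X
    using that Hom_Ob[OF that] comp_Id[of f Z] comp_zero[of Z f Z] assms by auto
  moreover have "Zero D X Z \<in> Hom D X Z" "Zero D Z X \<in> Hom D Z X" if "X \<in> Ob D" for X
    using that assms by auto
  ultimately show ?thesis unfolding zero_object_def using assms by metis
qed

lemma zero_objects_isomorphic:
  assumes "zero_object D Z" "zero_object D Z'" shows "isomorphic D Z Z'"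
  using assms zero_object_Hom[OF assms(1), of "Id D Z" Z Z] zero_object_Hom[OF assms(2), of "Id D Z'" Z' Z']
  by (intro isoI(2)[of "Zero D Z Z'" _ _ "Zero D Z' Z"]) (simp_all add: zero_object_def)

end

section \<open>Triangulated categories\<close>

context triangulated_category
begin

abbreviation shift_ob (\<open>\<Sigma>\<close>) where "\<Sigma> \<equiv> Shift_ob D"
abbreviation shift_arr (\<open>\<Sigma>\<^sub>a\<close>) where "\<Sigma>\<^sub>a \<equiv> Shift_arr D"
abbreviation tri where "tri \<equiv> dist_triangle D"

lemma shift_functor: "is_functor D D \<Sigma> \<Sigma>\<^sub>a"
  using shift_equivalence unfolding equivalence_functor_def by blast

lemma shift_Ob [simp]: "X \<in> Ob D \<Longrightarrow> \<Sigma> X \<in> Ob D"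
  using shift_functor unfolding is_functor_def by blast

lemma shift_pow_Ob [simp]: "X \<in> Ob D \<Longrightarrow> (\<Sigma> ^^ n) X \<in> Ob D"
  by (induction n) auto

lemma shift_Arr [simp]:
  assumes "f \<in> Arr D"
  shows "\<Sigma>\<^sub>a f \<in> Arr D" "Dom D (\<Sigma>\<^sub>a f) = \<Sigma> (Dom D f)" "Cod D (\<Sigma>\<^sub>a f) = \<Sigma> (Cod D f)"
proof -
  have "f \<in> Hom D (Dom D f) (Cod D f)" "Dom D f \<in> Ob D" "Cod D f \<in> Ob D"
    using assms Dom_in_Ob Cod_in_Ob by auto
  then have "\<Sigma>\<^sub>a f \<in> Hom D (\<Sigma> (Dom D f)) (\<Sigma> (Cod D f))"
    using shift_functor unfolding is_functor_def by blast
  then show "\<Sigma>\<^sub>a f \<in> Arr D" "Dom D (\<Sigma>\<^sub>a f) = \<Sigma> (Dom D f)" "Cod D (\<Sigma>\<^sub>a f) = \<Sigma> (Cod D f)"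
    by auto
qed

lemma shift_Id [simp]: "X \<in> Ob D \<Longrightarrow> \<Sigma>\<^sub>a (Id D X) = Id D (\<Sigma> X)"
  using shift_functor unfolding is_functor_def by blast

lemma shift_comp:
  assumes "f \<in> Hom D X Y" "g \<in> Hom D Y Z" shows "\<Sigma>\<^sub>a (g \<cdot> f) = \<Sigma>\<^sub>a g \<cdot> \<Sigma>\<^sub>a f"
  using assms Hom_Ob[OF assms(1)] Hom_Ob[OF assms(2)] shift_functor
  unfolding is_functor_def by blast

lemma shift_eq: "g \<cdot> f = h \<Longrightarrow> f \<in> Hom D X Y \<Longrightarrow> g \<in> Hom D Y Z \<Longrightarrow> \<Sigma>\<^sub>a g \<cdot> \<Sigma>\<^sub>a f = \<Sigma>\<^sub>a h"
  using shift_comp by metis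

lemma shift_comp_Arr [simp]:
  "\<lbrakk> f \<in> Arr D; g \<in> Arr D; Dom D g = Cod D f \<rbrakk> \<Longrightarrow> \<Sigma>\<^sub>a (g \<cdot> f) = \<Sigma>\<^sub>a g \<cdot> \<Sigma>\<^sub>a f"
  using shift_comp[of f "Dom D f" "Cod D f" g "Cod D g"] by auto

lemma shift_plus [simp]:
  "\<lbrakk> f \<in> Arr D; g \<in> Arr D; Dom D g = Dom D f; Cod D g = Cod D f \<rbrakk>
   \<Longrightarrow> \<Sigma>\<^sub>a (f \<boxplus> g) = \<Sigma>\<^sub>a f \<boxplus> \<Sigma>\<^sub>a g"
  using shift_additive[of f "Dom D f" "Cod D f" g] by auto

lemma shift_zero [simp]:
  assumes "X \<in> Ob D" "Y \<in> Ob D" shows "\<Sigma>\<^sub>a (Zero D X Y) = Zero D (\<Sigma> X) (\<Sigma> Y)"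
proof -
  let ?z = "\<Sigma>\<^sub>a (Zero D X Y)"
  have "?z \<boxplus> ?z = \<Sigma>\<^sub>a (Zero D X Y \<boxplus> Zero D X Y)"
    by (rule shift_plus[symmetric]) (use assms in auto)
  also have "Zero D X Y \<boxplus> Zero D X Y = Zero D X Y" using assms by simp
  finally show ?thesis
    by - (rule plus_right_cancel[of _ ?z], use assms in auto)
qed

lemma shift_neg [simp]:
  assumes "f \<in> Arr D" shows "\<Sigma>\<^sub>a (Neg D f) = Neg D (\<Sigma>\<^sub>a f)"
proof (rule neg_unique)
  have "\<Sigma>\<^sub>a (Neg D f \<boxplus> f) = Zero D (\<Sigma> (Dom D f)) (\<Sigma> (Cod D f))"
    using assms Dom_in_Ob Cod_in_Ob by (simp del: shift_plus)
  then show "\<Sigma>\<^sub>a (Neg D f) \<boxplus> \<Sigma>\<^sub>a f = Zero D (\<Sigma> (Dom D f)) (\<Sigma> (Cod D f))"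
    using assms by (simp del: minus_self)
qed (use assms in auto)

lemma shift_bij: "X \<in> Ob D \<Longrightarrow> Y \<in> Ob D \<Longrightarrow> bij_betw \<Sigma>\<^sub>a (Hom D X Y) (Hom D (\<Sigma> X) (\<Sigma> Y))"
  using shift_equivalence unfolding equivalence_functor_def by blast

lemma shift_faithful:
  assumes "\<Sigma>\<^sub>a f = \<Sigma>\<^sub>a g" "f \<in> Hom D X Y" "g \<in> Hom D X Y" shows "f = g"
proof -
  have "inj_on \<Sigma>\<^sub>a (Hom D X Y)" using assms(2) Hom_Ob shift_bij bij_betw_def by metis
  then show ?thesis using assms by (rule inj_onD)
qed

lemma shift_full:
  assumes "g \<in> Hom D (\<Sigma> X) (\<Sigma> Y)" "X \<in> Ob D" "Y \<in> Ob D"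
  obtains f where "f \<in> Hom D X Y" "\<Sigma>\<^sub>a f = g"
  using assms shift_bij[of X Y] unfolding bij_betw_def by (metis imageE)

lemma shift_surj:
  assumes "Y \<in> Ob D"
  obtains X a b where "X \<in> Ob D" "a \<in> Hom D (\<Sigma> X) Y" "b \<in> Hom D Y (\<Sigma> X)"
    "b \<cdot> a = Id D (\<Sigma> X)" "a \<cdot> b = Id D Y"
proof -
  obtain X where "X \<in> Ob D" "isomorphic D (\<Sigma> X) Y"
    using shift_equivalence assms unfolding equivalence_functor_def by blast
  then show thesis using that iso_obtain by metis
qed

lemma iso_shift: "isomorphic D X Y \<Longrightarrow> isomorphic D (\<Sigma> X) (\<Sigma> Y)"
proof (erule iso_obtain)
  fix f g assume *: "f \<in> Hom D X Y" "g \<in> Hom D Y X" "g \<cdot> f = Id D X" "f \<cdot> g = Id D Y"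
  then show ?thesis
    using Hom_Ob[OF *(1)] shift_eq[OF *(3,1,2)] shift_eq[OF *(4,2,1)]
    by (intro isoI(2)[of "\<Sigma>\<^sub>a f" _ _ "\<Sigma>\<^sub>a g"]) simp_all
qed

lemma iso_unshift:
  assumes "isomorphic D (\<Sigma> X) (\<Sigma> Y)" "X \<in> Ob D" "Y \<in> Ob D" shows "isomorphic D X Y"
proof -
  obtain f g where fg: "f \<in> Hom D (\<Sigma> X) (\<Sigma> Y)" "g \<in> Hom D (\<Sigma> Y) (\<Sigma> X)"
    "g \<cdot> f = Id D (\<Sigma> X)" "f \<cdot> g = Id D (\<Sigma> Y)" using iso_obtain[OF assms(1)] .
  obtain f' where f': "f' \<in> Hom D X Y" "\<Sigma>\<^sub>a f' = f" using shift_full[OF fg(1) assms(2,3)] .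
  obtain g' where g': "g' \<in> Hom D Y X" "\<Sigma>\<^sub>a g' = g" using shift_full[OF fg(2) assms(3,2)] .
  have "g' \<cdot> f' = Id D X"
    by (rule shift_faithful[of _ _ X X]) (use f' g' fg assms in simp_all)
  moreover have "f' \<cdot> g' = Id D Y"
    by (rule shift_faithful[of _ _ Y Y]) (use f' g' fg assms in simp_all)
  ultimately show ?thesis using isoI(2) f' g' by blast
qed

lemma zero_object_shift:
  assumes "zero_object D Z" shows "zero_object D (\<Sigma> Z)"
proof (rule zero_objectI)
  have Z: "Z \<in> Ob D" using assms zero_object_def by metis
  then have "Id D Z = Zero D Z Z" using zero_object_Hom[OF assms, of "Id D Z" Z Z] by simp
  then show "\<Sigma> Z \<in> Ob D" "Id D (\<Sigma> Z) = Zero D (\<Sigma> Z) (\<Sigma> Z)"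
    using Z shift_Id[OF Z] by auto
qed

subsection \<open>Exactness of the Hom functors\<close>

lemma tri_Hom:
  assumes "tri X Y Z u v w"
  shows "X \<in> Ob D" "Y \<in> Ob D" "Z \<in> Ob D"
    "u \<in> Hom D X Y" "v \<in> Hom D Y Z" "w \<in> Hom D Z (\<Sigma> X)"
  using assms unfolding dist_triangle_def triangle_shape_def by auto

lemma rotate: "tri X Y Z u v w \<Longrightarrow> tri Y Z (\<Sigma> X) v w (Neg D (\<Sigma>\<^sub>a u))"
  using Tri_rotate unfolding dist_triangle_def by blast

lemma comp_tri_1:
  assumes "tri X Y Z u v w" shows "v \<cdot> u = Zero D X Z"
proof -
  note t = tri_Hom[OF assms]
  obtain Z0 where Z0: "zero_object D Z0" using has_zero_object by blast
  obtain c where c: "c \<in> Hom D Z0 Z" "c \<cdot> Zero D X Z0 = v \<cdot> u"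
    using Tri_complete[OF Tri_Id[OF t(1) Z0] assms _ t(4), of "Id D X"] t by auto
  then show ?thesis using t Z0 unfolding zero_object_def by (simp flip: c(2))
qed

lemma comp_tri_2: "tri X Y Z u v w \<Longrightarrow> w \<cdot> v = Zero D Y (\<Sigma> X)"
  using comp_tri_1[OF rotate] .

lemma comp_tri_3:
  assumes "tri X Y Z u v w" shows "\<Sigma>\<^sub>a u \<cdot> w = Zero D Z (\<Sigma> Y)"
proof -
  note t = tri_Hom[OF assms]
  have "Neg D (\<Sigma>\<^sub>a u) \<cdot> w = Zero D Z (\<Sigma> Y)" using comp_tri_1[OF rotate[OF rotate[OF assms]]] .
  then show ?thesis using t by - (rule neg_eq_zeroD, auto)
qed

lemma lift_1:
  assumes "tri X Y Z u v w" "y \<in> Hom D W Y" "v \<cdot> y = Zero D W Z"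
  obtains x where "x \<in> Hom D W X" "u \<cdot> x = y"
proof -
  note t = tri_Hom[OF assms(1)]
  have W: "W \<in> Ob D" using assms(2) Hom_Ob by blast
  obtain Z0 where Z0: "zero_object D Z0" using has_zero_object by blast
  then have Z0': "Z0 \<in> Ob D" unfolding zero_object_def by blast
  have "\<exists>c\<in>Hom D (\<Sigma> W) (\<Sigma> X). c \<cdot> Zero D Z0 (\<Sigma> W) = w \<cdot> Zero D Z0 Z \<and>
      \<Sigma>\<^sub>a y \<cdot> Neg D (\<Sigma>\<^sub>a (Id D W)) = Neg D (\<Sigma>\<^sub>a u) \<cdot> c"
    by (rule Tri_complete[OF rotate[OF Tri_Id[OF W Z0]] rotate[OF assms(1)]])
      (use t W Z0' assms in simp_all)
  then obtain c where c: "c \<in> Hom D (\<Sigma> W) (\<Sigma> X)"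
      "\<Sigma>\<^sub>a y \<cdot> Neg D (\<Sigma>\<^sub>a (Id D W)) = Neg D (\<Sigma>\<^sub>a u) \<cdot> c" by blast
  obtain x where x: "x \<in> Hom D W X" "\<Sigma>\<^sub>a x = c" using shift_full[OF c(1) W t(1)] .
  have "Neg D (\<Sigma>\<^sub>a y) = Neg D (\<Sigma>\<^sub>a (u \<cdot> x))" using c x t W assms by simp
  then have "\<Sigma>\<^sub>a (u \<cdot> x) = \<Sigma>\<^sub>a y" using x t assms by (metis neg_neg shift_Arr(1) comp_Arr(1) Hom_iff)
  then have "u \<cdot> x = y" by (rule shift_faithful[of _ _ W Y]) (use x t assms in simp_all)
  then show thesis using that x by blast
qed

lemma lift_2:
  assumes "tri X Y Z u v w" "z \<in> Hom D W Z" "w \<cdot> z = Zero D W (\<Sigma> X)"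
  obtains y where "y \<in> Hom D W Y" "v \<cdot> y = z"
  using lift_1[OF rotate[OF assms(1)] assms(2,3)] .

lemma lift_3:
  assumes "tri X Y Z u v w" "x \<in> Hom D W (\<Sigma> X)" "\<Sigma>\<^sub>a u \<cdot> x = Zero D W (\<Sigma> Y)"
  obtains z where "z \<in> Hom D W Z" "w \<cdot> z = x"
proof -
  have "Neg D (\<Sigma>\<^sub>a u) \<cdot> x = Zero D W (\<Sigma> Y)"
    using tri_Hom[OF assms(1)] assms Hom_Ob[OF assms(2)] by simp
  then show thesis using lift_1[OF rotate[OF rotate[OF assms(1)]] assms(2)] that by blast
qed

text \<open>The connecting map \<open>w \<cdot> z\<close> is a map into \<open>\<Sigma> X\<close> that \<open>\<Sigma>\<^sub>a u\<close> kills, so it is zero as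
  soon as \<open>u\<close> is injective on maps from a desuspension of the source of \<open>z\<close>.\<close>

lemma lift_2_if_injective:
  assumes T: "tri X Y Z u v w" and z: "z \<in> Hom D Q Z"
    and inj: "\<And>Q' y. isomorphic D Q (\<Sigma> Q') \<Longrightarrow> Q' \<in> Ob D \<Longrightarrow> y \<in> Hom D Q' X
      \<Longrightarrow> u \<cdot> y = Zero D Q' Y \<Longrightarrow> y = Zero D Q' X"
  obtains y where "y \<in> Hom D Q Y" "v \<cdot> y = z"
proof -
  note t = tri_Hom[OF T]
  have "Q \<in> Ob D" using z Hom_Ob by blast
  then obtain Q' a b where Q': "Q' \<in> Ob D" "a \<in> Hom D (\<Sigma> Q') Q" "b \<in> Hom D Q (\<Sigma> Q')"
    "b \<cdot> a = Id D (\<Sigma> Q')" "a \<cdot> b = Id D Q" using shift_surj by metis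
  have "w \<cdot> (z \<cdot> a) \<in> Hom D (\<Sigma> Q') (\<Sigma> X)" using t z Q'(2) by simp
  then obtain y where y: "y \<in> Hom D Q' X" "\<Sigma>\<^sub>a y = w \<cdot> (z \<cdot> a)" using shift_full[OF _ Q'(1) t(1)] by blast
  have "u \<cdot> y = Zero D Q' Y"
  proof (rule shift_faithful)
    have "\<Sigma>\<^sub>a (u \<cdot> y) = \<Sigma>\<^sub>a u \<cdot> (w \<cdot> (z \<cdot> a))" unfolding y(2)[symmetric] by (rule shift_comp[OF y(1) t(4)])
    also have "\<dots> = Zero D Z (\<Sigma> Y) \<cdot> (z \<cdot> a)"
      by (rule assoc_subst[OF comp_tri_3[OF T] t(6)]) (use t(4) z Q'(2) in simp_all)
    also have "\<dots> = \<Sigma>\<^sub>a (Zero D Q' Y)" using z Q'(1,2) t(2) by simp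
    finally show "\<Sigma>\<^sub>a (u \<cdot> y) = \<Sigma>\<^sub>a (Zero D Q' Y)" .
  qed (use y(1) t(2,4) Q'(1) in simp_all)
  then have "y = Zero D Q' X" by (rule inj[OF isoI(2)[OF Q'(3,2,5,4)] Q'(1) y(1)])
  then have "w \<cdot> (z \<cdot> a) = Zero D (\<Sigma> Q') (\<Sigma> X)" using y(2) Q'(1) t(1) by simp
  then have "(w \<cdot> (z \<cdot> a)) \<cdot> b = Zero D Q (\<Sigma> X)" using Q'(1,3) t(1) by simp
  then have "w \<cdot> z = Zero D Q (\<Sigma> X)" using t(6) z Q'(2,3,5) by simp
  then show thesis using lift_2[OF T z] that by blast
qed

lemma extend_1:
  assumes "tri X Y Z u v w" "f \<in> Hom D Y W" "f \<cdot> u = Zero D X W"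
  obtains g where "g \<in> Hom D Z W" "g \<cdot> v = f"
proof -
  note t = tri_Hom[OF assms(1)]
  have W: "W \<in> Ob D" using assms(2) Hom_Ob by blast
  obtain Z0 where Z0: "zero_object D Z0" using has_zero_object by blast
  then have Z0': "Z0 \<in> Ob D" unfolding zero_object_def by blast
  have "tri W W (\<Sigma> Z0) (Id D W) (Zero D W (\<Sigma> Z0)) (Neg D (\<Sigma>\<^sub>a (Zero D Z0 W)))"
    using Tri_Id[OF W zero_object_shift[OF Z0]] W Z0' by simp
  then have "tri Z0 W W (Zero D Z0 W) (Id D W) (Zero D W (\<Sigma> Z0))"
    by (subst Tri_rotate) (use W Z0' in \<open>simp_all add: triangle_shape_def\<close>)
  then have "\<exists>c\<in>Hom D Z W. c \<cdot> v = Id D W \<cdot> f \<and> \<Sigma>\<^sub>a (Zero D X Z0) \<cdot> w = Zero D W (\<Sigma> Z0) \<cdot> c"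
    by (rule Tri_complete[OF assms(1)]) (use t W Z0' assms in simp_all)
  then show thesis using that assms(2) by auto
qed

lemma extend_2:
  assumes "tri X Y Z u v w" "f \<in> Hom D Z W" "f \<cdot> v = Zero D Y W"
  obtains g where "g \<in> Hom D (\<Sigma> X) W" "g \<cdot> w = f"
  using extend_1[OF rotate[OF assms(1)] assms(2,3)] .

subsection \<open>Construction and uniqueness of triangles\<close>

text \<open>The shift is only essentially surjective, so a triangle is extended to the left by replacing
  its third object by an isomorphic one of the form \<open>\<Sigma> W\<close>.\<close>

lemma fibre_exists:
  assumes "u \<in> Hom D X Y"
  obtains W t s where "tri W X Y t u s"
proof -
  have XY: "X \<in> Ob D" "Y \<in> Ob D" using assms Hom_Ob by auto
  obtain Z v w where T: "tri X Y Z u v w" using Tri_extend[OF XY assms] by blast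
  note t = tri_Hom[OF T]
  obtain W a b where W: "W \<in> Ob D" and a: "a \<in> Hom D (\<Sigma> W) Z" and b: "b \<in> Hom D Z (\<Sigma> W)"
    and ba: "b \<cdot> a = Id D (\<Sigma> W)" and ab: "a \<cdot> b = Id D Z" using shift_surj[OF t(3)] .
  have "Neg D (w \<cdot> a) \<in> Hom D (\<Sigma> W) (\<Sigma> X)" using t a by simp
  then obtain s where s: "s \<in> Hom D W X" "\<Sigma>\<^sub>a s = Neg D (w \<cdot> a)"
    using shift_full[OF _ W t(1)] by blast
  have "tri X Y (\<Sigma> W) u (b \<cdot> v) (w \<cdot> a)"
    by (rule Tri_iso[OF T _ iso_Id[OF XY(1)] iso_Id[OF XY(2)] isoI(1)[OF b a ab ba]])
      (use t a b W in \<open>simp_all add: triangle_shape_def ab\<close>)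
  then have "tri W X Y s u (b \<cdot> v)"
    by (subst Tri_rotate) (use t a b W s in \<open>simp_all add: triangle_shape_def\<close>)
  then show thesis using that by blast
qed

lemma unrotate:
  assumes T: "tri Q K (\<Sigma> N) q f s" and N: "N \<in> Ob D"
  obtains i where "tri N Q K i q f"
proof -
  note t = tri_Hom[OF T]
  have "Neg D s \<in> Hom D (\<Sigma> N) (\<Sigma> Q)" using t by simp
  then obtain i where i: "i \<in> Hom D N Q" "\<Sigma>\<^sub>a i = Neg D s" using shift_full[OF _ N t(1)] by blast
  have "tri N Q K i q f"
    by (subst Tri_rotate) (use t i N T in \<open>simp_all add: triangle_shape_def\<close>)
  then show thesis using that by blast
qed

text \<open>The five lemma for cones of one arrow: the completion of the two identities is bijective on
  arrows from every object.\<close>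

lemma cone_unique:
  assumes T: "tri X Y Z u v w" and T': "tri X Y Z' u v' w'"
  shows "isomorphic D Z Z'"
proof -
  note t = tri_Hom[OF T] and t' = tri_Hom[OF T']
  have "\<exists>c\<in>Hom D Z Z'. c \<cdot> v = v' \<cdot> Id D Y \<and> \<Sigma>\<^sub>a (Id D X) \<cdot> w = w' \<cdot> c"
    by (rule Tri_complete[OF T T']) (use t in simp_all)
  then obtain c where c0: "c \<in> Hom D Z Z'" "c \<cdot> v = v' \<cdot> Id D Y" "\<Sigma>\<^sub>a (Id D X) \<cdot> w = w' \<cdot> c"
    by blast
  have c: "c \<in> Hom D Z Z'" "c \<cdot> v = v'" "w' \<cdot> c = w"
    using c0 t(1,6) t'(5) by simp_all
  have inj: "z = Zero D W Z" if z: "z \<in> Hom D W Z" "c \<cdot> z = Zero D W Z'" for z W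
  proof -
    have W: "W \<in> Ob D" using z Hom_Ob by blast
    have "w \<cdot> z = w' \<cdot> (c \<cdot> z)" using c(1) t' z(1) by (simp add: assoc_subst[OF c(3)])
    also have "\<dots> = Zero D W (\<Sigma> X)" using z(2) t' W by simp
    finally obtain y where y: "y \<in> Hom D W Y" "v \<cdot> y = z" using lift_2[OF T z(1)] by blast
    have "v' \<cdot> y = c \<cdot> (v \<cdot> y)" using c(1) t y(1) by (simp add: assoc_subst[OF c(2)])
    then have "v' \<cdot> y = Zero D W Z'" using y(2) z(2) by simp
    then obtain x where x: "x \<in> Hom D W X" "u \<cdot> x = y" using lift_1[OF T' y(1)] by blast
    have "z = v \<cdot> (u \<cdot> x)" using x(2) y(2) by simp
    then show ?thesis using x(1) t by (simp add: assoc_subst[OF comp_tri_1[OF T]])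
  qed
  have surj: "\<exists>z\<in>Hom D W Z. c \<cdot> z = z'" if z': "z' \<in> Hom D W Z'" for z' W
  proof -
    have W: "W \<in> Ob D" using z' Hom_Ob by blast
    have "\<Sigma>\<^sub>a u \<cdot> (w' \<cdot> z') = Zero D W (\<Sigma> Y)"
      using t(1,2,3,5) t(4) t' z' W by (simp add: assoc_subst[OF comp_tri_3[OF T']])
    then obtain z where z: "z \<in> Hom D W Z" "w \<cdot> z = w' \<cdot> z'"
      using lift_3[OF T, of "w' \<cdot> z'" W] t' z' by auto
    have "w' \<cdot> (z' \<boxminus> c \<cdot> z) = Zero D W (\<Sigma> X)"
      using z(1) z' c(1) t' t by (simp add: assoc_subst[OF c(3)] z(2))
    then obtain y where y: "y \<in> Hom D W Y" "v' \<cdot> y = z' \<boxminus> c \<cdot> z"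
      using lift_2[OF T', of "z' \<boxminus> c \<cdot> z" W] z z' c by auto
    have "c \<cdot> (v \<cdot> y) = z' \<boxminus> c \<cdot> z"
      using y(1) c(1) t by (simp add: assoc_subst[OF c(2)] flip: y(2))
    then have "c \<cdot> (z \<boxplus> v \<cdot> y) = c \<cdot> z \<boxplus> (z' \<boxminus> c \<cdot> z)" using z c(1) t y(1) by simp
    also have "\<dots> = z'" by (rule minus_plus_cancel(2)[of _ W Z']) (use z z' c in simp_all)
    finally show ?thesis using z y t by (intro bexI[of _ "z \<boxplus> v \<cdot> y"]) simp_all
  qed
  obtain s where s: "s \<in> Hom D Z' Z" "c \<cdot> s = Id D Z'" using surj[of "Id D Z'" Z'] t' by auto
  have "c \<cdot> (s \<cdot> c \<boxminus> Id D Z) = Zero D Z Z'"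
    using s c(1) t by (simp add: assoc_subst[OF s(2)])
  then have "s \<cdot> c \<boxminus> Id D Z = Zero D Z Z" using inj[of "s \<cdot> c \<boxminus> Id D Z" Z] s c(1) t by simp
  then have "s \<cdot> c = Id D Z" by (rule minus_eq_zeroD) (use s c(1) t in simp_all)
  then show ?thesis using isoI(2)[OF c(1) s(1)] s(2) by blast
qed

subsection \<open>Triangulated subcategories\<close>

context
  fixes \<Y> assumes sub: "triangulated_subcategory D \<Y>"
begin

lemma sub_Ob: "X \<in> \<Y> \<Longrightarrow> X \<in> Ob D"
  using sub unfolding triangulated_subcategory_def by blast

lemma sub_zero: obtains Z where "Z \<in> \<Y>" "zero_object D Z"
  using sub unfolding triangulated_subcategory_def by blast

lemma sub_zero_object: "zero_object D Z \<Longrightarrow> Z \<in> \<Y>"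
  using sub zero_objects_isomorphic iso_Ob unfolding triangulated_subcategory_def by metis

lemma sub_iso: "X \<in> \<Y> \<Longrightarrow> isomorphic D X Y \<Longrightarrow> Y \<in> \<Y>"
  using sub iso_Ob unfolding triangulated_subcategory_def by blast

lemma sub_shift: "X \<in> Ob D \<Longrightarrow> \<Sigma> X \<in> \<Y> \<longleftrightarrow> X \<in> \<Y>"
  using sub unfolding triangulated_subcategory_def by blast

lemma sub_cone: "tri X Y Z u v w \<Longrightarrow> X \<in> \<Y> \<Longrightarrow> Y \<in> \<Y> \<Longrightarrow> Z \<in> \<Y>"
  using sub unfolding triangulated_subcategory_def by blast

lemma sub_fibre: "tri X Y Z u v w \<Longrightarrow> Y \<in> \<Y> \<Longrightarrow> Z \<in> \<Y> \<Longrightarrow> X \<in> \<Y>"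
  using sub_cone[OF rotate] sub_shift tri_Hom(1) by blast

lemma sub_mid: "tri X Y Z u v w \<Longrightarrow> X \<in> \<Y> \<Longrightarrow> Z \<in> \<Y> \<Longrightarrow> Y \<in> \<Y>"
  using sub_cone[OF rotate[OF rotate]] sub_shift tri_Hom(1,2) by blast

lemma sub_unshift:
  assumes "Y \<in> \<Y>"
  obtains X a b where "X \<in> \<Y>" "a \<in> Hom D (\<Sigma> X) Y" "b \<in> Hom D Y (\<Sigma> X)"
    "b \<cdot> a = Id D (\<Sigma> X)" "a \<cdot> b = Id D Y"
proof -
  obtain X a b where *: "X \<in> Ob D" "a \<in> Hom D (\<Sigma> X) Y" "b \<in> Hom D Y (\<Sigma> X)"
    "b \<cdot> a = Id D (\<Sigma> X)" "a \<cdot> b = Id D Y" using shift_surj[OF sub_Ob[OF assms]] .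
  moreover have "isomorphic D Y (\<Sigma> X)" by (rule isoI(2)[OF *(3,2,5,4)])
  ultimately show thesis using that sub_iso[OF assms] sub_shift by metis
qed

lemma sub_is_shift:
  assumes "P \<in> \<Y>" "is_shift D P Q" shows "Q \<in> \<Y>"
proof -
  obtain m n where *: "Q \<in> Ob D" "isomorphic D ((\<Sigma> ^^ m) P) ((\<Sigma> ^^ n) Q)"
    using assms(2) unfolding is_shift_def by blast
  have "(\<Sigma> ^^ m) P \<in> \<Y>" by (induction m) (use assms(1) sub_shift sub_Ob in auto)
  then have "(\<Sigma> ^^ n) Q \<in> \<Y>" using *(2) sub_iso by blast
  then show ?thesis
  proof (induction n)
    case (Suc n)
    then show ?case using *(1) sub_shift by auto
  qed simp
qed

end

lemma triangulated_subcategoryI: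
  assumes "\<Y> \<subseteq> Ob D" "\<And>Z. zero_object D Z \<Longrightarrow> Z \<in> \<Y>"
    and "\<And>X Y. X \<in> \<Y> \<Longrightarrow> isomorphic D X Y \<Longrightarrow> Y \<in> \<Y>"
    and "\<And>X. X \<in> Ob D \<Longrightarrow> X \<in> \<Y> \<longleftrightarrow> \<Sigma> X \<in> \<Y>"
    and "\<And>X Y Z u v w. tri X Y Z u v w \<Longrightarrow> X \<in> \<Y> \<Longrightarrow> Y \<in> \<Y> \<Longrightarrow> Z \<in> \<Y>"
  shows "triangulated_subcategory D \<Y>"
  unfolding triangulated_subcategory_def using assms has_zero_object by blast

text \<open>Classes closed under extensions and under the shift in one direction only. They are the natural
  setting of the devissage below, where only cones of arrows out of coproducts of given objects and
  Milnor colimits are formed.\<close>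

definition suspended :: "'o set \<Rightarrow> bool" where
  "suspended \<Y> \<longleftrightarrow> \<Y> \<subseteq> Ob D \<and> (\<forall>Z. zero_object D Z \<longrightarrow> Z \<in> \<Y>) \<and> (\<forall>X\<in>\<Y>. \<Sigma> X \<in> \<Y>) \<and>
     (\<forall>X Y Z u v w. tri X Y Z u v w \<longrightarrow> X \<in> \<Y> \<longrightarrow> Z \<in> \<Y> \<longrightarrow> Y \<in> \<Y>)"

lemma suspended_Ob: "suspended \<Y> \<Longrightarrow> X \<in> \<Y> \<Longrightarrow> X \<in> Ob D"
  unfolding suspended_def by blast

lemma suspended_mid: "suspended \<Y> \<Longrightarrow> tri X Y Z u v w \<Longrightarrow> X \<in> \<Y> \<Longrightarrow> Z \<in> \<Y> \<Longrightarrow> Y \<in> \<Y>"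
  unfolding suspended_def by blast

lemma suspended_cone: "suspended \<Y> \<Longrightarrow> tri X Y Z u v w \<Longrightarrow> X \<in> \<Y> \<Longrightarrow> Y \<in> \<Y> \<Longrightarrow> Z \<in> \<Y>"
  using suspended_mid[OF _ rotate] unfolding suspended_def by blast

lemma triangulated_subcategory_suspended: "triangulated_subcategory D \<Y> \<Longrightarrow> suspended \<Y>"
  unfolding suspended_def using sub_Ob sub_zero_object sub_shift sub_mid by (meson subsetI)

lemma triangulated_subcategory_Ob: "triangulated_subcategory D (Ob D)"
  by (rule triangulated_subcategoryI)
    (use iso_Ob zero_object_def tri_Hom(3) shift_Ob in \<open>metis | blast\<close>)+

lemma triangulated_subcategory_Inter:
  assumes "\<And>\<Y>. \<Y> \<in> F \<Longrightarrow> triangulated_subcategory D \<Y>" "F \<noteq> {}"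
  shows "triangulated_subcategory D (\<Inter> F)"
proof (rule triangulated_subcategoryI)
  show "\<Inter> F \<subseteq> Ob D" using assms sub_Ob by blast
  show "Z \<in> \<Inter> F" if "zero_object D Z" for Z
  proof
    fix \<Y> assume Y: "\<Y> \<in> F"
    show "Z \<in> \<Y>" by (rule sub_zero_object[OF assms(1)[OF Y] that])
  qed
  show "Y \<in> \<Inter> F" if "X \<in> \<Inter> F" "isomorphic D X Y" for X Y
    using that sub_iso assms(1) by blast
  show "X \<in> \<Inter> F \<longleftrightarrow> \<Sigma> X \<in> \<Inter> F" if "X \<in> Ob D" for X
    using that sub_shift assms(1) by blast
  show "Z \<in> \<Inter> F" if "tri X Y Z u v w" "X \<in> \<Inter> F" "Y \<in> \<Inter> F" for X Y Z u v w
    using that sub_cone assms(1) by blast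
qed

end

section \<open>Coproducts and compact objects\<close>

context additive_category
begin

lemma coproduct_projections:
  assumes "is_coproduct D I M S \<iota>"
  obtains \<pi> where "\<And>i. i \<in> I \<Longrightarrow> \<pi> i \<in> Hom D S (M i)" "\<And>i. i \<in> I \<Longrightarrow> \<pi> i \<cdot> \<iota> i = Id D (M i)"
    "\<And>i j. i \<in> I \<Longrightarrow> j \<in> I \<Longrightarrow> j \<noteq> i \<Longrightarrow> \<pi> i \<cdot> \<iota> j = Zero D (M j) (M i)"
proof -
  note c = coproduct_Hom[OF assms]
  have "\<exists>p. p \<in> Hom D S (M i) \<and> (\<forall>j\<in>I. p \<cdot> \<iota> j = (if j = i then Id D (M i) else Zero D (M j) (M i)))"
    if i: "i \<in> I" for i
  proof -
    obtain p where "p \<in> Hom D S (M i)"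
      "\<And>j. j \<in> I \<Longrightarrow> p \<cdot> \<iota> j = (if j = i then Id D (M i) else Zero D (M j) (M i))"
      by (rule coproduct_map[OF assms c(2)[OF i],
            of "\<lambda>j. if j = i then Id D (M i) else Zero D (M j) (M i)"])
        (use c(2) i in auto)
    then show ?thesis by blast
  qed
  then obtain \<pi> where "\<And>i. i \<in> I \<Longrightarrow> \<pi> i \<in> Hom D S (M i) \<and>
      (\<forall>j\<in>I. \<pi> i \<cdot> \<iota> j = (if j = i then Id D (M i) else Zero D (M j) (M i)))" by metis
  then show thesis by (intro that[of \<pi>]) auto
qed

text \<open>The idempotent of a coproduct \<open>S\<close> onto the summands with index in \<open>F\<close>. A map into \<open>S\<close> is a
  finite sum of maps into summands iff such an idempotent with \<open>F\<close> finite fixes it; this form of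
  finiteness can be transported along arrows and along the shift without handling sums.\<close>

definition cutoff :: "'i set \<Rightarrow> 'o \<Rightarrow> ('i \<Rightarrow> 'm) \<Rightarrow> 'i set \<Rightarrow> 'm \<Rightarrow> bool" where
  "cutoff I S \<iota> F e \<longleftrightarrow> e \<in> Hom D S S \<and>
     (\<forall>i\<in>I. e \<cdot> \<iota> i = (if i \<in> F then \<iota> i else Zero D (Dom D (\<iota> i)) S))"

definition finitely_supported :: "'i set \<Rightarrow> 'o \<Rightarrow> ('i \<Rightarrow> 'm) \<Rightarrow> 'm \<Rightarrow> bool" where
  "finitely_supported I S \<iota> f \<longleftrightarrow> (\<exists>F e. finite F \<and> F \<subseteq> I \<and> cutoff I S \<iota> F e \<and> e \<cdot> f = f)"

lemma cutoff_Hom: "cutoff I S \<iota> F e \<Longrightarrow> e \<in> Hom D S S"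
  unfolding cutoff_def by blast

lemma cutoff_inj:
  "cutoff I S \<iota> F e \<Longrightarrow> i \<in> I \<Longrightarrow> e \<cdot> \<iota> i = (if i \<in> F then \<iota> i else Zero D (Dom D (\<iota> i)) S)"
  unfolding cutoff_def by blast

lemma cutoff_exists:
  assumes "is_coproduct D I M S \<iota>" obtains e where "cutoff I S \<iota> F e"
proof -
  note c = coproduct_Hom[OF assms]
  obtain e where "e \<in> Hom D S S"
    "\<And>i. i \<in> I \<Longrightarrow> e \<cdot> \<iota> i = (if i \<in> F then \<iota> i else Zero D (Dom D (\<iota> i)) S)"
    by (rule coproduct_map[OF assms c(1),
          of "\<lambda>i. if i \<in> F then \<iota> i else Zero D (Dom D (\<iota> i)) S"])
      (use c in auto)
  then show thesis using that unfolding cutoff_def by blast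
qed

lemma cutoff_absorb:
  assumes "is_coproduct D I M S \<iota>" "cutoff I S \<iota> F e" "cutoff I S \<iota> G e'" "F \<inter> I \<subseteq> G"
  shows "e' \<cdot> e = e"
proof (rule coproduct_unique[OF assms(1)])
  note c = coproduct_Hom[OF assms(1)] and e = cutoff_Hom[OF assms(2)] and e' = cutoff_Hom[OF assms(3)]
  show "e' \<cdot> e \<in> Hom D S S" "e \<in> Hom D S S" using e e' by auto
  fix i assume i: "i \<in> I"
  show "(e' \<cdot> e) \<cdot> \<iota> i = e \<cdot> \<iota> i"
    using cutoff_inj[OF assms(2) i] cutoff_inj[OF assms(3) i] c(1) c(2,3)[OF i] e e' i assms(4) by auto
qed

lemma cutoff_empty:
  assumes "is_coproduct D I M S \<iota>" "cutoff I S \<iota> {} e" shows "e = Zero D S S"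
proof (rule coproduct_unique[OF assms(1)])
  note c = coproduct_Hom[OF assms(1)]
  show "e \<in> Hom D S S" "Zero D S S \<in> Hom D S S" using cutoff_Hom[OF assms(2)] c by auto
  show "e \<cdot> \<iota> i = Zero D S S \<cdot> \<iota> i" if "i \<in> I" for i
    using cutoff_inj[OF assms(2) that] c(1) c(3)[OF that] by auto
qed

lemma cutoff_insert:
  assumes "is_coproduct D I M S \<iota>" "cutoff I S \<iota> F e" "cutoff I S \<iota> (insert i F) e'"
    and i: "i \<in> I" "i \<notin> F" and p: "p \<in> Hom D S (M i)" "p \<cdot> \<iota> i = Id D (M i)"
      "\<And>j. j \<in> I \<Longrightarrow> j \<noteq> i \<Longrightarrow> p \<cdot> \<iota> j = Zero D (M j) (M i)"
  shows "e' = \<iota> i \<cdot> p \<boxplus> e"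
proof (rule coproduct_unique[OF assms(1)])
  note c = coproduct_Hom[OF assms(1)] and e = cutoff_Hom[OF assms(2)] and e' = cutoff_Hom[OF assms(3)]
  show "e' \<in> Hom D S S" "\<iota> i \<cdot> p \<boxplus> e \<in> Hom D S S" using e e' p(1) c(3)[OF i(1)] by auto
  fix j assume j: "j \<in> I"
  have "(\<iota> i \<cdot> p \<boxplus> e) \<cdot> \<iota> j = \<iota> i \<cdot> (p \<cdot> \<iota> j) \<boxplus> e \<cdot> \<iota> j"
    using e p(1) c(3)[OF i(1)] c(3)[OF j] by simp
  also have "\<dots> = e' \<cdot> \<iota> j"
  proof (cases "j = i")
    case True
    then show ?thesis using i p(2) c(1) c(2)[OF i(1)] c(3)[OF i(1)]
        cutoff_inj[OF assms(2) j] cutoff_inj[OF assms(3) j] by auto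
  next
    case False
    then show ?thesis using i p(3)[OF j False] c(1) c(2)[OF i(1)] c(3)[OF i(1)] c(2,3)[OF j]
        cutoff_inj[OF assms(2) j] cutoff_inj[OF assms(3) j] by auto
  qed
  finally show "e' \<cdot> \<iota> j = (\<iota> i \<cdot> p \<boxplus> e) \<cdot> \<iota> j" ..
qed

text \<open>Induction along the summands of a finitely supported map, with the sums left implicit.\<close>

lemma finitely_supported_mem:
  assumes cop: "is_coproduct D I M S \<iota>" and f: "finitely_supported I S \<iota> f" "f \<in> Hom D P S"
    and zero: "Zero D P S \<in> B" and plus: "\<And>g h. g \<in> B \<Longrightarrow> h \<in> B \<Longrightarrow> g \<boxplus> h \<in> B"
    and summand: "\<And>i p. i \<in> I \<Longrightarrow> p \<in> Hom D S (M i) \<Longrightarrow> p \<cdot> \<iota> i = Id D (M i)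
      \<Longrightarrow> (\<And>j. j \<in> I \<Longrightarrow> j \<noteq> i \<Longrightarrow> p \<cdot> \<iota> j = Zero D (M j) (M i)) \<Longrightarrow> \<iota> i \<cdot> (p \<cdot> f) \<in> B"
  shows "f \<in> B"
proof -
  note c = coproduct_Hom[OF cop]
  obtain F e where F: "finite F" "F \<subseteq> I" "cutoff I S \<iota> F e" "e \<cdot> f = f"
    using f(1) unfolding finitely_supported_def by blast
  obtain \<pi> where \<pi>: "\<And>i. i \<in> I \<Longrightarrow> \<pi> i \<in> Hom D S (M i)" "\<And>i. i \<in> I \<Longrightarrow> \<pi> i \<cdot> \<iota> i = Id D (M i)"
    "\<And>i j. i \<in> I \<Longrightarrow> j \<in> I \<Longrightarrow> j \<noteq> i \<Longrightarrow> \<pi> i \<cdot> \<iota> j = Zero D (M j) (M i)"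
    using coproduct_projections[OF cop] by blast
  have "e \<cdot> f \<in> B" if "finite F" "F \<subseteq> I" "cutoff I S \<iota> F e" for F e
    using that
  proof (induction F arbitrary: e rule: finite_induct)
    case empty
    then have "e = Zero D S S" using cutoff_empty[OF cop] by blast
    then have "e \<cdot> f = Zero D P S" using f(2) c(1) by simp
    then show ?case using zero by simp
  next
    case (insert i F)
    then have i: "i \<in> I" by blast
    obtain e0 where e0: "cutoff I S \<iota> F e0" using cutoff_exists[OF cop] .
    have "e = \<iota> i \<cdot> \<pi> i \<boxplus> e0"
      using cutoff_insert[OF cop e0 insert.prems(2) i insert.hyps(2)] \<pi> i by blast
    then have "e \<cdot> f = \<iota> i \<cdot> (\<pi> i \<cdot> f) \<boxplus> e0 \<cdot> f"
      using cutoff_Hom[OF e0] \<pi>(1)[OF i] c(3)[OF i] f(2) by simp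
    moreover have "\<iota> i \<cdot> (\<pi> i \<cdot> f) \<in> B" by (rule summand) (use i \<pi> in blast)+
    ultimately show ?case using plus insert.IH[OF _ e0] insert.prems(1) by auto
  qed
  then show ?thesis using F by metis
qed

lemma comp_finprod:
  assumes "finite F" "\<And>i. i \<in> F \<Longrightarrow> y i \<in> Hom D P S" "g \<in> Hom D S Y" "P \<in> Ob D"
  shows "g \<cdot> finprod (hom_group D P S) y F = finprod (hom_group D P Y) (\<lambda>i. g \<cdot> y i) F"
proof -
  have Ob: "S \<in> Ob D" "Y \<in> Ob D" using assms(3) Hom_Ob by blast+
  interpret S: comm_group "hom_group D P S" by (rule comm_group_Hom[OF assms(4) Ob(1)])
  interpret Y: comm_group "hom_group D P Y" by (rule comm_group_Hom[OF assms(4) Ob(2)])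
  show ?thesis using assms(1,2)
  proof (induction F rule: finite_induct)
    case empty then show ?case using assms Ob by simp
  next
    case (insert i F)
    have 1: "y i \<in> Hom D P S" "y \<in> F \<rightarrow> Hom D P S" using insert.prems by blast+
    then have 2: "g \<cdot> y i \<in> Hom D P Y" "(\<lambda>i. g \<cdot> y i) \<in> F \<rightarrow> Hom D P Y"
      using Comp_in_Hom[OF _ assms(3)] by blast+
    have 3: "finprod (hom_group D P S) y F \<in> Hom D P S"
      using S.finprod_closed[of y F] 1 by (simp only: hom_group_simps)
    have "finprod (hom_group D P S) y (insert i F) = y i \<boxplus> finprod (hom_group D P S) y F"
      using S.finprod_insert[of F i y] insert.hyps 1
      by (simp only: hom_group_simps simp_thms True_implies_equals)
    moreover have "finprod (hom_group D P Y) (\<lambda>i. g \<cdot> y i) (insert i F)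
        = g \<cdot> y i \<boxplus> finprod (hom_group D P Y) (\<lambda>i. g \<cdot> y i) F"
      using Y.finprod_insert[of F i "\<lambda>i. g \<cdot> y i"] insert.hyps 2
      by (simp only: hom_group_simps simp_thms True_implies_equals)
    moreover have "g \<cdot> finprod (hom_group D P S) y F = finprod (hom_group D P Y) (\<lambda>i. g \<cdot> y i) F"
      using insert by blast
    ultimately show ?case using 1 3 assms(3) by simp
  qed
qed

lemma cutoff_eq_finprod:
  assumes cop: "is_coproduct D I M S \<iota>" and F: "finite F" "F \<subseteq> I" "cutoff I S \<iota> F e"
    and f: "f \<in> Hom D P S"
    and \<pi>: "\<And>i. i \<in> I \<Longrightarrow> \<pi> i \<in> Hom D S (M i)" "\<And>i. i \<in> I \<Longrightarrow> \<pi> i \<cdot> \<iota> i = Id D (M i)"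
      "\<And>i j. i \<in> I \<Longrightarrow> j \<in> I \<Longrightarrow> j \<noteq> i \<Longrightarrow> \<pi> i \<cdot> \<iota> j = Zero D (M j) (M i)"
  shows "e \<cdot> f = finprod (hom_group D P S) (\<lambda>i. \<iota> i \<cdot> (\<pi> i \<cdot> f)) F"
proof -
  note c = coproduct_Hom[OF cop]
  have P: "P \<in> Ob D" using f Hom_Ob by blast
  interpret S: comm_group "hom_group D P S" by (rule comm_group_Hom[OF P c(1)])
  have in_Hom: "\<iota> i \<cdot> (\<pi> i \<cdot> f) \<in> Hom D P S" if "i \<in> I" for i
    using \<pi>(1)[OF that] c(3)[OF that] f by simp
  show ?thesis using F
  proof (induction F arbitrary: e rule: finite_induct)
    case empty
    then have "e = Zero D S S" using cutoff_empty[OF cop] by blast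
    then show ?case using f c(1) by simp
  next
    case (insert i F)
    then have i: "i \<in> I" "F \<subseteq> I" by blast+
    obtain e0 where e0: "cutoff I S \<iota> F e0" using cutoff_exists[OF cop] .
    have "e = \<iota> i \<cdot> \<pi> i \<boxplus> e0"
      using cutoff_insert[OF cop e0 insert.prems(2) i(1) insert.hyps(2)] \<pi> i by blast
    then have "e \<cdot> f = \<iota> i \<cdot> (\<pi> i \<cdot> f) \<boxplus> e0 \<cdot> f"
      using cutoff_Hom[OF e0] \<pi>(1)[OF i(1)] c(3)[OF i(1)] f by simp
    also have "\<dots> = finprod (hom_group D P S) (\<lambda>i. \<iota> i \<cdot> (\<pi> i \<cdot> f)) (insert i F)"
    proof -
      have "(\<lambda>i. \<iota> i \<cdot> (\<pi> i \<cdot> f)) \<in> F \<rightarrow> Hom D P S" using in_Hom i(2) by blast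
      then show ?thesis
        using S.finprod_insert[of F i "\<lambda>i. \<iota> i \<cdot> (\<pi> i \<cdot> f)"] insert.hyps insert.IH[OF i(2) e0] in_Hom[OF i(1)]
        by (simp only: hom_group_simps simp_thms True_implies_equals)
    qed
    finally show ?case .
  qed
qed

end

context triangulated_category
begin

text \<open>Compactness without the groups: since the injections of a coproduct are split, the canonical
  map from the direct sum is always injective, and only its surjectivity is in question.\<close>

lemma compact_objectI:
  fixes U :: "'u set"
  assumes P: "P \<in> Ob D"
    and supp: "\<And>(I :: 'u set) M S \<iota> f. I \<prec> U \<Longrightarrow> is_coproduct D I M S \<iota> \<Longrightarrow> f \<in> Hom D P S
      \<Longrightarrow> finitely_supported I S \<iota> f"
  shows "compact_object D U P"
  unfolding compact_object_def
proof (intro conjI allI impI P, elim conjE)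
  fix I :: "'u set" and M S \<iota> assume I: "I \<prec> U" and cop: "is_coproduct D I M S \<iota>"
  note c = coproduct_Hom[OF cop]
  let ?G = "hom_group D P S" and ?A = "\<lambda>i. hom_group D P (M i)"
  let ?\<phi> = "\<lambda>x. gfinprod ?G (\<lambda>i. \<iota> i \<cdot> x i) I"
  interpret S: comm_group ?G by (rule comm_group_Hom[OF P c(1)])
  have grp: "group (?A i)" if "i \<in> I" for i
    using comm_group_Hom[OF P c(2)[OF that]] by (simp add: comm_group.axioms)
  obtain \<pi> where \<pi>: "\<And>i. i \<in> I \<Longrightarrow> \<pi> i \<in> Hom D S (M i)" "\<And>i. i \<in> I \<Longrightarrow> \<pi> i \<cdot> \<iota> i = Id D (M i)"
    "\<And>i j. i \<in> I \<Longrightarrow> j \<in> I \<Longrightarrow> j \<noteq> i \<Longrightarrow> \<pi> i \<cdot> \<iota> j = Zero D (M j) (M i)"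
    using coproduct_projections[OF cop] by blast
  have car: "carrier (sum_group I ?A)
      = {x \<in> \<Pi>\<^sub>E i\<in>I. Hom D P (M i). finite {i \<in> I. x i \<noteq> Zero D P (M i)}}"
    using carrier_sum_group[of I ?A] grp by (simp only: hom_group_simps)
  have \<iota>x: "\<iota> i \<cdot> x \<in> Hom D P S" if "i \<in> I" "x \<in> Hom D P (M i)" for i x
    using c(3)[OF that(1)] that(2) by simp
  have hom: "?\<phi> \<in> hom (sum_group I ?A) ?G"
  proof (rule S.hom_group_sum)
    show "(\<lambda>x. \<iota> i \<cdot> x) \<in> hom (?A i) ?G" if "i \<in> I" for i
      using c(3)[OF that] by (auto simp: hom_def)
  qed (rule grp)
  have fin: "?\<phi> x = finprod ?G (\<lambda>i. \<iota> i \<cdot> x i) F"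
    if x: "x \<in> carrier (sum_group I ?A)" and F: "finite F" "F \<subseteq> I"
      "\<And>i. i \<in> I - F \<Longrightarrow> x i = Zero D P (M i)" for x F
  proof -
    have xi: "x i \<in> Hom D P (M i)" if "i \<in> I" for i using x that unfolding car by blast
    have "?\<phi> x = gfinprod ?G (\<lambda>i. \<iota> i \<cdot> x i) F"
    proof (rule S.gfinprod_mono_neutral_cong_right[OF F(2)])
      show "\<iota> i \<cdot> x i = one ?G" if "i \<in> I - F" for i
        using F(3)[OF that] c(3)[of i] P that by simp
      show "(\<lambda>i. \<iota> i \<cdot> x i) \<in> I \<rightarrow> carrier ?G" using \<iota>x xi by (simp only: hom_group_simps) blast
    qed simp
    also have "\<dots> = finprod ?G (\<lambda>i. \<iota> i \<cdot> x i) F"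
      by (rule S.gfinprod_eq_finprod[OF F(1)]) (use \<iota>x xi F(2) in \<open>simp only: hom_group_simps; blast\<close>)
    finally show ?thesis .
  qed
  have component: "\<pi> j \<cdot> ?\<phi> x = x j" if x: "x \<in> carrier (sum_group I ?A)" and j: "j \<in> I" for x j
  proof -
    have xi: "x i \<in> Hom D P (M i)" if "i \<in> I" for i using x that unfolding car by blast
    let ?F = "insert j {i \<in> I. x i \<noteq> Zero D P (M i)}"
    have F: "finite ?F" "?F \<subseteq> I" using x j unfolding car by auto
    interpret M: comm_group "?A j" by (rule comm_group_Hom[OF P c(2)[OF j]])
    have "?\<phi> x = finprod ?G (\<lambda>i. \<iota> i \<cdot> x i) ?F" by (rule fin[OF x F]) blast
    then have "\<pi> j \<cdot> ?\<phi> x = \<pi> j \<cdot> finprod ?G (\<lambda>i. \<iota> i \<cdot> x i) ?F" by (simp only:)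
    also have "\<dots> = finprod (?A j) (\<lambda>i. \<pi> j \<cdot> (\<iota> i \<cdot> x i)) ?F"
      by (rule comp_finprod[OF F(1) _ \<pi>(1)[OF j] P]) (use \<iota>x xi F(2) in blast)
    also have "\<dots> = finprod (?A j) (\<lambda>i. \<pi> j \<cdot> (\<iota> i \<cdot> x i)) {j}"
    proof (rule M.finprod_mono_neutral_cong_right)
      show "\<pi> j \<cdot> (\<iota> i \<cdot> x i) = one (?A j)" if "i \<in> ?F - {j}" for i
      proof -
        have i: "i \<in> I" "i \<noteq> j" using that F(2) by blast+
        show ?thesis
          using assoc_subst[OF \<pi>(3)[OF j i] c(3)[OF i(1)] \<pi>(1)[OF j], of "x i"] xi[OF i(1)] c(2)[OF j] by simp
      qed
      show "(\<lambda>i. \<pi> j \<cdot> (\<iota> i \<cdot> x i)) \<in> ?F \<rightarrow> carrier (?A j)"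
        using \<iota>x xi F(2) \<pi>(1)[OF j] Comp_in_Hom by (simp only: hom_group_simps) blast
    qed (use F in auto)
    also have "\<dots> = \<pi> j \<cdot> (\<iota> j \<cdot> x j)"
    proof -
      have "\<pi> j \<cdot> (\<iota> j \<cdot> x j) \<in> carrier (?A j)"
        using Comp_in_Hom[OF \<iota>x[OF j xi[OF j]] \<pi>(1)[OF j]] by (simp only: hom_group_simps)
      then show ?thesis
        using M.finprod_insert[of "{}" j "\<lambda>i. \<pi> j \<cdot> (\<iota> i \<cdot> x i)"] by (simp del: hom_group_simps Hom_iff)
    qed
    also have "\<dots> = x j"
      using assoc_subst[OF \<pi>(2)[OF j] c(3)[OF j] \<pi>(1)[OF j], of "x j"] xi[OF j] by simp
    finally show ?thesis .
  qed
  have "inj_on ?\<phi> (carrier (sum_group I ?A))"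
  proof (rule inj_onI)
    fix x y assume xy: "x \<in> carrier (sum_group I ?A)" "y \<in> carrier (sum_group I ?A)" "?\<phi> x = ?\<phi> y"
    have "x j = y j" if "j \<in> I" for j
      using component[OF xy(1) that] component[OF xy(2) that] xy(3) by metis
    moreover have "x \<in> (\<Pi>\<^sub>E i\<in>I. Hom D P (M i))" "y \<in> (\<Pi>\<^sub>E i\<in>I. Hom D P (M i))"
      using xy(1,2) unfolding car by blast+
    ultimately show "x = y" by (intro PiE_ext)
  qed
  moreover have "?\<phi> ` carrier (sum_group I ?A) = carrier ?G"
  proof
    show "?\<phi> ` carrier (sum_group I ?A) \<subseteq> carrier ?G" using hom unfolding hom_def by blast
    show "carrier ?G \<subseteq> ?\<phi> ` carrier (sum_group I ?A)"
    proof
      fix f assume "f \<in> carrier ?G"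
      then have f: "f \<in> Hom D P S" by (simp only: hom_group_simps)
      obtain F e where F: "finite F" "F \<subseteq> I" "cutoff I S \<iota> F e" "e \<cdot> f = f"
        using supp[OF I cop f] unfolding finitely_supported_def by blast
      define x where "x = (\<lambda>i\<in>I. if i \<in> F then \<pi> i \<cdot> f else Zero D P (M i))"
      have x: "x \<in> carrier (sum_group I ?A)"
      proof -
        have "x i \<in> Hom D P (M i)" if "i \<in> I" for i
          using \<pi>(1)[OF that] f P c(2)[OF that] by (simp add: x_def that)
        moreover have "{i \<in> I. x i \<noteq> Zero D P (M i)} \<subseteq> F" by (auto simp: x_def)
        ultimately show ?thesis
          using finite_subset[OF _ F(1)] unfolding car by (auto simp: x_def PiE_iff extensional_def)
      qed
      have "?\<phi> x = finprod ?G (\<lambda>i. \<iota> i \<cdot> x i) F" by (rule fin[OF x F(1,2)]) (simp add: x_def)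
      also have "\<dots> = finprod ?G (\<lambda>i. \<iota> i \<cdot> (\<pi> i \<cdot> f)) F"
      proof (rule S.finprod_cong')
        show "(\<lambda>i. \<iota> i \<cdot> (\<pi> i \<cdot> f)) \<in> F \<rightarrow> carrier ?G"
          using \<iota>x Comp_in_Hom[OF f \<pi>(1)] F(2) by (simp only: hom_group_simps) blast
        show "\<iota> i \<cdot> x i = \<iota> i \<cdot> (\<pi> i \<cdot> f)" if "i \<in> F" for i
          using that F(2) by (simp add: x_def subset_iff)
      qed simp
      also have "\<dots> = f"
        using cutoff_eq_finprod[OF cop F(1-3) f \<pi>] F(4) by simp
      finally show "f \<in> ?\<phi> ` carrier (sum_group I ?A)" using x by blast
    qed
  qed
  ultimately show "?\<phi> \<in> iso (sum_group I ?A) ?G" using hom unfolding iso_def bij_betw_def by blast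
qed

text \<open>Conversely, an element of the direct sum with support \<open>F\<close> is sent to a map that the idempotent
  of \<open>F\<close> fixes, summand by summand.\<close>

lemma compact_object_finitely_supported_U:
  fixes U :: "'u set" and I :: "'u set"
  assumes P: "compact_object D U P" and I: "I \<prec> U" and cop: "is_coproduct D I M S \<iota>"
    and f: "f \<in> Hom D P S"
  shows "finitely_supported I S \<iota> f"
proof -
  note c = coproduct_Hom[OF cop]
  have Ob: "P \<in> Ob D" using P unfolding compact_object_def by blast
  let ?G = "hom_group D P S" and ?A = "\<lambda>i. hom_group D P (M i)"
  let ?\<phi> = "\<lambda>x. gfinprod ?G (\<lambda>i. \<iota> i \<cdot> x i) I"
  interpret S: comm_group ?G by (rule comm_group_Hom[OF Ob c(1)])
  have grp: "group (?A i)" if "i \<in> I" for i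
    using comm_group_Hom[OF Ob c(2)[OF that]] by (simp add: comm_group.axioms)
  have car: "carrier (sum_group I ?A)
      = {x \<in> \<Pi>\<^sub>E i\<in>I. Hom D P (M i). finite {i \<in> I. x i \<noteq> Zero D P (M i)}}"
    using carrier_sum_group[of I ?A] grp by (simp only: hom_group_simps)
  have "?\<phi> \<in> iso (sum_group I ?A) ?G" using P I cop unfolding compact_object_def by blast
  then have "f \<in> ?\<phi> ` carrier (sum_group I ?A)" using f unfolding iso_def bij_betw_def by simp
  then obtain x where x: "x \<in> carrier (sum_group I ?A)" "f = ?\<phi> x" by blast
  have xi: "x i \<in> Hom D P (M i)" if "i \<in> I" for i using x that unfolding car by blast
  have \<iota>x: "\<iota> i \<cdot> x i \<in> Hom D P S" if "i \<in> I" for i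
    using c(3)[OF that] xi[OF that] by simp
  let ?F = "{i \<in> I. x i \<noteq> Zero D P (M i)}"
  have F: "finite ?F" "?F \<subseteq> I" using x unfolding car by auto
  have "f = gfinprod ?G (\<lambda>i. \<iota> i \<cdot> x i) ?F" unfolding x(2)
  proof (rule S.gfinprod_mono_neutral_cong_right[OF F(2)])
    show "\<iota> i \<cdot> x i = one ?G" if "i \<in> I - ?F" for i
      using c(3)[of i] Ob that by simp
    show "(\<lambda>i. \<iota> i \<cdot> x i) \<in> I \<rightarrow> carrier ?G" using \<iota>x by (simp only: hom_group_simps) blast
  qed simp
  also have "\<dots> = finprod ?G (\<lambda>i. \<iota> i \<cdot> x i) ?F"
    by (rule S.gfinprod_eq_finprod[OF F(1)]) (use \<iota>x in \<open>simp only: hom_group_simps; blast\<close>)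
  finally have fsum: "f = finprod ?G (\<lambda>i. \<iota> i \<cdot> x i) ?F" .
  obtain e where e: "cutoff I S \<iota> ?F e" using cutoff_exists[OF cop] .
  have "e \<cdot> f = finprod ?G (\<lambda>i. e \<cdot> (\<iota> i \<cdot> x i)) ?F" unfolding fsum
    by (rule comp_finprod[OF F(1) _ cutoff_Hom[OF e] Ob]) (use \<iota>x in blast)
  also have "\<dots> = f" unfolding fsum
  proof (rule S.finprod_cong')
    show "(\<lambda>i. \<iota> i \<cdot> x i) \<in> ?F \<rightarrow> carrier ?G" using \<iota>x by (simp only: hom_group_simps) blast
    show "e \<cdot> (\<iota> i \<cdot> x i) = \<iota> i \<cdot> x i" if "i \<in> ?F" for i
    proof -
      have i: "i \<in> I" using that by blast
      have "e \<cdot> \<iota> i = \<iota> i" using cutoff_inj[OF e i] that by simp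
      then show ?thesis
        using assoc_subst[OF _ c(3)[OF i] cutoff_Hom[OF e], of "\<iota> i" "x i"] xi[OF i] by simp
    qed
  qed simp
  finally show ?thesis unfolding finitely_supported_def using F e by blast
qed

lemma compact_object_finitely_supported:
  fixes U :: "'u set" and A :: "'i set"
  assumes "universe U" and P: "compact_object D U P" and A: "A \<prec> U"
    and cop: "is_coproduct D A M S \<iota>" and f: "f \<in> Hom D P S"
  shows "finitely_supported A S \<iota> f"
proof -
  obtain I :: "'u set" and b where I: "I \<prec> U" "bij_betw b I A"
    using universe.small_index[OF assms(1) A] .
  obtain F e where F: "finite F" "F \<subseteq> I" "cutoff I S (\<iota> \<circ> b) F e" "e \<cdot> f = f"
    using compact_object_finitely_supported_U[OF P I(1) coproduct_reindex[OF cop I(2)] f]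
    unfolding finitely_supported_def by blast
  have "cutoff A S \<iota> (b ` F) e"
    unfolding cutoff_def
  proof (intro conjI ballI cutoff_Hom[OF F(3)])
    fix a assume "a \<in> A"
    then obtain i where i: "i \<in> I" "a = b i" using I(2) by (auto simp: bij_betw_def)
    have "a \<in> b ` F \<longleftrightarrow> i \<in> F" using i F(2) I(2) by (auto simp: bij_betw_def inj_on_def)
    then show "e \<cdot> \<iota> a = (if a \<in> b ` F then \<iota> a else Zero D (Dom D (\<iota> a)) S)"
      using cutoff_inj[OF F(3) i(1)] i(2) by simp
  qed
  moreover have "finite (b ` F)" "b ` F \<subseteq> A" using F I(2) by (auto simp: bij_betw_def)
  ultimately show ?thesis using F(4) unfolding finitely_supported_def by blast
qed

text \<open>The shift is an equivalence, hence preserves coproducts; as it has no chosen inverse, a coproduct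
  is shifted back by choosing desuspensions of its summands and of the coproduct separately.\<close>

lemma coproduct_shift:
  assumes cop: "is_coproduct D I M S \<iota>"
  shows "is_coproduct D I (\<lambda>i. \<Sigma> (M i)) (\<Sigma> S) (\<lambda>i. \<Sigma>\<^sub>a (\<iota> i))"
proof (rule is_coproductI)
  note c = coproduct_Hom[OF cop]
  show "\<Sigma> S \<in> Ob D" using c by simp
  show "\<Sigma>\<^sub>a (\<iota> i) \<in> Hom D (\<Sigma> (M i)) (\<Sigma> S)" if "i \<in> I" for i using c(3)[OF that] by simp
  show "\<exists>h. h \<in> Hom D (\<Sigma> S) Y \<and> (\<forall>i\<in>I. h \<cdot> \<Sigma>\<^sub>a (\<iota> i) = g i)"
    if Y: "Y \<in> Ob D" and g: "\<And>i. i \<in> I \<Longrightarrow> g i \<in> Hom D (\<Sigma> (M i)) Y" for Y g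
  proof -
    obtain Y' a b where Y': "Y' \<in> Ob D" "a \<in> Hom D (\<Sigma> Y') Y" "b \<in> Hom D Y (\<Sigma> Y')"
      "b \<cdot> a = Id D (\<Sigma> Y')" "a \<cdot> b = Id D Y" using shift_surj[OF Y] .
    have "\<exists>g'. g' \<in> Hom D (M i) Y' \<and> \<Sigma>\<^sub>a g' = b \<cdot> g i" if "i \<in> I" for i
      using shift_full[OF Comp_in_Hom[OF g[OF that] Y'(3)] c(2)[OF that] Y'(1)] by blast
    then obtain g' where g': "\<And>i. i \<in> I \<Longrightarrow> g' i \<in> Hom D (M i) Y'"
      "\<And>i. i \<in> I \<Longrightarrow> \<Sigma>\<^sub>a (g' i) = b \<cdot> g i" by metis
    obtain h where h: "h \<in> Hom D S Y'" "\<And>i. i \<in> I \<Longrightarrow> h \<cdot> \<iota> i = g' i"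
      using coproduct_map[OF cop Y'(1), of g'] g'(1) by metis
    have "(a \<cdot> \<Sigma>\<^sub>a h) \<cdot> \<Sigma>\<^sub>a (\<iota> i) = g i" if i: "i \<in> I" for i
    proof -
      have "(a \<cdot> \<Sigma>\<^sub>a h) \<cdot> \<Sigma>\<^sub>a (\<iota> i) = a \<cdot> (b \<cdot> g i)"
        using shift_eq[OF h(2)[OF i] c(3)[OF i] h(1)] g'(2)[OF i] Y'(2) h(1) c(3)[OF i] by simp
      then show ?thesis using assoc_subst[OF Y'(5,3,2), of "g i"] g[OF i] by simp
    qed
    moreover have "a \<cdot> \<Sigma>\<^sub>a h \<in> Hom D (\<Sigma> S) Y" using h(1) Y'(2) by simp
    ultimately show ?thesis by blast
  qed
  show "f = g" if f: "f \<in> Hom D (\<Sigma> S) Y" and g: "g \<in> Hom D (\<Sigma> S) Y"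
    and eq: "\<And>i. i \<in> I \<Longrightarrow> f \<cdot> \<Sigma>\<^sub>a (\<iota> i) = g \<cdot> \<Sigma>\<^sub>a (\<iota> i)" for Y f g
  proof -
    have Y: "Y \<in> Ob D" using f Hom_Ob by blast
    obtain Y' a b where Y': "Y' \<in> Ob D" "a \<in> Hom D (\<Sigma> Y') Y" "b \<in> Hom D Y (\<Sigma> Y')"
      "b \<cdot> a = Id D (\<Sigma> Y')" "a \<cdot> b = Id D Y" using shift_surj[OF Y] .
    obtain f' where f': "f' \<in> Hom D S Y'" "\<Sigma>\<^sub>a f' = b \<cdot> f"
      using shift_full[OF Comp_in_Hom[OF f Y'(3)] c(1) Y'(1)] .
    obtain g' where g': "g' \<in> Hom D S Y'" "\<Sigma>\<^sub>a g' = b \<cdot> g"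
      using shift_full[OF Comp_in_Hom[OF g Y'(3)] c(1) Y'(1)] .
    have "f' = g'"
    proof (rule coproduct_unique[OF cop f'(1) g'(1)])
      fix i assume i: "i \<in> I"
      show "f' \<cdot> \<iota> i = g' \<cdot> \<iota> i"
        by (rule shift_faithful[of _ _ "M i" Y'])
          (use f' g' c(3)[OF i] eq[OF i] f g Y'(3) in simp_all)
    qed
    then have "a \<cdot> (b \<cdot> f) = a \<cdot> (b \<cdot> g)" using f'(2) g'(2) by simp
    then show ?thesis
      using assoc_subst[OF Y'(5,3,2), of f] assoc_subst[OF Y'(5,3,2), of g] f g by simp
  qed
qed

lemma coproduct_unshift:
  assumes cop: "is_coproduct D I M S \<iota>"
  obtains M' S' \<iota>' a b m n where "is_coproduct D I M' S' \<iota>'"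
    "a \<in> Hom D (\<Sigma> S') S" "b \<in> Hom D S (\<Sigma> S')" "b \<cdot> a = Id D (\<Sigma> S')" "a \<cdot> b = Id D S"
    "\<And>i. i \<in> I \<Longrightarrow> m i \<in> Hom D (\<Sigma> (M' i)) (M i)" "\<And>i. i \<in> I \<Longrightarrow> n i \<in> Hom D (M i) (\<Sigma> (M' i))"
    "\<And>i. i \<in> I \<Longrightarrow> m i \<cdot> n i = Id D (M i)" "\<And>i. i \<in> I \<Longrightarrow> a \<cdot> \<Sigma>\<^sub>a (\<iota>' i) = \<iota> i \<cdot> m i"
proof -
  note c = coproduct_Hom[OF cop]
  obtain S' a b where S': "S' \<in> Ob D" "a \<in> Hom D (\<Sigma> S') S" "b \<in> Hom D S (\<Sigma> S')"
    "b \<cdot> a = Id D (\<Sigma> S')" "a \<cdot> b = Id D S" using shift_surj[OF c(1)] .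
  have "\<exists>M' m n. M' \<in> Ob D \<and> m \<in> Hom D (\<Sigma> M') (M i) \<and> n \<in> Hom D (M i) (\<Sigma> M') \<and>
      n \<cdot> m = Id D (\<Sigma> M') \<and> m \<cdot> n = Id D (M i)" if "i \<in> I" for i
    using shift_surj[OF c(2)[OF that]] by metis
  then obtain M' m n where M': "\<And>i. i \<in> I \<Longrightarrow> M' i \<in> Ob D"
    "\<And>i. i \<in> I \<Longrightarrow> m i \<in> Hom D (\<Sigma> (M' i)) (M i)" "\<And>i. i \<in> I \<Longrightarrow> n i \<in> Hom D (M i) (\<Sigma> (M' i))"
    "\<And>i. i \<in> I \<Longrightarrow> n i \<cdot> m i = Id D (\<Sigma> (M' i))" "\<And>i. i \<in> I \<Longrightarrow> m i \<cdot> n i = Id D (M i)" by metis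
  have "\<exists>k. k \<in> Hom D (M' i) S' \<and> \<Sigma>\<^sub>a k = b \<cdot> (\<iota> i \<cdot> m i)" if "i \<in> I" for i
    using shift_full[OF Comp_in_Hom[OF Comp_in_Hom[OF M'(2)[OF that] c(3)[OF that]] S'(3)] M'(1)[OF that] S'(1)]
    by blast
  then obtain \<iota>' where \<iota>': "\<And>i. i \<in> I \<Longrightarrow> \<iota>' i \<in> Hom D (M' i) S'"
    "\<And>i. i \<in> I \<Longrightarrow> \<Sigma>\<^sub>a (\<iota>' i) = b \<cdot> (\<iota> i \<cdot> m i)" by metis
  have a\<iota>: "a \<cdot> \<Sigma>\<^sub>a (\<iota>' i) = \<iota> i \<cdot> m i" if "i \<in> I" for i
    using \<iota>'(2)[OF that] assoc_subst[OF S'(5,3,2), of "\<iota> i \<cdot> m i"] c(3)[OF that] M'(2)[OF that] by simp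
  have b\<iota>: "b \<cdot> \<iota> i = \<Sigma>\<^sub>a (\<iota>' i) \<cdot> n i" if "i \<in> I" for i
    using \<iota>'(2)[OF that] M'(5)[OF that] c(3)[OF that] M'(2,3)[OF that] S'(3) by simp
  have "is_coproduct D I M' S' \<iota>'"
  proof (rule is_coproductI[OF S'(1) \<iota>'(1)])
    show "\<exists>h. h \<in> Hom D S' Y \<and> (\<forall>i\<in>I. h \<cdot> \<iota>' i = g i)"
      if Y: "Y \<in> Ob D" and g: "\<And>i. i \<in> I \<Longrightarrow> g i \<in> Hom D (M' i) Y" for Y g
    proof -
      have "\<Sigma>\<^sub>a (g i) \<cdot> n i \<in> Hom D (M i) (\<Sigma> Y)" if "i \<in> I" for i
        using g[OF that] M'(3)[OF that] by simp
      then obtain h where h: "h \<in> Hom D S (\<Sigma> Y)" "\<And>i. i \<in> I \<Longrightarrow> h \<cdot> \<iota> i = \<Sigma>\<^sub>a (g i) \<cdot> n i"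
        using coproduct_map[OF cop shift_Ob[OF Y], of "\<lambda>i. \<Sigma>\<^sub>a (g i) \<cdot> n i"] by metis
      obtain h' where h': "h' \<in> Hom D S' Y" "\<Sigma>\<^sub>a h' = h \<cdot> a"
        using shift_full[OF Comp_in_Hom[OF S'(2) h(1)] S'(1) Y] .
      have "h' \<cdot> \<iota>' i = g i" if i: "i \<in> I" for i
      proof (rule shift_faithful)
        have "\<Sigma>\<^sub>a (h' \<cdot> \<iota>' i) = h \<cdot> (a \<cdot> \<Sigma>\<^sub>a (\<iota>' i))" using h' \<iota>'(1)[OF i] h(1) S'(2) by simp
        also have "\<dots> = (h \<cdot> \<iota> i) \<cdot> m i" using a\<iota>[OF i] h(1) c(3)[OF i] M'(2)[OF i] by simp
        also have "\<dots> = \<Sigma>\<^sub>a (g i) \<cdot> (n i \<cdot> m i)"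
          unfolding h(2)[OF i] using g[OF i] M'(2,3)[OF i] by (simp del: M')
        also have "\<dots> = \<Sigma>\<^sub>a (g i)" using M'(4)[OF i] g[OF i] by simp
        finally show "\<Sigma>\<^sub>a (h' \<cdot> \<iota>' i) = \<Sigma>\<^sub>a (g i)" .
      qed (use h' \<iota>' g i in auto)
      then show ?thesis using h' by blast
    qed
    show "f = g" if f: "f \<in> Hom D S' Y" and g: "g \<in> Hom D S' Y"
      and eq: "\<And>i. i \<in> I \<Longrightarrow> f \<cdot> \<iota>' i = g \<cdot> \<iota>' i" for Y f g
    proof -
      have "\<Sigma>\<^sub>a f \<cdot> b = \<Sigma>\<^sub>a g \<cdot> b"
      proof (rule coproduct_unique[OF cop])
        show "\<Sigma>\<^sub>a f \<cdot> b \<in> Hom D S (\<Sigma> Y)" "\<Sigma>\<^sub>a g \<cdot> b \<in> Hom D S (\<Sigma> Y)" using f g S'(3) by simp_all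
        fix i assume i: "i \<in> I"
        have "(\<Sigma>\<^sub>a k \<cdot> b) \<cdot> \<iota> i = \<Sigma>\<^sub>a (k \<cdot> \<iota>' i) \<cdot> n i" if "k \<in> Hom D S' Y" for k
          using that S'(3) c(3)[OF i] \<iota>'(1)[OF i] M'(3)[OF i] by (simp add: b\<iota>[OF i])
        then show "(\<Sigma>\<^sub>a f \<cdot> b) \<cdot> \<iota> i = (\<Sigma>\<^sub>a g \<cdot> b) \<cdot> \<iota> i" using f g eq[OF i] by metis
      qed
      then have "(\<Sigma>\<^sub>a f \<cdot> b) \<cdot> a = (\<Sigma>\<^sub>a g \<cdot> b) \<cdot> a" by simp
      then have "\<Sigma>\<^sub>a f = \<Sigma>\<^sub>a g" using f g S'(1-4) by simp
      then show ?thesis using shift_faithful f g by blast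
    qed
  qed
  then show thesis using that S' M' a\<iota> by metis
qed

lemma finitely_supported_unshift:
  assumes "finitely_supported I (\<Sigma> S) (\<lambda>i. \<Sigma>\<^sub>a (\<iota> i)) (\<Sigma>\<^sub>a f)" "is_coproduct D I M S \<iota>" "f \<in> Hom D P S"
  shows "finitely_supported I S \<iota> f"
proof -
  note c = coproduct_Hom[OF assms(2)]
  obtain F e where F: "finite F" "F \<subseteq> I" and e: "cutoff I (\<Sigma> S) (\<lambda>i. \<Sigma>\<^sub>a (\<iota> i)) F e" "e \<cdot> \<Sigma>\<^sub>a f = \<Sigma>\<^sub>a f"
    using assms(1) unfolding finitely_supported_def by blast
  obtain e' where e': "e' \<in> Hom D S S" "\<Sigma>\<^sub>a e' = e"
    using shift_full[OF cutoff_Hom[OF e(1)] c(1) c(1)] .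
  have "e' \<cdot> f = f" by (rule shift_faithful[of _ _ P S]) (use e(2) e' assms(3) in simp_all)
  moreover have "cutoff I S \<iota> F e'"
    unfolding cutoff_def
  proof (intro conjI ballI e'(1))
    fix i assume i: "i \<in> I"
    show "e' \<cdot> \<iota> i = (if i \<in> F then \<iota> i else Zero D (Dom D (\<iota> i)) S)"
      by (rule shift_faithful[of _ _ "M i" S])
        (use cutoff_inj[OF e(1) i] e' c(1) c(2,3)[OF i] in simp_all)
  qed
  ultimately show ?thesis unfolding finitely_supported_def using F by blast
qed

lemma finitely_supported_shift:
  assumes cop': "is_coproduct D I M' S' \<iota>'" and "finitely_supported I S' \<iota>' f'" "f' \<in> Hom D P S'"
    and "f \<in> Hom D (\<Sigma> P) S" "\<Sigma>\<^sub>a f' = b \<cdot> f" "is_coproduct D I M S \<iota>"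
    "a \<in> Hom D (\<Sigma> S') S" "b \<in> Hom D S (\<Sigma> S')" "b \<cdot> a = Id D (\<Sigma> S')" "a \<cdot> b = Id D S"
    "\<And>i. i \<in> I \<Longrightarrow> m i \<in> Hom D (\<Sigma> (M' i)) (M i)" "\<And>i. i \<in> I \<Longrightarrow> n i \<in> Hom D (M i) (\<Sigma> (M' i))"
    "\<And>i. i \<in> I \<Longrightarrow> m i \<cdot> n i = Id D (M i)" "\<And>i. i \<in> I \<Longrightarrow> a \<cdot> \<Sigma>\<^sub>a (\<iota>' i) = \<iota> i \<cdot> m i"
  shows "finitely_supported I S \<iota> f"
proof -
  note c = coproduct_Hom[OF assms(6)] and c' = coproduct_Hom[OF cop']
  obtain F e where F: "finite F" "F \<subseteq> I" and e: "cutoff I S' \<iota>' F e" "e \<cdot> f' = f'"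
    using assms(2) unfolding finitely_supported_def by blast
  note e0 = cutoff_Hom[OF e(1)]
  let ?e = "a \<cdot> (\<Sigma>\<^sub>a e \<cdot> b)"
  have b\<iota>: "b \<cdot> \<iota> i = \<Sigma>\<^sub>a (\<iota>' i) \<cdot> n i" if i: "i \<in> I" for i
  proof -
    have "\<iota> i = (a \<cdot> \<Sigma>\<^sub>a (\<iota>' i)) \<cdot> n i"
      unfolding assms(14)[OF i] using assms(11-13)[OF i] c(3)[OF i] by simp
    then have "b \<cdot> \<iota> i = b \<cdot> (a \<cdot> (\<Sigma>\<^sub>a (\<iota>' i) \<cdot> n i))"
      using assms(7) c'(3)[OF i] assms(12)[OF i] by simp
    also have "\<dots> = \<Sigma>\<^sub>a (\<iota>' i) \<cdot> n i"
      using assoc_subst[OF assms(9,7,8), of "\<Sigma>\<^sub>a (\<iota>' i) \<cdot> n i"] c'(3)[OF i] assms(12)[OF i] by simp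
    finally show ?thesis .
  qed
  have "cutoff I S \<iota> F ?e"
    unfolding cutoff_def
  proof (intro conjI ballI)
    show "?e \<in> Hom D S S" using e0 assms(7,8) by simp
    fix i assume i: "i \<in> I"
    have "?e \<cdot> \<iota> i = a \<cdot> (\<Sigma>\<^sub>a (e \<cdot> \<iota>' i) \<cdot> n i)"
      using e0 assms(7,8) c(3)[OF i] c'(3)[OF i] assms(12)[OF i] by (simp add: b\<iota>[OF i])
    also have "\<dots> = (if i \<in> F then \<iota> i else Zero D (Dom D (\<iota> i)) S)"
    proof (cases "i \<in> F")
      case True
      have "a \<cdot> (\<Sigma>\<^sub>a (e \<cdot> \<iota>' i) \<cdot> n i) = a \<cdot> (b \<cdot> \<iota> i)"
        using cutoff_inj[OF e(1) i] True b\<iota>[OF i] by simp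
      also have "\<dots> = \<iota> i" using assoc_subst[OF assms(10,8,7), of "\<iota> i"] c(3)[OF i] by simp
      finally show ?thesis using True by simp
    next
      case False
      then show ?thesis
        using cutoff_inj[OF e(1) i] c(1) c(2,3)[OF i] c'(1) c'(2,3)[OF i] assms(7) assms(12)[OF i] by simp
    qed
    finally show "?e \<cdot> \<iota> i = (if i \<in> F then \<iota> i else Zero D (Dom D (\<iota> i)) S)" .
  qed
  moreover have "?e \<cdot> f = f"
  proof -
    have "?e \<cdot> f = a \<cdot> (\<Sigma>\<^sub>a (e \<cdot> f'))" using e0 assms(3,4,5,7,8) by simp
    also have "\<dots> = a \<cdot> (b \<cdot> f)" using e(2) assms(5) by simp
    also have "\<dots> = f" using assoc_subst[OF assms(10,8,7), of f] assms(4) by simp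
    finally show ?thesis .
  qed
  ultimately show ?thesis unfolding finitely_supported_def using F by blast
qed

lemma compact_object_Ob: "compact_object D U P \<Longrightarrow> P \<in> Ob D"
  unfolding compact_object_def by blast

text \<open>Closure of compactness under cones, the only part that is not formal: a map out of a cone is
  cut off first on the second object of the triangle, and the remainder factors through the shift of
  the first object, where it is cut off again.\<close>

lemma triangulated_subcategory_compact:
  fixes U :: "'u set"
  shows "triangulated_subcategory D {P. compact_object D U P}"
proof (rule triangulated_subcategoryI)
  show "{P. compact_object D U P} \<subseteq> Ob D" using compact_object_Ob by blast
  show "Z \<in> {P. compact_object D U P}" if Z: "zero_object D Z" for Z
  proof (rule CollectI, rule compact_objectI)
    show "Z \<in> Ob D" using Z zero_object_def by metis
    fix I :: "'u set" and M S \<iota> f assume *: "is_coproduct D I M S \<iota>" "f \<in> Hom D Z S"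
    obtain e where e: "cutoff I S \<iota> {} e" using cutoff_exists[OF *(1)] .
    have "f = Zero D Z S" by (rule zero_object_Hom[OF Z *(2)]) simp
    moreover have "e \<cdot> f = Zero D Z S"
      by (rule zero_object_Hom[OF Z]) (use e *(2) cutoff_Hom in \<open>force+\<close>)
    ultimately show "finitely_supported I S \<iota> f"
      unfolding finitely_supported_def using e by (intro exI[of _ "{}"] exI[of _ e]) simp
  qed
  show "Q \<in> {P. compact_object D U P}" if P: "P \<in> {P. compact_object D U P}" and iso: "isomorphic D P Q" for P Q
  proof (rule CollectI, rule compact_objectI)
    show "Q \<in> Ob D" using iso iso_Ob by blast
    obtain g h where gh: "g \<in> Hom D P Q" "h \<in> Hom D Q P" "h \<cdot> g = Id D P" "g \<cdot> h = Id D Q"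
      using iso_obtain[OF iso] .
    fix I :: "'u set" and M S \<iota> f assume *: "I \<prec> U" "is_coproduct D I M S \<iota>" "f \<in> Hom D Q S"
    have "finitely_supported I S \<iota> (f \<cdot> g)"
      by (rule compact_object_finitely_supported_U[OF CollectD[OF P] *(1,2)]) (use gh *(3) in simp)
    then obtain F e where F: "finite F" "F \<subseteq> I" "cutoff I S \<iota> F e" "e \<cdot> (f \<cdot> g) = f \<cdot> g"
      unfolding finitely_supported_def by blast
    note e = cutoff_Hom[OF F(3)]
    have "(e \<cdot> (f \<cdot> g)) \<cdot> h = (f \<cdot> g) \<cdot> h" using F(4) by simp
    then have "e \<cdot> f = f" using e *(3) gh(1,2,4) by simp
    then show "finitely_supported I S \<iota> f" unfolding finitely_supported_def using F by blast
  qed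
  have up: "compact_object D U (\<Sigma> P)" if P: "compact_object D U P" for P
  proof (rule compact_objectI)
    show "\<Sigma> P \<in> Ob D" using compact_object_Ob[OF P] by simp
    fix I :: "'u set" and M S \<iota> f assume *: "I \<prec> U" "is_coproduct D I M S \<iota>" "f \<in> Hom D (\<Sigma> P) S"
    obtain M' S' \<iota>' a b m n where d: "is_coproduct D I M' S' \<iota>'"
      "a \<in> Hom D (\<Sigma> S') S" "b \<in> Hom D S (\<Sigma> S')" "b \<cdot> a = Id D (\<Sigma> S')" "a \<cdot> b = Id D S"
      "\<And>i. i \<in> I \<Longrightarrow> m i \<in> Hom D (\<Sigma> (M' i)) (M i)" "\<And>i. i \<in> I \<Longrightarrow> n i \<in> Hom D (M i) (\<Sigma> (M' i))"
      "\<And>i. i \<in> I \<Longrightarrow> m i \<cdot> n i = Id D (M i)" "\<And>i. i \<in> I \<Longrightarrow> a \<cdot> \<Sigma>\<^sub>a (\<iota>' i) = \<iota> i \<cdot> m i"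
      using coproduct_unshift[OF *(2)] by metis
    obtain f' where f': "f' \<in> Hom D P S'" "\<Sigma>\<^sub>a f' = b \<cdot> f"
      using shift_full[OF Comp_in_Hom[OF *(3) d(3)] compact_object_Ob[OF P] coproduct_Hom(1)[OF d(1)]] .
    show "finitely_supported I S \<iota> f"
      by (rule finitely_supported_shift[OF d(1) compact_object_finitely_supported_U[OF P *(1) d(1) f'(1)]
            f'(1) *(3) f'(2) *(2) d(2-9)])
  qed
  have down: "compact_object D U P" if P: "compact_object D U (\<Sigma> P)" "P \<in> Ob D" for P
  proof (rule compact_objectI[OF P(2)])
    fix I :: "'u set" and M S \<iota> f assume *: "I \<prec> U" "is_coproduct D I M S \<iota>" "f \<in> Hom D P S"
    have "\<Sigma>\<^sub>a f \<in> Hom D (\<Sigma> P) (\<Sigma> S)" using *(3) by simp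
    from compact_object_finitely_supported_U[OF P(1) *(1) coproduct_shift[OF *(2)] this]
    show "finitely_supported I S \<iota> f" by (rule finitely_supported_unshift[OF _ *(2,3)])
  qed
  show "X \<in> {P. compact_object D U P} \<longleftrightarrow> \<Sigma> X \<in> {P. compact_object D U P}" if "X \<in> Ob D" for X
    using up down that by blast
  show "R \<in> {P. compact_object D U P}"
    if T: "tri P Q R u v w" and P: "P \<in> {P. compact_object D U P}" and Q: "Q \<in> {P. compact_object D U P}"
    for P Q R u v w
  proof (rule CollectI, rule compact_objectI)
    note t = tri_Hom[OF T]
    show "R \<in> Ob D" by (fact t)
    fix I :: "'u set" and M S \<iota> f assume *: "I \<prec> U" "is_coproduct D I M S \<iota>" "f \<in> Hom D R S"
    have S: "S \<in> Ob D" using coproduct_Hom[OF *(2)] by blast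
    have "finitely_supported I S \<iota> (f \<cdot> v)"
      by (rule compact_object_finitely_supported_U[OF CollectD[OF Q] *(1,2)]) (use t *(3) in simp)
    then obtain F e where F: "finite F" "F \<subseteq> I" "cutoff I S \<iota> F e" "e \<cdot> (f \<cdot> v) = f \<cdot> v"
      unfolding finitely_supported_def by blast
    note e = cutoff_Hom[OF F(3)]
    \<comment> \<open>The part of \<open>f\<close> outside \<open>F\<close> vanishes on \<open>Q\<close>, so it comes from \<open>\<Sigma> P\<close>.\<close>
    let ?r = "f \<boxminus> e \<cdot> f"
    have r: "?r \<in> Hom D R S" using e *(3) by simp
    have "?r \<cdot> v = Zero D Q S" using e *(3) t F(4) by simp
    then obtain g where g: "g \<in> Hom D (\<Sigma> P) S" "g \<cdot> w = ?r" using extend_2[OF T r] by blast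
    obtain G e' where G: "finite G" "G \<subseteq> I" "cutoff I S \<iota> G e'" "e' \<cdot> g = g"
      using compact_object_finitely_supported_U[OF up[OF CollectD[OF P]] *(1,2) g(1)]
      unfolding finitely_supported_def by blast
    \<comment> \<open>The idempotent of \<open>F \<union> G\<close> fixes both parts of \<open>f\<close>.\<close>
    obtain e'' where e'': "cutoff I S \<iota> (F \<union> G) e''" using cutoff_exists[OF *(2)] .
    note e''0 = cutoff_Hom[OF e''] and e'0 = cutoff_Hom[OF G(3)]
    have 1: "e'' \<cdot> e = e" by (rule cutoff_absorb[OF *(2) F(3) e'']) blast
    have 2: "e'' \<cdot> e' = e'" by (rule cutoff_absorb[OF *(2) G(3) e'']) blast
    have "e'' \<cdot> g = e'' \<cdot> (e' \<cdot> g)" using G(4) by simp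
    also have "\<dots> = g" using assoc_subst[OF 2 e'0 e''0, of g] g(1) G(4) by simp
    finally have g': "e'' \<cdot> g = g" .
    have "e'' \<cdot> ?r = (e'' \<cdot> g) \<cdot> w" unfolding g(2)[symmetric] using e''0 g(1) t by simp
    then have 3: "e'' \<cdot> ?r = ?r" using g' g(2) by simp
    have 4: "e'' \<cdot> (e \<cdot> f) = e \<cdot> f" using assoc_subst[OF 1 e e''0, of f] *(3) by simp
    have f: "?r \<boxplus> e \<cdot> f = f" by (rule minus_plus_cancel(1)[OF *(3)]) (use e *(3) in simp)
    have "e'' \<cdot> f = e'' \<cdot> (?r \<boxplus> e \<cdot> f)" using f by simp
    also have "\<dots> = e'' \<cdot> ?r \<boxplus> e'' \<cdot> (e \<cdot> f)"
      by (rule comp_plus) (use r e''0 e *(3) in auto)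
    also have "\<dots> = f" using 3 4 f by simp
    finally have "e'' \<cdot> f = f" .
    then show "finitely_supported I S \<iota> f" unfolding finitely_supported_def using F(1,2) G(1,2) e''
      by (intro exI[of _ "F \<union> G"] exI[of _ e'']) simp
  qed
qed

text \<open>The cone of the zero arrow out of a desuspension of \<open>A\<close> is a biproduct of \<open>A\<close> and \<open>B\<close>; only the
  extension of arrows out of the summands is needed, and membership in \<open>\<Y>\<close> comes for free.\<close>

lemma weak_biproduct:
  assumes sub: "triangulated_subcategory D \<Y>" and A: "A \<in> \<Y>" and B: "B \<in> \<Y>"
  obtains K s t where "K \<in> \<Y>" "s \<in> Hom D A K" "t \<in> Hom D B K"
    "\<And>N f g. f \<in> Hom D A N \<Longrightarrow> g \<in> Hom D B N \<Longrightarrow> \<exists>h\<in>Hom D K N. h \<cdot> s = f \<and> h \<cdot> t = g"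
proof -
  note Ob = sub_Ob[OF sub A] sub_Ob[OF sub B]
  obtain J a b where J: "J \<in> \<Y>" "a \<in> Hom D (\<Sigma> J) A" "b \<in> Hom D A (\<Sigma> J)"
    "b \<cdot> a = Id D (\<Sigma> J)" "a \<cdot> b = Id D A" using sub_unshift[OF sub A] .
  note JOb = sub_Ob[OF sub J(1)]
  obtain K t w where T: "tri J B K (Zero D J B) t w"
    using Tri_extend[OF JOb Ob(2), of "Zero D J B"] JOb Ob by auto
  note t = tri_Hom[OF T]
  have "\<Sigma>\<^sub>a (Zero D J B) \<cdot> b = Zero D A (\<Sigma> B)" using J(3) JOb Ob by simp
  then obtain s where s: "s \<in> Hom D A K" "w \<cdot> s = b" using lift_3[OF T J(3)] by blast
  have "\<exists>h\<in>Hom D K N. h \<cdot> s = f \<and> h \<cdot> t = g"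
    if f: "f \<in> Hom D A N" and g: "g \<in> Hom D B N" for N f g
  proof -
    have N: "N \<in> Ob D" using f Hom_Ob by blast
    have "g \<cdot> Zero D J B = Zero D J N" using g JOb by simp
    then obtain r where r: "r \<in> Hom D K N" "r \<cdot> t = g" using extend_1[OF T g] by blast
    let ?d = "f \<boxminus> r \<cdot> s"
    have d: "?d \<in> Hom D A N" using f r(1) s(1) by simp
    let ?h = "r \<boxplus> ?d \<cdot> (a \<cdot> w)"
    have da: "?d \<cdot> (a \<cdot> w) \<in> Hom D K N" using d J(2) t(6) by simp
    have "?h \<cdot> s = r \<cdot> s \<boxplus> ?d \<cdot> (a \<cdot> (w \<cdot> s))"
      using r(1) da s(1) d J(2) t(6) by (simp del: s(2))
    also have "\<dots> = r \<cdot> s \<boxplus> ?d" using s(2) J(5) d by simp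
    also have "\<dots> = f" by (rule minus_plus_cancel(2)[OF f]) (use r(1) s(1) in simp)
    finally have 1: "?h \<cdot> s = f" .
    have "?h \<cdot> t = r \<cdot> t \<boxplus> ?d \<cdot> (a \<cdot> (w \<cdot> t))"
      using r(1) da t(5) d J(2) t(6) by simp
    also have "\<dots> = g"
      using r(2) comp_tri_2[OF T] d J(2) JOb Ob g N by simp
    finally have 2: "?h \<cdot> t = g" .
    show ?thesis using 1 2 r(1) da by (intro bexI[of _ ?h]) simp_all
  qed
  then show thesis using that sub_cone[OF sub T J(1) B] s(1) t(5) by blast
qed

end

context compactly_generated_triangulated_category
begin

lemma small_coproduct:
  assumes "A \<prec> U" "\<And>i. i \<in> A \<Longrightarrow> M i \<in> Ob D"
  obtains S \<iota> where "is_coproduct D A M S \<iota>"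
  using small_coproduct_exists[OF small_coproducts universe_axioms assms(1), of M] assms(2) by blast

section \<open>Essentially small triangulated subcategories\<close>

text \<open>A small set of objects is closed up under the shift, chosen desuspensions and chosen cones in
  countably many steps. The objects isomorphic to one in the result form a triangulated subcategory,
  because cones are unique up to isomorphism.\<close>

lemma essentially_small_hull:
  assumes G: "\<G> \<prec> U" "\<G> \<subseteq> Ob D"
  obtains \<K> where "\<K> \<prec> U" "\<K> \<subseteq> Ob D" "\<G> \<subseteq> \<K>"
    "triangulated_subcategory D {Q. \<exists>R\<in>\<K>. isomorphic D R Q}"
proof -
  obtain Z0 where Z0: "zero_object D Z0" using has_zero_object by blast
  have "\<exists>X'. X' \<in> Ob D \<and> isomorphic D (\<Sigma> X') X" if "X \<in> Ob D" for X
    using shift_surj[OF that] isoI(2) by metis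
  then obtain ds where ds: "\<And>X. X \<in> Ob D \<Longrightarrow> ds X \<in> Ob D \<and> isomorphic D (\<Sigma> (ds X)) X" by metis
  have "\<exists>Z v w. tri X Y Z u v w" if "u \<in> Hom D X Y" for u X Y
    using that Tri_extend Hom_Ob by blast
  then have "\<exists>Z v w. tri (Dom D u) (Cod D u) Z u v w" if "u \<in> Arr D" for u using that by simp
  then obtain cn where cn: "\<And>u. u \<in> Arr D \<Longrightarrow> \<exists>v w. tri (Dom D u) (Cod D u) (cn u) u v w" by metis
  define step where "step K = K \<union> (\<Sigma> ` K \<union> (ds ` K \<union> cn ` (\<Union>X\<in>K. \<Union>Y\<in>K. Hom D X Y)))" for K
  define K where "K n = (step ^^ n) (insert Z0 \<G>)" for n
  have K_Suc: "K (Suc n) = step (K n)" for n by (simp add: K_def)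
  have small: "K n \<prec> U \<and> K n \<subseteq> Ob D" for n
  proof (induction n)
    case 0
    have "insert Z0 \<G> = {Z0} \<union> \<G>" by simp
    moreover have "{Z0} \<prec> U" by (rule countable_small) simp
    ultimately have "insert Z0 \<G> \<prec> U" using small_Un[OF _ G(1)] by metis
    then show ?case using G(2) Z0 by (simp add: K_def zero_object_def)
  next
    case (Suc n)
    have hom: "(\<Union>X\<in>K n. \<Union>Y\<in>K n. Hom D X Y) \<prec> U"
      by (intro small_Union Suc[THEN conjunct1] locally_small) (use Suc in blast)+
    have "step (K n) \<prec> U" unfolding step_def
      by (intro small_Un small_image hom Suc[THEN conjunct1])
    moreover have "cn u \<in> Ob D" if "u \<in> Arr D" for u using cn[OF that] tri_Hom(3) by blast
    then have "step (K n) \<subseteq> Ob D" using Suc ds unfolding step_def by auto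
    ultimately show ?case unfolding K_Suc by blast
  qed
  define \<K> where "\<K> = (\<Union>n. K n)"
  have mono: "K m \<subseteq> K n" if "m \<le> n" for m n
    by (rule lift_Suc_mono_le[of K, OF _ that]) (auto simp: K_Suc step_def)
  have K0: "insert Z0 \<G> \<subseteq> \<K>" unfolding \<K>_def
    using UN_upper[of 0 UNIV K] by (simp add: K_def)
  have Kshift: "\<Sigma> X \<in> \<K>" "ds X \<in> \<K>" if X: "X \<in> \<K>" for X
  proof -
    obtain n where "X \<in> K n" using X unfolding \<K>_def by blast
    then have "\<Sigma> X \<in> K (Suc n)" "ds X \<in> K (Suc n)" unfolding K_Suc step_def by simp_all
    then show "\<Sigma> X \<in> \<K>" "ds X \<in> \<K>" unfolding \<K>_def by blast+
  qed
  have Kcone: "cn u \<in> \<K>" if XY: "X \<in> \<K>" "Y \<in> \<K>" "u \<in> Hom D X Y" for X Y u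
  proof -
    obtain m n where "X \<in> K m" "Y \<in> K n" using XY unfolding \<K>_def by blast
    then have "X \<in> K (max m n)" "Y \<in> K (max m n)" using mono[of m "max m n"] mono[of n "max m n"] by auto
    then have "u \<in> (\<Union>X\<in>K (max m n). \<Union>Y\<in>K (max m n). Hom D X Y)" using XY(3) by blast
    then have "cn u \<in> K (Suc (max m n))" unfolding K_Suc step_def by blast
    then show ?thesis unfolding \<K>_def by blast
  qed
  have KOb: "\<K> \<subseteq> Ob D" using small unfolding \<K>_def by blast
  let ?Y = "{Q. \<exists>R\<in>\<K>. isomorphic D R Q}"
  have "triangulated_subcategory D ?Y"
  proof (rule triangulated_subcategoryI)
    show "?Y \<subseteq> Ob D" using iso_Ob by blast
    show "Z \<in> ?Y" if "zero_object D Z" for Z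
      using zero_objects_isomorphic[OF Z0 that] K0 by blast
    show "Y \<in> ?Y" if "X \<in> ?Y" "isomorphic D X Y" for X Y using that iso_trans by blast
    show "X \<in> ?Y \<longleftrightarrow> \<Sigma> X \<in> ?Y" if X: "X \<in> Ob D" for X
    proof
      show "\<Sigma> X \<in> ?Y" if "X \<in> ?Y" using that Kshift(1) iso_shift by blast
      assume "\<Sigma> X \<in> ?Y"
      then obtain R where R: "R \<in> \<K>" "isomorphic D R (\<Sigma> X)" by blast
      then have "isomorphic D (\<Sigma> (ds R)) (\<Sigma> X)" "ds R \<in> Ob D" using ds KOb iso_trans by blast+
      then have "isomorphic D (ds R) X" using iso_unshift X by blast
      then show "X \<in> ?Y" using Kshift(2)[OF R(1)] by blast
    qed
    show "Z \<in> ?Y" if T: "tri X Y Z u v w" and X: "X \<in> ?Y" and Y: "Y \<in> ?Y" for X Y Z u v w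
    proof -
      note t = tri_Hom[OF T]
      obtain X' where X': "X' \<in> \<K>" "isomorphic D X' X" using X by blast
      obtain Y' where Y': "Y' \<in> \<K>" "isomorphic D Y' Y" using Y by blast
      obtain a a' where a: "a \<in> Hom D X X'" "a' \<in> Hom D X' X" "a' \<cdot> a = Id D X" "a \<cdot> a' = Id D X'"
        using iso_obtain[OF iso_sym[OF X'(2)]] .
      obtain b b' where b: "b \<in> Hom D Y Y'" "b' \<in> Hom D Y' Y" "b' \<cdot> b = Id D Y" "b \<cdot> b' = Id D Y'"
        using iso_obtain[OF iso_sym[OF Y'(2)]] .
      let ?u = "b \<cdot> (u \<cdot> a')"
      have u: "?u \<in> Hom D X' Y'" using a(2) b(1) t by simp
      have T1: "tri X' Y' Z ?u (v \<cdot> b') (\<Sigma>\<^sub>a a \<cdot> w)"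
        by (rule Tri_iso[OF T _ isoI(1)[OF a] isoI(1)[OF b] iso_Id[OF t(3)]])
          (use t a b X' Y' KOb in \<open>auto simp: triangle_shape_def\<close>)
      obtain v' w' where T2: "tri X' Y' (cn ?u) ?u v' w'" using cn[of ?u] u by auto
      have "isomorphic D (cn ?u) Z" by (rule cone_unique[OF T2 T1])
      then show ?thesis using Kcone[OF X'(1) Y'(1) u] by blast
    qed
  qed
  moreover have "\<K> \<prec> U" unfolding \<K>_def by (rule small_Union) (use small nat_small in auto)
  ultimately show thesis using that KOb K0 by blast
qed

section \<open>Milnor colimits\<close>

lemma Milnor_colimit_exists:
  assumes f: "\<And>n. f n \<in> Hom D (M n) (M (Suc n))"
  obtains C where "is_Milnor_colimit D M f C"
proof -
  have M: "M n \<in> Ob D" for n using f[of n] Hom_Ob by blast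
  obtain S \<iota> where cop: "is_coproduct D (UNIV :: nat set) M S \<iota>"
    using small_coproduct[OF nat_small, of M] M by blast
  note c = coproduct_Hom[OF cop]
  have "\<iota> (Suc n) \<cdot> f n \<in> Hom D (M n) S" for n using c(3)[of "Suc n"] f[of n] by simp
  then obtain \<sigma> where \<sigma>: "\<sigma> \<in> Hom D S S" "\<And>n. \<sigma> \<cdot> \<iota> n = \<iota> (Suc n) \<cdot> f n"
    using coproduct_map[OF cop c(1), of "\<lambda>n. \<iota> (Suc n) \<cdot> f n"] by auto
  have "Id D S \<boxminus> \<sigma> \<in> Hom D S S" using \<sigma>(1) c(1) by simp
  then obtain C v w where "tri S S C (Id D S \<boxminus> \<sigma>) v w" using Tri_extend[OF c(1) c(1)] by blast
  then show thesis using that f cop \<sigma> unfolding is_Milnor_colimit_def by blast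
qed

lemma Milnor_colimit_in:
  assumes "suspended \<Y>" "closed_under_small_coproducts D U \<Y>"
    and "is_Milnor_colimit D M f C" "\<And>n. M n \<in> \<Y>"
  shows "C \<in> \<Y>"
proof -
  obtain S \<iota> \<sigma> v w where cop: "is_coproduct D UNIV M S \<iota>" and T: "tri S S C (Id D S \<boxminus> \<sigma>) v w"
    using assms(3) unfolding is_Milnor_colimit_def by blast
  have "S \<in> \<Y>"
    by (rule small_coproduct_closed[OF assms(2) universe_axioms nat_small cop]) (use assms(4) in blast)
  then show ?thesis using suspended_cone[OF assms(1) T] by blast
qed

end

text \<open>The structure maps of a Milnor colimit are \<open>v \<cdot> \<iota> n\<close>. They are compatible with the sequence,
  and compatible families extend along them. For a compact object \<open>P\<close>, the endomorphism \<open>1 - \<sigma>\<close> is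
  injective on maps from \<open>P\<close>: a map fixed by \<open>\<sigma>\<close> has zero components, by induction on the index.\<close>

locale Milnor_colimit = compactly_generated_triangulated_category D U
  for D :: "('o, 'm, 'x) triangulated_data_scheme" (structure) and U :: "'u set" +
  fixes M :: "nat \<Rightarrow> 'o" and f :: "nat \<Rightarrow> 'm" and C S :: 'o and \<iota> :: "nat \<Rightarrow> 'm" and \<sigma> v w :: 'm
  assumes f: "f n \<in> Hom D (M n) (M (Suc n))"
    and cop: "is_coproduct D UNIV M S \<iota>"
    and \<sigma>: "\<sigma> \<in> Hom D S S" and \<sigma>\<iota>: "\<sigma> \<cdot> \<iota> n = \<iota> (Suc n) \<cdot> f n"
    and T: "dist_triangle D S S C (Plus D (Id D S) (Neg D \<sigma>)) v w"
begin

lemma M_Ob: "M n \<in> Ob D"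
  using f[of n] Hom_Ob by blast

lemma S_Ob: "S \<in> Ob D" and \<iota>: "\<iota> n \<in> Hom D (M n) S"
  using coproduct_Hom[OF cop] by auto

lemma v: "v \<in> Hom D S C" and w: "w \<in> Hom D C (\<Sigma> S)" and C_Ob: "C \<in> Ob D"
  using tri_Hom[OF T] by auto

lemma leg: "v \<cdot> \<iota> n \<in> Hom D (M n) C"
  using v \<iota>[of n] by simp

lemma v\<sigma>: "v \<cdot> \<sigma> = v"
proof -
  have "v \<cdot> (Id D S \<boxminus> \<sigma>) = Zero D S C" using comp_tri_1[OF T] .
  then have "v \<boxminus> v \<cdot> \<sigma> = Zero D S C" using v \<sigma> S_Ob by simp
  then have "v = v \<cdot> \<sigma>" by (rule minus_eq_zeroD) (use v \<sigma> in simp_all)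
  then show ?thesis ..
qed

lemma leg_compat: "(v \<cdot> \<iota> (Suc n)) \<cdot> f n = v \<cdot> \<iota> n"
proof -
  have "(v \<cdot> \<iota> (Suc n)) \<cdot> f n = v \<cdot> (\<sigma> \<cdot> \<iota> n)" using v \<iota>[of "Suc n"] f[of n] \<sigma>\<iota>[of n] by simp
  also have "\<dots> = v \<cdot> \<iota> n" by (rule assoc_subst[OF v\<sigma> \<sigma> v]) (use \<iota>[of n] in simp_all)
  finally show ?thesis .
qed

lemma extend:
  assumes Y: "Y \<in> Ob D" and g: "\<And>n. g n \<in> Hom D (M n) Y" "\<And>n. g (Suc n) \<cdot> f n = g n"
  obtains h where "h \<in> Hom D C Y" "\<And>n. h \<cdot> (v \<cdot> \<iota> n) = g n"
proof -
  obtain k where k: "k \<in> Hom D S Y" "\<And>n. k \<cdot> \<iota> n = g n"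
    using coproduct_map[OF cop Y, of g] g(1) by auto
  have "k \<cdot> \<sigma> = k"
  proof (rule coproduct_unique[OF cop])
    show "k \<cdot> \<sigma> \<in> Hom D S Y" "k \<in> Hom D S Y" using k(1) \<sigma> by simp_all
    fix n
    have "(k \<cdot> \<sigma>) \<cdot> \<iota> n = k \<cdot> (\<iota> (Suc n) \<cdot> f n)" using k(1) \<sigma> \<iota>[of n] by (simp add: \<sigma>\<iota>)
    also have "\<dots> = g (Suc n) \<cdot> f n"
      by (rule assoc_subst[OF k(2) \<iota> k(1)]) (use f[of n] in simp_all)
    finally show "(k \<cdot> \<sigma>) \<cdot> \<iota> n = k \<cdot> \<iota> n" using g(2) k(2) by simp
  qed
  then have "k \<cdot> (Id D S \<boxminus> \<sigma>) = Zero D S Y" using k(1) \<sigma> S_Ob by simp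
  then obtain h where h: "h \<in> Hom D C Y" "h \<cdot> v = k" using extend_1[OF T k(1)] by blast
  have "h \<cdot> (v \<cdot> \<iota> n) = g n" for n
    using assoc_subst[OF h(2) v h(1), of "\<iota> n"] \<iota>[of n] k(2)[of n] by simp
  then show thesis using that h(1) by blast
qed

lemma compact_fixed_zero:
  assumes P: "compact_object D U P" and y: "y \<in> Hom D P S" "\<sigma> \<cdot> y = y"
  shows "y = Zero D P S"
proof -
  have POb: "P \<in> Ob D" using y Hom_Ob by blast
  obtain \<pi> where \<pi>: "\<And>n. \<pi> n \<in> Hom D S (M n)" "\<And>n. \<pi> n \<cdot> \<iota> n = Id D (M n)"
    "\<And>n k. k \<noteq> n \<Longrightarrow> \<pi> n \<cdot> \<iota> k = Zero D (M k) (M n)"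
    using coproduct_projections[OF cop] by (metis UNIV_I)
  have \<pi>y: "\<pi> n \<cdot> y = Zero D P (M n)" for n
  proof (induction n)
    case 0
    \<comment> \<open>\<open>\<sigma>\<close> raises the index by one, so nothing reaches the first summand.\<close>
    have "\<pi> 0 \<cdot> \<sigma> = Zero D S (M 0)"
    proof (rule coproduct_unique[OF cop])
      fix k
      have "(\<pi> 0 \<cdot> \<sigma>) \<cdot> \<iota> k = \<pi> 0 \<cdot> (\<iota> (Suc k) \<cdot> f k)" using \<pi>(1)[of 0] \<sigma> \<iota>[of k] by (simp add: \<sigma>\<iota>)
      also have "\<dots> = Zero D (M (Suc k)) (M 0) \<cdot> f k"
        by (rule assoc_subst[OF _ \<iota> \<pi>(1)]) (use \<pi>(3)[of "Suc k" 0] f[of k] in simp_all)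
      finally show "(\<pi> 0 \<cdot> \<sigma>) \<cdot> \<iota> k = Zero D S (M 0) \<cdot> \<iota> k" using f[of k] \<iota>[of k] M_Ob by simp
    qed (use \<pi>(1)[of 0] \<sigma> S_Ob M_Ob in simp_all)
    then have "\<pi> 0 \<cdot> (\<sigma> \<cdot> y) = Zero D S (M 0) \<cdot> y"
      by (rule assoc_subst[OF _ \<sigma> \<pi>(1)]) (use y in simp_all)
    then show ?case using y M_Ob by simp
  next
    case (Suc n)
    have "\<pi> (Suc n) \<cdot> \<sigma> = f n \<cdot> \<pi> n"
    proof (rule coproduct_unique[OF cop])
      fix k
      have "(\<pi> (Suc n) \<cdot> \<sigma>) \<cdot> \<iota> k = \<pi> (Suc n) \<cdot> (\<iota> (Suc k) \<cdot> f k)"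
        using \<pi>(1)[of "Suc n"] \<sigma> \<iota>[of k] by (simp add: \<sigma>\<iota>)
      also have "\<dots> = (\<pi> (Suc n) \<cdot> \<iota> (Suc k)) \<cdot> f k"
        using \<pi>(1)[of "Suc n"] \<iota>[of "Suc k"] f[of k] by simp
      also have "\<dots> = f n \<cdot> (\<pi> n \<cdot> \<iota> k)"
      proof (cases "k = n")
        case True
        then show ?thesis using \<pi>(2)[of n] \<pi>(2)[of "Suc n"] f[of n] by simp
      next
        case False
        then show ?thesis using \<pi>(3)[of k n] \<pi>(3)[of "Suc k" "Suc n"] f[of n] f[of k] M_Ob by simp
      qed
      finally show "(\<pi> (Suc n) \<cdot> \<sigma>) \<cdot> \<iota> k = (f n \<cdot> \<pi> n) \<cdot> \<iota> k"
        using \<pi>(1)[of n] f[of n] \<iota>[of k] by simp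
    qed (use \<pi>(1)[of "Suc n"] \<pi>(1)[of n] \<sigma> f[of n] in simp_all)
    then have "\<pi> (Suc n) \<cdot> (\<sigma> \<cdot> y) = (f n \<cdot> \<pi> n) \<cdot> y"
      by (rule assoc_subst[OF _ \<sigma> \<pi>(1)]) (use y in simp_all)
    also have "\<dots> = Zero D P (M (Suc n))" using y(1) \<pi>(1)[of n] f[of n] Suc POb by simp
    finally show ?case using y(2) by simp
  qed
  have "y \<in> {Zero D P S}"
  proof (rule finitely_supported_mem[OF cop compact_object_finitely_supported[OF universe_axioms P nat_small cop y(1)] y(1)])
    fix i p assume p: "p \<in> Hom D S (M i)" "p \<cdot> \<iota> i = Id D (M i)"
      "\<And>j. j \<in> UNIV \<Longrightarrow> j \<noteq> i \<Longrightarrow> p \<cdot> \<iota> j = Zero D (M j) (M i)"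
    have "p = \<pi> i"
    proof (rule coproduct_unique[OF cop p(1) \<pi>(1)])
      show "p \<cdot> \<iota> k = \<pi> i \<cdot> \<iota> k" for k by (cases "k = i") (use p \<pi> in auto)
    qed
    then show "\<iota> i \<cdot> (p \<cdot> y) \<in> {Zero D P S}" using \<pi>y[of i] \<iota>[of i] POb by simp
  qed (use POb S_Ob in auto)
  then show ?thesis by simp
qed

text \<open>So a map from a compact object to the colimit lifts to the coproduct, hence to finitely many
  terms of the sequence, and then to a single one.\<close>

lemma compact_factor:
  assumes P: "compact_object D U P" and x: "x \<in> Hom D P C"
  obtains n y where "y \<in> Hom D P (M n)" "(v \<cdot> \<iota> n) \<cdot> y = x"
proof -
  have POb: "P \<in> Ob D" using x Hom_Ob by blast
  have inj: "z = Zero D P' S"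
    if P': "isomorphic D P (\<Sigma> P')" "P' \<in> Ob D" and z: "z \<in> Hom D P' S" "(Id D S \<boxminus> \<sigma>) \<cdot> z = Zero D P' S"
    for P' z
  proof -
    have "\<Sigma> P' \<in> {P. compact_object D U P}"
      by (rule sub_iso[OF triangulated_subcategory_compact _ P'(1)]) (use P in simp)
    then have cP': "compact_object D U P'"
      using sub_shift[OF triangulated_subcategory_compact P'(2), of U] by simp
    have "z \<boxminus> \<sigma> \<cdot> z = Zero D P' S" using z \<sigma> S_Ob by simp
    then have "z = \<sigma> \<cdot> z" by (rule minus_eq_zeroD) (use z(1) \<sigma> in simp_all)
    then show ?thesis using compact_fixed_zero[OF cP' z(1)] by simp
  qed
  obtain y where y: "y \<in> Hom D P S" "v \<cdot> y = x" using lift_2_if_injective[OF T x inj] by blast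
  \<comment> \<open>Demanding a lift to all late terms makes this set closed under addition.\<close>
  let ?B = "{g \<in> Hom D P S. \<exists>m. \<forall>n\<ge>m. \<exists>z\<in>Hom D P (M n). (v \<cdot> \<iota> n) \<cdot> z = v \<cdot> g}"
  have "y \<in> ?B"
  proof (rule finitely_supported_mem[OF cop compact_object_finitely_supported[OF universe_axioms P nat_small cop y(1)] y(1)])
    show "Zero D P S \<in> ?B"
    proof -
      have "(v \<cdot> \<iota> n) \<cdot> Zero D P (M n) = v \<cdot> Zero D P S" for n using leg[of n] v POb by simp
      moreover have "Zero D P (M n) \<in> Hom D P (M n)" for n using POb M_Ob by simp
      ultimately have "\<forall>n\<ge>0. \<exists>z\<in>Hom D P (M n). (v \<cdot> \<iota> n) \<cdot> z = v \<cdot> Zero D P S" by blast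
      then have "\<exists>m. \<forall>n\<ge>m. \<exists>z\<in>Hom D P (M n). (v \<cdot> \<iota> n) \<cdot> z = v \<cdot> Zero D P S" by blast
      moreover have "Zero D P S \<in> Hom D P S" using POb S_Ob by simp
      ultimately show ?thesis by blast
    qed
    show "g \<boxplus> h \<in> ?B" if g: "g \<in> ?B" and h: "h \<in> ?B" for g h
    proof -
      obtain m1 m2 where m: "\<And>n. n \<ge> m1 \<Longrightarrow> \<exists>z\<in>Hom D P (M n). (v \<cdot> \<iota> n) \<cdot> z = v \<cdot> g"
        "\<And>n. n \<ge> m2 \<Longrightarrow> \<exists>z\<in>Hom D P (M n). (v \<cdot> \<iota> n) \<cdot> z = v \<cdot> h" using g h by blast
      have "\<exists>z\<in>Hom D P (M n). (v \<cdot> \<iota> n) \<cdot> z = v \<cdot> (g \<boxplus> h)" if "n \<ge> max m1 m2" for n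
      proof -
        obtain z1 z2 where z: "z1 \<in> Hom D P (M n)" "(v \<cdot> \<iota> n) \<cdot> z1 = v \<cdot> g"
          "z2 \<in> Hom D P (M n)" "(v \<cdot> \<iota> n) \<cdot> z2 = v \<cdot> h" using m[of n] \<open>n \<ge> max m1 m2\<close> by auto
        have "(v \<cdot> \<iota> n) \<cdot> (z1 \<boxplus> z2) = (v \<cdot> \<iota> n) \<cdot> z1 \<boxplus> (v \<cdot> \<iota> n) \<cdot> z2"
          by (rule comp_plus) (use z(1,3) leg[of n] in simp_all)
        also have "\<dots> = v \<cdot> (g \<boxplus> h)" unfolding z(2,4) using g h v by simp
        finally show ?thesis using z(1,3) by (intro bexI[of _ "z1 \<boxplus> z2"]) simp_all
      qed
      moreover have "g \<boxplus> h \<in> Hom D P S" using g h by simp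
      ultimately show ?thesis by blast
    qed
    fix i p assume p: "p \<in> Hom D S (M i)"
    have "\<exists>z\<in>Hom D P (M n). (v \<cdot> \<iota> n) \<cdot> z = v \<cdot> (\<iota> i \<cdot> (p \<cdot> y))" if "n \<ge> i" for n
      using that
    proof (induction n rule: dec_induct)
      case base
      then show ?case using v \<iota>[of i] p y(1) by (intro bexI[of _ "p \<cdot> y"]) simp_all
    next
      case (step n)
      then obtain z where z: "z \<in> Hom D P (M n)" "(v \<cdot> \<iota> n) \<cdot> z = v \<cdot> (\<iota> i \<cdot> (p \<cdot> y))" by blast
      have "(v \<cdot> \<iota> (Suc n)) \<cdot> (f n \<cdot> z) = (v \<cdot> \<iota> n) \<cdot> z"
        by (rule assoc_subst[OF leg_compat f leg]) (use z(1) in simp_all)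
      then show ?case using z f[of n] by (intro bexI[of _ "f n \<cdot> z"]) simp_all
    qed
    moreover have "\<iota> i \<cdot> (p \<cdot> y) \<in> Hom D P S" using \<iota>[of i] p y(1) by simp
    ultimately show "\<iota> i \<cdot> (p \<cdot> y) \<in> ?B" by blast
  qed
  then obtain n z where "z \<in> Hom D P (M n)" "(v \<cdot> \<iota> n) \<cdot> z = v \<cdot> y" by blast
  then show thesis using that y(2) by simp
qed

end

lemma (in compactly_generated_triangulated_category) Milnor_colimit_data:
  assumes "is_Milnor_colimit D M f C"
  obtains S \<iota> \<sigma> v w where "Milnor_colimit D U M f C S \<iota> \<sigma> v w"
proof -
  obtain S \<iota> \<sigma> v w where "is_coproduct D UNIV M S \<iota>" "\<sigma> \<in> Hom D S S" "\<forall>n. \<sigma> \<cdot> \<iota> n = \<iota> (Suc n) \<cdot> f n"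
    "tri S S C (Id D S \<boxminus> \<sigma>) v w" "\<forall>n. f n \<in> Hom D (M n) (M (Suc n))"
    using assms unfolding is_Milnor_colimit_def by blast
  then have "Milnor_colimit D U M f C S \<iota> \<sigma> v w" by unfold_locales blast+
  then show thesis using that by blast
qed

section \<open>Infinite devissage\<close>

context compactly_generated_triangulated_category
begin

lemma Tria_properties:
  assumes "\<P> \<subseteq> Ob D"
  shows "triangulated_subcategory D (Tria D U \<P>)" "closed_under_small_coproducts D U (Tria D U \<P>)"
    "\<P> \<subseteq> Tria D U \<P>"
proof -
  have "closed_under_small_coproducts D U (Ob D)"
    unfolding closed_under_small_coproducts_def using coproduct_Hom(1) by blast
  then have ne: "{\<Y>. triangulated_subcategory D \<Y> \<and> closed_under_small_coproducts D U \<Y> \<and> \<P> \<subseteq> \<Y>} \<noteq> {}"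
    using triangulated_subcategory_Ob assms by blast
  show "triangulated_subcategory D (Tria D U \<P>)"
    unfolding Tria_def by (rule triangulated_subcategory_Inter[OF _ ne]) blast
  show "closed_under_small_coproducts D U (Tria D U \<P>)"
    unfolding Tria_def closed_under_small_coproducts_def by blast
  show "\<P> \<subseteq> Tria D U \<P>" unfolding Tria_def by blast
qed

lemma Tria_least:
  assumes "triangulated_subcategory D \<Y>" "closed_under_small_coproducts D U \<Y>" "\<P> \<subseteq> \<Y>"
  shows "Tria D U \<P> \<subseteq> \<Y>"
  unfolding Tria_def using assms by blast

text \<open>The coproduct is indexed by the arrows in \<open>A\<close> themselves, which form a small set because the
  category is locally small.\<close>

lemma coproduct_of_arrows:
  assumes sub: "suspended \<Y>" "closed_under_small_coproducts D U \<Y>"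
    and P: "\<P> \<prec> U" "\<P> \<subseteq> \<Y>" and M: "M \<in> Ob D" and A: "A \<subseteq> (\<Union>P\<in>\<P>. Hom D P M)"
  obtains K u where "K \<in> \<Y>" "u \<in> Hom D K M" "\<And>p. p \<in> A \<Longrightarrow> \<exists>k\<in>Hom D (Dom D p) K. u \<cdot> k = p"
    "\<And>Y g. g \<in> Hom D M Y \<Longrightarrow> (\<And>p. p \<in> A \<Longrightarrow> g \<cdot> p = Zero D (Dom D p) Y) \<Longrightarrow> g \<cdot> u = Zero D K Y"
proof -
  have POb: "P \<in> Ob D" if "P \<in> \<P>" for P using that P(2) suspended_Ob[OF sub(1)] by blast
  have "(\<Union>P\<in>\<P>. Hom D P M) \<prec> U" by (rule small_Union[OF P(1)]) (use locally_small POb M in blast)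
  then have A_small: "A \<prec> U" by (rule small_subset[OF A])
  have A_arr: "p \<in> Hom D (Dom D p) M" "Dom D p \<in> \<P>" if "p \<in> A" for p using A that by auto
  obtain K \<iota> where cop: "is_coproduct D A (Dom D) K \<iota>"
    using small_coproduct[OF A_small, of "Dom D"] A_arr POb by blast
  note c = coproduct_Hom[OF cop]
  have K: "K \<in> \<Y>"
    by (rule small_coproduct_closed[OF sub(2) universe_axioms A_small cop]) (use A_arr P in blast)
  obtain u where u: "u \<in> Hom D K M" "\<And>p. p \<in> A \<Longrightarrow> u \<cdot> \<iota> p = p"
    using coproduct_map[OF cop M, of "\<lambda>p. p"] A_arr by metis
  have "g \<cdot> u = Zero D K Y"
    if g: "g \<in> Hom D M Y" and z: "\<And>p. p \<in> A \<Longrightarrow> g \<cdot> p = Zero D (Dom D p) Y" for Y g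
  proof (rule coproduct_unique[OF cop])
    have Y: "Y \<in> Ob D" using g Hom_Ob by blast
    show "g \<cdot> u \<in> Hom D K Y" "Zero D K Y \<in> Hom D K Y" using g u(1) c(1) Y by simp_all
    fix p assume p: "p \<in> A"
    have "(g \<cdot> u) \<cdot> \<iota> p = g \<cdot> (u \<cdot> \<iota> p)" using g u(1) c(3)[OF p] by (simp del: u(2))
    then show "(g \<cdot> u) \<cdot> \<iota> p = Zero D K Y \<cdot> \<iota> p" using u(2)[OF p] z[OF p] c(3)[OF p] Y by simp
  qed
  then show thesis using that K u c(3) by metis
qed

text \<open>Given \<open>g : F \<rightarrow> M\<close>, a cone kills the maps from the test objects to \<open>F\<close> that \<open>g\<close> kills: such a
  map lifts to the fibre of \<open>g\<close>, which lies in \<open>\<X>\<close>, and so factors through an object of \<open>\<P>\<close>.\<close>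

lemma kill_kernel:
  assumes X: "triangulated_subcategory D \<X>"
    and P: "\<P> \<prec> U" "\<P> \<subseteq> \<Y>" and Y: "suspended \<Y>" "closed_under_small_coproducts D U \<Y>"
    and YX: "\<Y> \<subseteq> \<X>"
    and factor: "\<And>Q M x. Q \<in> \<S> \<Longrightarrow> M \<in> \<X> \<Longrightarrow> x \<in> Hom D Q M
      \<Longrightarrow> \<exists>R\<in>\<P>. \<exists>a\<in>Hom D Q R. \<exists>b\<in>Hom D R M. b \<cdot> a = x"
    and M: "M \<in> \<X>" and F: "F \<in> \<Y>" and g: "g \<in> Hom D F M"
  obtains F' a g' where "F' \<in> \<Y>" "a \<in> Hom D F F'" "g' \<in> Hom D F' M" "g' \<cdot> a = g"
    "\<And>Q x. Q \<in> \<S> \<Longrightarrow> x \<in> Hom D Q F \<Longrightarrow> g \<cdot> x = Zero D Q M \<Longrightarrow> a \<cdot> x = Zero D Q F'"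
proof -
  have Ob: "F \<in> Ob D" "M \<in> Ob D" using g Hom_Ob by blast+
  let ?A = "{p \<in> (\<Union>P\<in>\<P>. Hom D P F). g \<cdot> p = Zero D (Dom D p) M}"
  obtain K u where K: "K \<in> \<Y>" "u \<in> Hom D K F" "\<And>p. p \<in> ?A \<Longrightarrow> \<exists>k\<in>Hom D (Dom D p) K. u \<cdot> k = p"
    "\<And>Y g. g \<in> Hom D F Y \<Longrightarrow> (\<And>p. p \<in> ?A \<Longrightarrow> g \<cdot> p = Zero D (Dom D p) Y) \<Longrightarrow> g \<cdot> u = Zero D K Y"
    using coproduct_of_arrows[OF Y P Ob(1), of ?A] by blast
  have "g \<cdot> u = Zero D K M" by (rule K(4)[OF g]) blast
  obtain F' a w where T: "tri K F F' u a w"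
    using Tri_extend[OF suspended_Ob[OF Y(1) K(1)] Ob(1) K(2)] by blast
  note t = tri_Hom[OF T]
  obtain g' where g': "g' \<in> Hom D F' M" "g' \<cdot> a = g" using extend_1[OF T g \<open>g \<cdot> u = _\<close>] .
  have "a \<cdot> x = Zero D Q F'" if Q: "Q \<in> \<S>" and x: "x \<in> Hom D Q F" "g \<cdot> x = Zero D Q M" for Q x
  proof -
    have QOb: "Q \<in> Ob D" using x Hom_Ob by blast
    obtain G i s where G: "tri G F M i g s" using fibre_exists[OF g] .
    have GX: "G \<in> \<X>" using sub_fibre[OF X G] F M YX by blast
    obtain y where y: "y \<in> Hom D Q G" "i \<cdot> y = x" using lift_1[OF G x] .
    obtain R b c where R: "R \<in> \<P>" "b \<in> Hom D Q R" "c \<in> Hom D R G" "c \<cdot> b = y"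
      using factor[OF Q GX y(1)] by blast
    note i = tri_Hom(4)[OF G]
    have "g \<cdot> (i \<cdot> c) = Zero D G M \<cdot> c"
      by (rule assoc_subst[OF comp_tri_1[OF G] i g]) (use R(3) in simp_all)
    then have "i \<cdot> c \<in> ?A" using R(1,3) i Ob by auto
    then obtain k where k: "k \<in> Hom D R K" "u \<cdot> k = i \<cdot> c" using K(3)[of "i \<cdot> c"] R(3) i by auto
    have "a \<cdot> x = a \<cdot> ((u \<cdot> k) \<cdot> b)" unfolding k(2) y(2)[symmetric] R(4)[symmetric] using i R(2,3) by simp
    also have "\<dots> = a \<cdot> (u \<cdot> (k \<cdot> b))" using k(1) R(2) K(2) by (simp del: k(2))
    also have "\<dots> = Zero D K F' \<cdot> (k \<cdot> b)"
      by (rule assoc_subst[OF comp_tri_1[OF T] t(4,5)]) (use k(1) R(2) in simp_all)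
    also have "\<dots> = Zero D Q F'" using k(1) R(2) t by simp
    finally show ?thesis .
  qed
  then show thesis using that suspended_cone[OF Y(1) T K(1) F] t(5) g' by blast
qed

text \<open>For \<open>M\<close> in \<open>\<X>\<close>, an arrow to \<open>M\<close> from a coproduct of objects of \<open>\<P>\<close> that is surjective on maps
  from the test objects \<open>\<S>\<close> is made injective on them by countably many applications of
  \<open>kill_kernel\<close>. Every map from a compact object to the Milnor colimit \<open>C\<close> of these steps comes from
  one of them, so \<open>C \<rightarrow> M\<close> is bijective on maps from the test objects. As these are closed under
  desuspension, the cone of \<open>C \<rightarrow> M\<close> has no non-zero maps from them; hence it is zero.\<close>

lemma devissage:
  assumes S: "\<And>Q. Q \<in> \<S> \<Longrightarrow> compact_object D U Q"
    and S_shift: "\<And>Q. Q \<in> Ob D \<Longrightarrow> \<Sigma> Q \<in> \<S> \<Longrightarrow> Q \<in> \<S>" and S_iso: "\<And>Q R. Q \<in> \<S> \<Longrightarrow> isomorphic D Q R \<Longrightarrow> R \<in> \<S>"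
    and gen: "\<And>M. M \<in> Ob D \<Longrightarrow> (\<And>Q. Q \<in> \<S> \<Longrightarrow> Hom D Q M = {Zero D Q M}) \<Longrightarrow> zero_object D M"
    and X: "triangulated_subcategory D \<X>"
    and T: "suspended \<Y>" "closed_under_small_coproducts D U \<Y>" "\<Y> \<subseteq> \<X>"
    and P: "\<P> \<prec> U" "\<P> \<subseteq> \<Y>"
    and factor: "\<And>Q M x. Q \<in> \<S> \<Longrightarrow> M \<in> \<X> \<Longrightarrow> x \<in> Hom D Q M
      \<Longrightarrow> \<exists>R\<in>\<P>. \<exists>a\<in>Hom D Q R. \<exists>b\<in>Hom D R M. b \<cdot> a = x"
  shows "\<X> \<subseteq> \<Y>"
proof
  fix M assume M: "M \<in> \<X>"
  have MOb: "M \<in> Ob D" using sub_Ob[OF X M] .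
  obtain F0 g0 where F0: "F0 \<in> \<Y>" "g0 \<in> Hom D F0 M"
    "\<And>p. p \<in> (\<Union>P\<in>\<P>. Hom D P M) \<Longrightarrow> \<exists>k\<in>Hom D (Dom D p) F0. g0 \<cdot> k = p"
    by (rule coproduct_of_arrows[OF T(1,2) P MOb subset_refl], rule that)
  have onto0: "\<exists>y\<in>Hom D Q F0. g0 \<cdot> y = x" if Q: "Q \<in> \<S>" "x \<in> Hom D Q M" for Q x
  proof -
    obtain R a b where R: "R \<in> \<P>" "a \<in> Hom D Q R" "b \<in> Hom D R M" "b \<cdot> a = x"
      using factor[OF Q(1) M Q(2)] by blast
    then obtain k where k: "k \<in> Hom D R F0" "g0 \<cdot> k = b" using F0(3)[of b] by auto
    have "g0 \<cdot> (k \<cdot> a) = x" using assoc_subst[OF k(2,1) F0(2), of a] R(2,4) by simp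
    then show ?thesis using k(1) R(2) by (intro bexI[of _ "k \<cdot> a"]) simp_all
  qed
  define good where "good n s \<longleftrightarrow> fst s \<in> \<Y> \<and> snd s \<in> Hom D (fst s) M \<and> (n = 0 \<longrightarrow> s = (F0, g0))"
    for n :: nat and s
  define next' where "next' s s' a \<longleftrightarrow> a \<in> Hom D (fst s) (fst s') \<and> snd s' \<cdot> a = snd s \<and>
      (\<forall>Q\<in>\<S>. \<forall>x\<in>Hom D Q (fst s). snd s \<cdot> x = Zero D Q M \<longrightarrow> a \<cdot> x = Zero D Q (fst s'))" for s s' a
  have "\<exists>\<phi>. \<forall>n. good n (\<phi> n) \<and> (\<exists>a. next' (\<phi> n) (\<phi> (Suc n)) a)"
  proof (rule dependent_nat_choice)
    show "\<exists>s. good 0 s" using F0 unfolding good_def by (intro exI[of _ "(F0, g0)"]) simp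
    fix s n assume "good n s"
    then have s: "fst s \<in> \<Y>" "snd s \<in> Hom D (fst s) M" unfolding good_def by blast+
    obtain F' a g' where F': "F' \<in> \<Y>" "a \<in> Hom D (fst s) F'" "g' \<in> Hom D F' M" "g' \<cdot> a = snd s"
      "\<And>Q x. Q \<in> \<S> \<Longrightarrow> x \<in> Hom D Q (fst s) \<Longrightarrow> snd s \<cdot> x = Zero D Q M \<Longrightarrow> a \<cdot> x = Zero D Q F'"
      using kill_kernel[OF X P T factor M s] by blast
    then show "\<exists>s'. good (Suc n) s' \<and> (\<exists>a. next' s s' a)"
      unfolding good_def next'_def by (intro exI[of _ "(F', g')"] conjI exI[of _ a]) simp_all
  qed
  then obtain \<phi> where \<phi>: "\<And>n. good n (\<phi> n)" "\<And>n. \<exists>a. next' (\<phi> n) (\<phi> (Suc n)) a" by blast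
  define F g where "F n = fst (\<phi> n)" and "g n = snd (\<phi> n)" for n
  obtain a where a: "\<And>n. next' (\<phi> n) (\<phi> (Suc n)) (a n)" using \<phi>(2) by metis
  have Fg: "F n \<in> \<Y>" "g n \<in> Hom D (F n) M" for n
    using \<phi>(1)[of n] unfolding good_def F_def g_def by blast+
  have FOb: "F n \<in> Ob D" for n using Fg(1) suspended_Ob[OF T(1)] by blast
  have a_hom: "a n \<in> Hom D (F n) (F (Suc n))" and ga: "g (Suc n) \<cdot> a n = g n" for n
    using a[of n] unfolding next'_def F_def g_def by blast+
  have a_kill: "a n \<cdot> x = Zero D Q (F (Suc n))"
    if "Q \<in> \<S>" "x \<in> Hom D Q (F n)" "g n \<cdot> x = Zero D Q M" for n Q x
    using a[of n] that unfolding next'_def F_def g_def by blast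
  have zero: "F 0 = F0" "g 0 = g0" using \<phi>(1)[of 0] unfolding good_def F_def g_def by simp_all
  obtain C where C: "is_Milnor_colimit D F a C" 
    using Milnor_colimit_exists[where M = F and f = a, OF a_hom] .
  have CT: "C \<in> \<Y>" by (rule Milnor_colimit_in[OF T(1,2) C Fg(1)])
  obtain S \<iota> \<sigma> v w where "Milnor_colimit D U F a C S \<iota> \<sigma> v w" using Milnor_colimit_data[OF C] .
  then interpret C: Milnor_colimit D U F a C S \<iota> \<sigma> v w .
  obtain h where h: "h \<in> Hom D C M" "\<And>n. h \<cdot> (v \<cdot> \<iota> n) = g n" 
    by (rule C.extend[where g = g, OF MOb Fg(2) ga], rule that)
  have onto: "\<exists>y\<in>Hom D Q C. h \<cdot> y = x" if Q: "Q \<in> \<S>" "x \<in> Hom D Q M" for Q x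
  proof -
    obtain y where y: "y \<in> Hom D Q F0" "g0 \<cdot> y = x" using onto0[OF Q] by blast
    have "h \<cdot> ((v \<cdot> \<iota> 0) \<cdot> y) = x"
      using assoc_subst[OF h(2)[of 0] C.leg h(1), of y] y zero by simp
    moreover have "(v \<cdot> \<iota> 0) \<cdot> y \<in> Hom D Q C" using C.leg[of 0] y zero by simp
    ultimately show ?thesis by blast
  qed
  have into: "y = Zero D Q C" if Q: "Q \<in> \<S>" and y: "y \<in> Hom D Q C" "h \<cdot> y = Zero D Q M" for Q y
  proof -
    have QOb: "Q \<in> Ob D" using y Hom_Ob by blast
    obtain n z where z: "z \<in> Hom D Q (F n)" "(v \<cdot> \<iota> n) \<cdot> z = y" using C.compact_factor[OF S[OF Q] y(1)] .
    have "g n \<cdot> z = Zero D Q M"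
      using assoc_subst[OF h(2)[of n] C.leg h(1), of z] z y(2) by simp
    then have "a n \<cdot> z = Zero D Q (F (Suc n))" by (rule a_kill[OF Q z(1)])
    moreover have "(v \<cdot> \<iota> (Suc n)) \<cdot> (a n \<cdot> z) = (v \<cdot> \<iota> n) \<cdot> z"
      by (rule assoc_subst[OF C.leg_compat a_hom C.leg]) (use z(1) in simp_all)
    ultimately show ?thesis using C.leg[of "Suc n"] QOb z(2) by simp
  qed
  obtain Z p q where Z: "tri C M Z h p q" using Tri_extend[OF C.C_Ob MOb h(1)] by blast
  note t = tri_Hom[OF Z]
  have "zero_object D Z"
  proof (rule gen[OF t(3)])
    fix Q assume Q: "Q \<in> \<S>"
    have QOb: "Q \<in> Ob D" using S[OF Q] compact_object_Ob by blast
    have "z = Zero D Q Z" if z: "z \<in> Hom D Q Z" for z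
    proof -
      have inj: "y = Zero D Q' C" if "isomorphic D Q (\<Sigma> Q')" "Q' \<in> Ob D"
        "y \<in> Hom D Q' C" "h \<cdot> y = Zero D Q' M" for Q' y
        using into S_shift[OF that(2) S_iso[OF Q that(1)]] that(3,4) by blast
      obtain m where m: "m \<in> Hom D Q M" "p \<cdot> m = z" using lift_2_if_injective[OF Z z inj] by blast
      obtain y where y: "y \<in> Hom D Q C" "h \<cdot> y = m" using onto[OF Q m(1)] by blast
      have "z = p \<cdot> (h \<cdot> y)" using m(2) y(2) by simp
      also have "\<dots> = Zero D C Z \<cdot> y"
        by (rule assoc_subst[OF comp_tri_1[OF Z] t(4,5)]) (use y(1) in simp_all)
      also have "\<dots> = Zero D Q Z" using y(1) t by simp
      finally show ?thesis .
    qed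
    moreover have "Zero D Q Z \<in> Hom D Q Z" using QOb t(3) by simp
    ultimately show "Hom D Q Z = {Zero D Q Z}" by blast
  qed
  then have "Z \<in> \<Y>" using T(1) unfolding suspended_def by blast
  then show "M \<in> \<Y>" by (rule suspended_mid[OF T(1) Z CT])
qed

lemma Tria_eqI:
  assumes S: "\<And>Q. Q \<in> \<S> \<Longrightarrow> compact_object D U Q"
    and S_shift: "\<And>Q. Q \<in> Ob D \<Longrightarrow> \<Sigma> Q \<in> \<S> \<Longrightarrow> Q \<in> \<S>" and S_iso: "\<And>Q R. Q \<in> \<S> \<Longrightarrow> isomorphic D Q R \<Longrightarrow> R \<in> \<S>"
    and gen: "\<And>M. M \<in> Ob D \<Longrightarrow> (\<And>Q. Q \<in> \<S> \<Longrightarrow> Hom D Q M = {Zero D Q M}) \<Longrightarrow> zero_object D M"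
    and X: "triangulated_subcategory D \<X>" "closed_under_small_coproducts D U \<X>"
    and P: "\<P> \<prec> U" "\<P> \<subseteq> \<X>"
    and factor: "\<And>Q M x. Q \<in> \<S> \<Longrightarrow> M \<in> \<X> \<Longrightarrow> x \<in> Hom D Q M
      \<Longrightarrow> \<exists>R\<in>\<P>. \<exists>a\<in>Hom D Q R. \<exists>b\<in>Hom D R M. b \<cdot> a = x"
  shows "\<X> = Tria D U \<P>"
proof
  have "\<P> \<subseteq> Ob D" using P(2) sub_Ob[OF X(1)] by blast
  note T = Tria_properties[OF this]
  show TX: "Tria D U \<P> \<subseteq> \<X>" by (rule Tria_least[OF X P(2)])
  show "\<X> \<subseteq> Tria D U \<P>"
    by (rule devissage[OF S S_shift S_iso gen X(1) triangulated_subcategory_suspended[OF T(1)] T(2) TX P(1) T(3) factor])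
qed

end

section \<open>Smashing localization\<close>

locale smashing_localization = compactly_generated_triangulated_category D U
  for D :: "('o, 'm, 'x) triangulated_data_scheme" (structure) and U :: "'u set" +
  fixes \<X> :: "'o set"
  assumes smashing: "smashing_subcategory D U \<X>"
begin

lemma X_sub: "triangulated_subcategory D \<X>"
  using smashing unfolding smashing_subcategory_def by blast

lemma X_Ob: "X \<in> \<X> \<Longrightarrow> X \<in> Ob D"
  using sub_Ob[OF X_sub] .

abbreviation perp where "perp \<equiv> right_orthogonal D \<X>"

lemma perp_Ob: "Y \<in> perp \<Longrightarrow> Y \<in> Ob D"
  unfolding right_orthogonal_def by blast

lemma perp_zero: "Y \<in> perp \<Longrightarrow> X \<in> \<X> \<Longrightarrow> f \<in> Hom D X Y \<Longrightarrow> f = Zero D X Y"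
  unfolding right_orthogonal_def by blast

lemma perpI:
  assumes "Y \<in> Ob D" "\<And>X f. X \<in> \<X> \<Longrightarrow> f \<in> Hom D X Y \<Longrightarrow> f = Zero D X Y"
  shows "Y \<in> perp"
proof -
  have "Zero D X Y \<in> Hom D X Y" if "X \<in> \<X>" for X using X_Ob[OF that] assms(1) by simp
  then show ?thesis using assms unfolding right_orthogonal_def by blast
qed

lemma perp_shift:
  assumes "Y \<in> perp" shows "\<Sigma> Y \<in> perp"
proof (rule perpI)
  have Y: "Y \<in> Ob D" using perp_Ob[OF assms] .
  then show "\<Sigma> Y \<in> Ob D" by simp
  fix X f assume X: "X \<in> \<X>" "f \<in> Hom D X (\<Sigma> Y)"
  obtain X' a b where X': "X' \<in> \<X>" "a \<in> Hom D (\<Sigma> X') X" "b \<in> Hom D X (\<Sigma> X')"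
    "b \<cdot> a = Id D (\<Sigma> X')" "a \<cdot> b = Id D X" using sub_unshift[OF X_sub X(1)] .
  obtain g where g: "g \<in> Hom D X' Y" "\<Sigma>\<^sub>a g = f \<cdot> a"
    using shift_full[OF Comp_in_Hom[OF X'(2) X(2)] X_Ob[OF X'(1)] Y] .
  have "g = Zero D X' Y" using perp_zero[OF assms X'(1) g(1)] .
  then have "f \<cdot> a = Zero D (\<Sigma> X') (\<Sigma> Y)" using g(2) X_Ob[OF X'(1)] Y by simp
  then have "(f \<cdot> a) \<cdot> b = Zero D X (\<Sigma> Y)" using X'(3) X_Ob[OF X'(1)] Y by simp
  then show "f = Zero D X (\<Sigma> Y)" using X(2) X'(2,3,5) by simp
qed

lemma perp_cone:
  assumes T: "tri Y Z W u v w" and Y: "Y \<in> perp" and Z: "Z \<in> perp" shows "W \<in> perp"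
proof (rule perpI)
  note t = tri_Hom[OF T]
  show "W \<in> Ob D" by (fact t)
  fix X f assume X: "X \<in> \<X>" "f \<in> Hom D X W"
  have "w \<cdot> f = Zero D X (\<Sigma> Y)" by (rule perp_zero[OF perp_shift[OF Y] X(1)]) (use X(2) t in simp)
  then obtain g where g: "g \<in> Hom D X Z" "v \<cdot> g = f" using lift_2[OF T X(2)] by blast
  have "g = Zero D X Z" by (rule perp_zero[OF Z X(1) g(1)])
  then show "f = Zero D X W" using g(2) t X_Ob[OF X(1)] by simp
qed

subsection \<open>The reflection onto the right orthogonal\<close>

text \<open>The arrow \<open>\<epsilon>\<close> is the counit of the adjunction, the preimage of an identity under the adjunction
  bijection; naturality makes composition with \<open>\<epsilon>\<close> the inverse of that bijection.\<close>

lemma coreflection: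
  assumes N: "N \<in> Ob D"
  obtains G \<epsilon> where "G \<in> \<X>" "\<epsilon> \<in> Hom D G N"
    "\<And>X x. X \<in> \<X> \<Longrightarrow> x \<in> Hom D X N \<Longrightarrow> \<exists>y\<in>Hom D X G. \<epsilon> \<cdot> y = x"
    "\<And>X y. X \<in> \<X> \<Longrightarrow> y \<in> Hom D X G \<Longrightarrow> \<epsilon> \<cdot> y = Zero D X N \<Longrightarrow> y = Zero D X G"
proof -
  let ?C = "full_subcategory D \<X>"
  have C: "Ob ?C = \<X>" "Id ?C = Id D" "Comp ?C = Comp D" by (simp_all add: full_subcategory_def)
  have CHom: "Hom ?C X Y = Hom D X Y" if "X \<in> \<X>" "Y \<in> \<X>" for X Y
    using that by (auto simp: Hom_def full_subcategory_def)
  obtain Go Ga \<phi> where F: "is_functor D ?C Go Ga"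
    and bij: "\<And>X Y. X \<in> \<X> \<Longrightarrow> Y \<in> Ob D \<Longrightarrow> bij_betw (\<phi> X Y) (Hom D X Y) (Hom ?C X (Go Y))"
    and nat: "\<And>X X' Y Y' f g h. X \<in> \<X> \<Longrightarrow> X' \<in> \<X> \<Longrightarrow> Y \<in> Ob D \<Longrightarrow> Y' \<in> Ob D \<Longrightarrow>
      f \<in> Hom ?C X' X \<Longrightarrow> g \<in> Hom D Y Y' \<Longrightarrow> h \<in> Hom D X Y \<Longrightarrow> \<phi> X' Y' (g \<cdot> h \<cdot> f) = Ga g \<cdot> \<phi> X Y h \<cdot> f"
    using smashing unfolding smashing_subcategory_def has_right_adjoint_def adjoint_functors_def C
    by (elim conjE exE) metis
  have G: "Go N \<in> \<X>" "Ga (Id D N) = Id D (Go N)" using F N unfolding is_functor_def C by blast+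
  have bij': "bij_betw (\<phi> X N) (Hom D X N) (Hom D X (Go N))" if "X \<in> \<X>" for X
    using bij[OF that N] CHom[OF that G(1)] by simp
  have "Id D (Go N) \<in> Hom D (Go N) (Go N)" using X_Ob[OF G(1)] by simp
  then obtain \<epsilon> where \<epsilon>: "\<epsilon> \<in> Hom D (Go N) N" "\<phi> (Go N) N \<epsilon> = Id D (Go N)"
    using bij'[OF G(1)] unfolding bij_betw_def by (metis imageE)
  have key: "\<phi> X N (\<epsilon> \<cdot> y) = y" if X: "X \<in> \<X>" and y: "y \<in> Hom D X (Go N)" for X y
  proof -
    have "\<phi> X N (Id D N \<cdot> \<epsilon> \<cdot> y) = Ga (Id D N) \<cdot> \<phi> (Go N) N \<epsilon> \<cdot> y"
      by (rule nat[OF G(1) X N N _ _ \<epsilon>(1)]) (use y N CHom[OF X G(1)] in simp_all)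
    moreover have "Id D N \<cdot> \<epsilon> \<cdot> y = \<epsilon> \<cdot> y" using \<epsilon>(1) y by simp
    moreover have "Ga (Id D N) \<cdot> \<phi> (Go N) N \<epsilon> \<cdot> y = y" unfolding G(2) \<epsilon>(2) using y by simp
    ultimately show ?thesis by simp
  qed
  have 1: "\<exists>y\<in>Hom D X (Go N). \<epsilon> \<cdot> y = x" if X: "X \<in> \<X>" and x: "x \<in> Hom D X N" for X x
  proof -
    have y: "\<phi> X N x \<in> Hom D X (Go N)" using bij'[OF X] x unfolding bij_betw_def by blast
    have "\<epsilon> \<cdot> \<phi> X N x \<in> Hom D X N" using y \<epsilon>(1) by simp
    moreover have "inj_on (\<phi> X N) (Hom D X N)" using bij'[OF X] unfolding bij_betw_def by blast
    ultimately have "\<epsilon> \<cdot> \<phi> X N x = x" using key[OF X y] x by (meson inj_onD)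
    then show ?thesis using y by blast
  qed
  have 2: "y = Zero D X (Go N)"
    if X: "X \<in> \<X>" and y: "y \<in> Hom D X (Go N)" "\<epsilon> \<cdot> y = Zero D X N" for X y
  proof -
    have z: "Zero D X (Go N) \<in> Hom D X (Go N)" using X_Ob[OF X] X_Ob[OF G(1)] by simp
    have "\<epsilon> \<cdot> Zero D X (Go N) = \<epsilon> \<cdot> y" using y(2) \<epsilon>(1) X_Ob[OF X] by simp
    then show ?thesis using key[OF X y(1)] key[OF X z] by metis
  qed
  show thesis by (rule that[OF G(1) \<epsilon>(1) 1 2])
qed

definition local_triangle :: "'o \<Rightarrow> 'o \<Rightarrow> 'm \<Rightarrow> bool" where
  "local_triangle N Y \<eta> \<longleftrightarrow> Y \<in> perp \<and> (\<exists>G \<epsilon> w. G \<in> \<X> \<and> tri G N Y \<epsilon> \<eta> w)"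

text \<open>The third object of a triangle on the counit is orthogonal to \<open>\<X>\<close>: a map from \<open>\<X>\<close> to it lifts to
  \<open>N\<close> by injectivity of the counit, then to \<open>G\<close> by its surjectivity, and two consecutive arrows of a
  triangle compose to zero.\<close>

lemma local_triangle_exists:
  assumes N: "N \<in> Ob D" shows "\<exists>Y \<eta>. local_triangle N Y \<eta>"
proof -
  obtain G \<epsilon> where G: "G \<in> \<X>" "\<epsilon> \<in> Hom D G N"
    "\<And>X x. X \<in> \<X> \<Longrightarrow> x \<in> Hom D X N \<Longrightarrow> \<exists>y\<in>Hom D X G. \<epsilon> \<cdot> y = x"
    "\<And>X y. X \<in> \<X> \<Longrightarrow> y \<in> Hom D X G \<Longrightarrow> \<epsilon> \<cdot> y = Zero D X N \<Longrightarrow> y = Zero D X G"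
    using coreflection[OF N] by blast
  obtain Y \<eta> w where T: "tri G N Y \<epsilon> \<eta> w" using Tri_extend[OF X_Ob[OF G(1)] N G(2)] by blast
  note t = tri_Hom[OF T]
  have "Y \<in> perp"
  proof (rule perpI)
    show "Y \<in> Ob D" by (fact t)
    fix X x assume X: "X \<in> \<X>" and x: "x \<in> Hom D X Y"
    have inj: "y = Zero D X' G" if "isomorphic D X (\<Sigma> X')" "X' \<in> Ob D"
      "y \<in> Hom D X' G" "\<epsilon> \<cdot> y = Zero D X' N" for X' y
      using G(4) that(3,4) sub_iso[OF X_sub X that(1)] sub_shift[OF X_sub that(2)] by blast
    obtain n where n: "n \<in> Hom D X N" "\<eta> \<cdot> n = x" using lift_2_if_injective[OF T x inj] by blast
    obtain k where k: "k \<in> Hom D X G" "\<epsilon> \<cdot> k = n" using G(3)[OF X n(1)] by blast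
    have "x = \<eta> \<cdot> (\<epsilon> \<cdot> k)" using n(2) k(2) by simp
    also have "\<dots> = Zero D G Y \<cdot> k" by (rule assoc_subst[OF comp_tri_1[OF T] t(4,5)]) (use k(1) in simp_all)
    also have "\<dots> = Zero D X Y" using k(1) t by simp
    finally show "x = Zero D X Y" .
  qed
  then show ?thesis using G(1) T unfolding local_triangle_def by blast
qed

definition reflection :: "'o \<Rightarrow> 'o \<times> 'm" where
  "reflection N = (SOME p. local_triangle N (fst p) (snd p))"

definition L :: "'o \<Rightarrow> 'o" where "L N = fst (reflection N)"
definition \<eta> :: "'o \<Rightarrow> 'm" where "\<eta> N = snd (reflection N)"

lemma reflection_triangle:
  assumes "N \<in> Ob D"
  obtains G \<epsilon> w where "G \<in> \<X>" "tri G N (L N) \<epsilon> (\<eta> N) w" "L N \<in> perp"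
proof -
  have "\<exists>p. local_triangle N (fst p) (snd p)" using local_triangle_exists[OF assms] by simp
  then have "local_triangle N (L N) (\<eta> N)" unfolding L_def \<eta>_def reflection_def by (rule someI_ex)
  then show thesis using that unfolding local_triangle_def by blast
qed

lemma L_perp: "N \<in> Ob D \<Longrightarrow> L N \<in> perp"
  using reflection_triangle by blast

lemma L_Ob [simp]: "N \<in> Ob D \<Longrightarrow> L N \<in> Ob D"
  using L_perp perp_Ob by blast

lemma eta_Arr [simp]:
  assumes "N \<in> Ob D" shows "\<eta> N \<in> Arr D" "Dom D (\<eta> N) = N" "Cod D (\<eta> N) = L N"
proof -
  obtain G \<epsilon> w where "tri G N (L N) \<epsilon> (\<eta> N) w" using reflection_triangle[OF assms] .
  from tri_Hom(5)[OF this] show "\<eta> N \<in> Arr D" "Dom D (\<eta> N) = N" "Cod D (\<eta> N) = L N" by simp_all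
qed

lemma eta_extend:
  assumes f: "f \<in> Hom D N Y" and Y: "Y \<in> perp"
  obtains g where "g \<in> Hom D (L N) Y" "g \<cdot> \<eta> N = f"
proof -
  have N: "N \<in> Ob D" using f Hom_Ob by blast
  obtain G \<epsilon> w where G: "G \<in> \<X>" "tri G N (L N) \<epsilon> (\<eta> N) w" using reflection_triangle[OF N] .
  have "f \<cdot> \<epsilon> = Zero D G Y" by (rule perp_zero[OF Y G(1)]) (use f tri_Hom(4)[OF G(2)] in simp)
  then show thesis using extend_1[OF G(2) f] that by blast
qed

lemma eta_cancel:
  assumes g: "g \<in> Hom D (L N) Y" "g' \<in> Hom D (L N) Y" and N: "N \<in> Ob D" and Y: "Y \<in> perp"
    and eq: "g \<cdot> \<eta> N = g' \<cdot> \<eta> N"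
  shows "g = g'"
proof -
  obtain G \<epsilon> w where G: "G \<in> \<X>" "tri G N (L N) \<epsilon> (\<eta> N) w" using reflection_triangle[OF N] .
  have d: "g \<boxminus> g' \<in> Hom D (L N) Y" using g by simp
  have "(g \<boxminus> g') \<cdot> \<eta> N = Zero D N Y" using g N eq by simp
  then obtain k where k: "k \<in> Hom D (\<Sigma> G) Y" "k \<cdot> w = g \<boxminus> g'" using extend_2[OF G(2) d] by blast
  have "k = Zero D (\<Sigma> G) Y"
    by (rule perp_zero[OF Y _ k(1)]) (use sub_shift[OF X_sub X_Ob[OF G(1)]] G(1) in blast)
  then have "g \<boxminus> g' = Zero D (L N) Y" using k(2) tri_Hom(6)[OF G(2)] perp_Ob[OF Y] by simp
  then show ?thesis by (rule minus_eq_zeroD[OF _ g])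
qed

lemma eta_zero_factors:
  assumes f: "f \<in> Hom D C N" "\<eta> N \<cdot> f = Zero D C (L N)"
  obtains G p q where "G \<in> \<X>" "p \<in> Hom D C G" "q \<in> Hom D G N" "q \<cdot> p = f"
proof -
  have N: "N \<in> Ob D" using f Hom_Ob by blast
  obtain G \<epsilon> w where G: "G \<in> \<X>" "tri G N (L N) \<epsilon> (\<eta> N) w" using reflection_triangle[OF N] .
  show thesis using lift_1[OF G(2) f] that[OF G(1) _ tri_Hom(4)[OF G(2)]] by blast
qed

text \<open>If there are no maps from \<open>P\<close> to local objects, the unit of \<open>P\<close> is zero, so \<open>L P = 0\<close> by the
  uniqueness in its universal property, and \<open>P\<close> is isomorphic to the object of \<open>\<X>\<close> in its triangle.\<close>

lemma in_X_if_left_orthogonal: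
  assumes P: "P \<in> Ob D" and z: "\<And>Y f. Y \<in> perp \<Longrightarrow> f \<in> Hom D P Y \<Longrightarrow> f = Zero D P Y"
  shows "P \<in> \<X>"
proof -
  obtain G \<epsilon> w where G: "G \<in> \<X>" "tri G P (L P) \<epsilon> (\<eta> P) w" using reflection_triangle[OF P] .
  have "\<eta> P = Zero D P (L P)" by (rule z[OF L_perp[OF P]]) (use P in simp)
  then have "Id D (L P) = Zero D (L P) (L P)"
    by - (rule eta_cancel[OF _ _ P L_perp[OF P]], use P in simp_all)
  then have "zero_object D (L P)" by (intro zero_objectI) (use P in simp_all)
  then have "L P \<in> \<X>" by (rule sub_zero_object[OF X_sub])
  then show ?thesis using sub_mid[OF X_sub G(2,1)] by blast
qed

lemma X_coproducts: "closed_under_small_coproducts D U \<X>"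
  unfolding closed_under_small_coproducts_def
proof (intro allI impI, elim conjE)
  fix I :: "'u set" and M S \<iota> assume M: "\<forall>i\<in>I. M i \<in> \<X>" and cop: "is_coproduct D I M S \<iota>"
  note c = coproduct_Hom[OF cop]
  show "S \<in> \<X>"
  proof (rule in_X_if_left_orthogonal[OF c(1)])
    fix Y f assume Y: "Y \<in> perp" and f: "f \<in> Hom D S Y"
    show "f = Zero D S Y"
    proof (rule coproduct_unique[OF cop f])
      show "Zero D S Y \<in> Hom D S Y" using c(1) perp_Ob[OF Y] by simp
      fix i assume i: "i \<in> I"
      have "f \<cdot> \<iota> i = Zero D (M i) Y"
        by (rule perp_zero[OF Y]) (use M i f c(3)[OF i] in simp_all)
      then show "f \<cdot> \<iota> i = Zero D S Y \<cdot> \<iota> i" using c(3)[OF i] perp_Ob[OF Y] by simp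
    qed
  qed
qed

subsection \<open>Functoriality and exactness\<close>

definition La :: "'m \<Rightarrow> 'm" where
  "La f = (SOME g. g \<in> Hom D (L (Dom D f)) (L (Cod D f)) \<and> g \<cdot> \<eta> (Dom D f) = \<eta> (Cod D f) \<cdot> f)"

lemma La:
  assumes f: "f \<in> Hom D M N" shows "La f \<in> Hom D (L M) (L N)" "La f \<cdot> \<eta> M = \<eta> N \<cdot> f"
proof -
  have Ob: "M \<in> Ob D" "N \<in> Ob D" using f Hom_Ob by blast+
  have "\<eta> N \<cdot> f \<in> Hom D M (L N)" using f Ob by simp
  then have "\<exists>g. g \<in> Hom D (L M) (L N) \<and> g \<cdot> \<eta> M = \<eta> N \<cdot> f" using eta_extend L_perp[OF Ob(2)] by metis
  moreover have "La f = (SOME g. g \<in> Hom D (L M) (L N) \<and> g \<cdot> \<eta> M = \<eta> N \<cdot> f)"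
    unfolding La_def using f by simp
  ultimately have "La f \<in> Hom D (L M) (L N) \<and> La f \<cdot> \<eta> M = \<eta> N \<cdot> f"
    by (simp only:) (rule someI_ex)
  then show "La f \<in> Hom D (L M) (L N)" "La f \<cdot> \<eta> M = \<eta> N \<cdot> f" by blast+
qed

lemma La_unique:
  assumes "f \<in> Hom D M N" "g \<in> Hom D (L M) (L N)" "g \<cdot> \<eta> M = \<eta> N \<cdot> f" shows "La f = g"
proof -
  have Ob: "M \<in> Ob D" "N \<in> Ob D" using assms(1) Hom_Ob by blast+
  show ?thesis
    by (rule eta_cancel[OF La(1)[OF assms(1)] assms(2) Ob(1) L_perp[OF Ob(2)]])
      (use La(2)[OF assms(1)] assms(3) in simp)
qed

lemma La_Arr [simp]:
  assumes "f \<in> Arr D"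
  shows "La f \<in> Arr D" "Dom D (La f) = L (Dom D f)" "Cod D (La f) = L (Cod D f)"
  using La(1)[of f "Dom D f" "Cod D f"] assms by simp_all

lemma La_Id [simp]: "N \<in> Ob D \<Longrightarrow> La (Id D N) = Id D (L N)"
  by (rule La_unique[of _ N N]) simp_all

lemma La_comp:
  assumes f: "f \<in> Hom D M N" and g: "g \<in> Hom D N P" shows "La (g \<cdot> f) = La g \<cdot> La f"
proof (rule La_unique[of _ M P])
  have Ob: "M \<in> Ob D" "N \<in> Ob D" "P \<in> Ob D" using f g Hom_Ob by blast+
  show "g \<cdot> f \<in> Hom D M P" using f g by simp
  show "La g \<cdot> La f \<in> Hom D (L M) (L P)" using f g by simp
  have "(La g \<cdot> La f) \<cdot> \<eta> M = La g \<cdot> (\<eta> N \<cdot> f)" using f g Ob La(2)[OF f] by simp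
  also have "\<dots> = (\<eta> P \<cdot> g) \<cdot> f"
    by (rule assoc_subst[OF La(2)[OF g]]) (use f g Ob in simp_all)
  finally show "(La g \<cdot> La f) \<cdot> \<eta> M = \<eta> P \<cdot> (g \<cdot> f)" using f g Ob by simp
qed

lemma La_plus:
  assumes f: "f \<in> Hom D M N" "g \<in> Hom D M N" shows "La (f \<boxplus> g) = La f \<boxplus> La g"
proof (rule La_unique[of _ M N])
  have Ob: "M \<in> Ob D" "N \<in> Ob D" using f Hom_Ob by blast+
  show "f \<boxplus> g \<in> Hom D M N" "La f \<boxplus> La g \<in> Hom D (L M) (L N)" using f by simp_all
  show "(La f \<boxplus> La g) \<cdot> \<eta> M = \<eta> N \<cdot> (f \<boxplus> g)" using f Ob La(2)[OF f(1)] La(2)[OF f(2)] by simp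
qed

lemma La_zero [simp]: "M \<in> Ob D \<Longrightarrow> N \<in> Ob D \<Longrightarrow> La (Zero D M N) = Zero D (L M) (L N)"
  by (rule La_unique[of _ M N]) simp_all

text \<open>Exactness of \<open>L\<close> in the middle: the cone of \<open>La u\<close> is orthogonal to \<open>\<X>\<close>, so the arrow from
  \<open>L N\<close> to it factors through \<open>La v\<close>.\<close>

lemma L_exact:
  assumes T: "tri N' N N'' u v w" and h: "h \<in> Hom D C (L N)" "La v \<cdot> h = Zero D C (L N'')"
  obtains h' where "h' \<in> Hom D C (L N')" "La u \<cdot> h' = h"
proof -
  note t = tri_Hom[OF T]
  have C: "C \<in> Ob D" using h Hom_Ob by blast
  note u = La[OF t(4)] and v = La[OF t(5)]
  obtain Z p q where Z: "tri (L N') (L N) Z (La u) p q"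
    using Tri_extend[OF _ _ u(1)] t by auto
  note z = tri_Hom[OF Z]
  have Zp: "Z \<in> perp" by (rule perp_cone[OF Z]) (use L_perp t in blast)+
  have p\<eta>: "p \<cdot> \<eta> N \<in> Hom D N Z" using z t by simp
  have "(p \<cdot> \<eta> N) \<cdot> u = p \<cdot> (La u \<cdot> \<eta> N')" using u(2) z t by simp
  also have "\<dots> = Zero D (L N') Z \<cdot> \<eta> N'"
    by (rule assoc_subst[OF comp_tri_1[OF Z] z(4,5)]) (use t in simp_all)
  also have "\<dots> = Zero D N' Z" using z t by simp
  finally obtain r where r: "r \<in> Hom D N'' Z" "r \<cdot> v = p \<cdot> \<eta> N" using extend_1[OF T p\<eta>] by blast
  obtain r' where r': "r' \<in> Hom D (L N'') Z" "r' \<cdot> \<eta> N'' = r" using eta_extend[OF r(1) Zp] .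
  have "r' \<cdot> La v = p"
  proof (rule eta_cancel[OF _ z(5) t(2) Zp])
    show "r' \<cdot> La v \<in> Hom D (L N) Z" using r'(1) v(1) by simp
    have "(r' \<cdot> La v) \<cdot> \<eta> N = r' \<cdot> (\<eta> N'' \<cdot> v)" using r'(1) v t by simp
    also have "\<dots> = r \<cdot> v" by (rule assoc_subst[OF r'(2) _ r'(1)]) (use t in simp_all)
    finally show "(r' \<cdot> La v) \<cdot> \<eta> N = p \<cdot> \<eta> N" using r(2) by simp
  qed
  then have "p \<cdot> h = r' \<cdot> (La v \<cdot> h)" using r'(1) v(1) h(1) by (simp flip: assoc)
  then have "p \<cdot> h = Zero D C Z" using h(2) r'(1) C by simp
  then show thesis using lift_1[OF Z h(1)] that by blast
qed

text \<open>A Milnor colimit of arrows that factor through \<open>\<X>\<close> has no non-zero arrows to an object \<open>Y\<close>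
  orthogonal to \<open>\<X>\<close>: such an arrow vanishes on every term, so it comes from an arrow \<open>\<Sigma> S \<rightarrow> Y\<close>, on
  which the shift of \<open>1 - \<sigma>\<close> acts as the identity; but consecutive arrows of a triangle compose to
  zero.\<close>

lemma Milnor_colimit_in_X:
  assumes C: "is_Milnor_colimit D M f C"
    and factor: "\<And>n. \<exists>G\<in>\<X>. \<exists>p\<in>Hom D (M n) G. \<exists>q\<in>Hom D G (M (Suc n)). q \<cdot> p = f n"
  shows "C \<in> \<X>"
proof -
  obtain S \<iota> \<sigma> v w where "Milnor_colimit D U M f C S \<iota> \<sigma> v w" using Milnor_colimit_data[OF C] .
  then interpret C: Milnor_colimit D U M f C S \<iota> \<sigma> v w .
  have f_kill: "g \<cdot> f n = Zero D (M n) Y" "h \<cdot> \<Sigma>\<^sub>a (f n) = Zero D (\<Sigma> (M n)) Y"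
    if Y: "Y \<in> perp" and g: "g \<in> Hom D (M (Suc n)) Y" "h \<in> Hom D (\<Sigma> (M (Suc n))) Y" for g h n Y
  proof -
    obtain G p q where G: "G \<in> \<X>" "p \<in> Hom D (M n) G" "q \<in> Hom D G (M (Suc n))" "q \<cdot> p = f n"
      using factor by blast
    have GOb: "G \<in> Ob D" "\<Sigma> G \<in> \<X>" using X_Ob[OF G(1)] G(1) sub_shift[OF X_sub] by blast+
    have "g \<cdot> q = Zero D G Y" by (rule perp_zero[OF Y G(1)]) (use g G(3) in simp)
    then have "g \<cdot> (q \<cdot> p) = Zero D G Y \<cdot> p" by (rule assoc_subst[OF _ G(3) g(1)]) (use G(2) in simp_all)
    then show "g \<cdot> f n = Zero D (M n) Y" using G(2,4) perp_Ob[OF Y] by simp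
    have "h \<cdot> \<Sigma>\<^sub>a q = Zero D (\<Sigma> G) Y" by (rule perp_zero[OF Y GOb(2)]) (use g G(3) in simp)
    then have "h \<cdot> (\<Sigma>\<^sub>a q \<cdot> \<Sigma>\<^sub>a p) = Zero D (\<Sigma> G) Y \<cdot> \<Sigma>\<^sub>a p"
      by (rule assoc_subst[OF _ _ g(2)]) (use G(2,3) in simp_all)
    then show "h \<cdot> \<Sigma>\<^sub>a (f n) = Zero D (\<Sigma> (M n)) Y"
      using shift_eq[OF G(4,2,3)] G(2) perp_Ob[OF Y] by simp
  qed
  show ?thesis
  proof (rule in_X_if_left_orthogonal[OF C.C_Ob])
    fix Y h assume Y: "Y \<in> perp" and h: "h \<in> Hom D C Y"
    note YOb = perp_Ob[OF Y]
    have "h \<cdot> v = Zero D S Y"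
    proof (rule coproduct_unique[OF C.cop])
      show "h \<cdot> v \<in> Hom D S Y" "Zero D S Y \<in> Hom D S Y" using h C.v C.S_Ob YOb by simp_all
      fix n
      have zero_in: "Zero D (\<Sigma> (M (Suc n))) Y \<in> Hom D (\<Sigma> (M (Suc n))) Y" using C.M_Ob YOb by simp
      have "(h \<cdot> (v \<cdot> \<iota> (Suc n))) \<cdot> f n = Zero D (M n) Y"
        by (rule f_kill(1)[OF Y _ zero_in]) (use h C.leg[of "Suc n"] in simp)
      then have "h \<cdot> (v \<cdot> \<iota> n) = Zero D (M n) Y"
        unfolding C.leg_compat[of n, symmetric] using h C.v C.\<iota>[of "Suc n"] C.f[of n] by simp
      then show "(h \<cdot> v) \<cdot> \<iota> n = Zero D S Y \<cdot> \<iota> n" using h C.v C.\<iota>[of n] YOb by simp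
    qed
    then obtain g where g: "g \<in> Hom D (\<Sigma> S) Y" "g \<cdot> w = h" using extend_2[OF C.T h] by blast
    have S\<sigma>: "\<Sigma>\<^sub>a (Id D S \<boxminus> \<sigma>) \<in> Hom D (\<Sigma> S) (\<Sigma> S)" using C.\<sigma> C.S_Ob by simp
    have g\<sigma>: "g \<cdot> \<Sigma>\<^sub>a \<sigma> = Zero D (\<Sigma> S) Y"
    proof (rule coproduct_unique[OF coproduct_shift[OF C.cop]])
      show "g \<cdot> \<Sigma>\<^sub>a \<sigma> \<in> Hom D (\<Sigma> S) Y" "Zero D (\<Sigma> S) Y \<in> Hom D (\<Sigma> S) Y"
        using g(1) C.\<sigma> C.S_Ob YOb by simp_all
      fix n
      have "(g \<cdot> \<Sigma>\<^sub>a \<sigma>) \<cdot> \<Sigma>\<^sub>a (\<iota> n) = g \<cdot> \<Sigma>\<^sub>a (\<sigma> \<cdot> \<iota> n)" using g(1) C.\<sigma> C.\<iota>[of n] by simp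
      also have "\<dots> = (g \<cdot> \<Sigma>\<^sub>a (\<iota> (Suc n))) \<cdot> \<Sigma>\<^sub>a (f n)"
        unfolding C.\<sigma>\<iota> using g(1) C.\<iota>[of "Suc n"] C.f[of n] by simp
      also have "\<dots> = Zero D (\<Sigma> (M n)) Y"
        by (rule f_kill(2)[OF Y, of "Zero D (M (Suc n)) Y"])
          (use g(1) C.\<iota>[of "Suc n"] C.M_Ob YOb in simp_all)
      finally show "(g \<cdot> \<Sigma>\<^sub>a \<sigma>) \<cdot> \<Sigma>\<^sub>a (\<iota> n) = Zero D (\<Sigma> S) Y \<cdot> \<Sigma>\<^sub>a (\<iota> n)" using C.\<iota>[of n] YOb by simp
    qed
    have "g \<cdot> \<Sigma>\<^sub>a (Id D S \<boxminus> \<sigma>) = g" using g(1) C.\<sigma> C.S_Ob YOb by (simp add: g\<sigma>)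
    then have "h = g \<cdot> (\<Sigma>\<^sub>a (Id D S \<boxminus> \<sigma>) \<cdot> w)"
      unfolding g(2)[symmetric] by - (rule assoc_subst[OF _ S\<sigma> g(1), symmetric], use C.w in simp_all)
    then show "h = Zero D C Y" unfolding comp_tri_3[OF C.T] using g(1) C.C_Ob by simp
  qed
qed

end

section \<open>Maps into local objects come from compact objects\<close>

text \<open>The test objects form a subcategory \<open>\<T>\<close> closed under cones, because the arguments below
  take cones and fibres of arrows between them; its small skeleton bounds the number of sequences of
  test objects.\<close>

locale smashing_with_compacts = smashing_localization D U \<X>
  for D :: "('o, 'm, 'x) triangulated_data_scheme" (structure) and U :: "'u set" and \<X> +
  fixes \<T> :: "'o set"
  assumes T_sub: "triangulated_subcategory D \<T>"
    and T_compact: "C \<in> \<T> \<Longrightarrow> compact_object D U C"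
    and T_generates: "\<lbrakk> M \<in> Ob D; \<forall>C\<in>\<T>. Hom D C M = {Zero D C M} \<rbrakk> \<Longrightarrow> zero_object D M"
    and T_skeleton: "\<exists>\<K>. \<K> \<prec> U \<and> \<K> \<subseteq> \<T> \<and> (\<forall>C\<in>\<T>. \<exists>K\<in>\<K>. isomorphic D C K)"
begin

lemma T_Ob: "C \<in> \<T> \<Longrightarrow> C \<in> Ob D"
  using sub_Ob[OF T_sub] .

text \<open>The next four definitions express that, for each \<open>C\<close> in \<open>\<T>\<close>, the canonical map from the colimit
  of the groups \<open>D(C, L K)\<close>, over the objects \<open>K\<close> of \<open>\<T>\<close> equipped with an arrow to \<open>N\<close>, to the group
  \<open>D(C, L N)\<close> is surjective (\<open>T_onto\<close>) and injective (\<open>T_into\<close>).\<close>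

definition lifts :: "'o \<Rightarrow> 'm \<Rightarrow> bool" where
  "lifts N h \<longleftrightarrow> (\<exists>K\<in>\<T>. \<exists>u\<in>Hom D K N. \<exists>h'\<in>Hom D (Dom D h) (L K). La u \<cdot> h' = h)"

definition T_onto :: "'o \<Rightarrow> bool" where
  "T_onto N \<longleftrightarrow> (\<forall>C\<in>\<T>. \<forall>h\<in>Hom D C (L N). lifts N h)"

definition kills :: "'m \<Rightarrow> 'm \<Rightarrow> bool" where
  "kills k f \<longleftrightarrow> (\<exists>K\<in>\<T>. \<exists>a\<in>Hom D (Dom D f) K. \<exists>b\<in>Hom D K (Cod D f).
     b \<cdot> a = f \<and> La a \<cdot> k = Zero D (Dom D k) (L K))"

definition T_into :: "'o \<Rightarrow> bool" where
  "T_into N \<longleftrightarrow> (\<forall>C\<in>\<T>. \<forall>K\<in>\<T>. \<forall>k\<in>Hom D C (L K). \<forall>f\<in>Hom D K N.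
     La f \<cdot> k = Zero D C (L N) \<longrightarrow> kills k f)"

text \<open>This is equivalent to \<open>T_onto N\<close> and \<open>T_into (\<Sigma> N)\<close> together, by the lemmas \<open>T_stable_onto\<close>,
  \<open>T_stable_into\<close> and \<open>T_stableI\<close>, but in this form it passes to extensions by a single application of
  the octahedral axiom.\<close>

definition T_stable :: "'o \<Rightarrow> bool" where
  "T_stable N \<longleftrightarrow> (\<forall>Q K i q f. tri N Q K i q f \<longrightarrow> K \<in> \<T> \<longrightarrow> T_onto Q)"

lemma liftsI:
  "K \<in> \<T> \<Longrightarrow> u \<in> Hom D K N \<Longrightarrow> h' \<in> Hom D C (L K) \<Longrightarrow> La u \<cdot> h' = h \<Longrightarrow> h \<in> Hom D C (L N) \<Longrightarrow> lifts N h"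
  unfolding lifts_def by (intro bexI[of _ K] bexI[of _ u] bexI[of _ h']) simp_all

lemma liftsE:
  assumes "lifts N h" "h \<in> Hom D C (L N)"
  obtains K u h' where "K \<in> \<T>" "u \<in> Hom D K N" "h' \<in> Hom D C (L K)" "La u \<cdot> h' = h"
proof -
  have "Dom D h = C" using assms(2) by simp
  from assms(1)[unfolded lifts_def this] show thesis using that by blast
qed

lemma lifts_plus:
  assumes h: "h1 \<in> Hom D C (L N)" "h2 \<in> Hom D C (L N)" and l: "lifts N h1" "lifts N h2"
  shows "lifts N (h1 \<boxplus> h2)"
proof -
  obtain K1 u1 k1 where 1: "K1 \<in> \<T>" "u1 \<in> Hom D K1 N" "k1 \<in> Hom D C (L K1)" "La u1 \<cdot> k1 = h1"
    using liftsE[OF l(1) h(1)] .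
  obtain K2 u2 k2 where 2: "K2 \<in> \<T>" "u2 \<in> Hom D K2 N" "k2 \<in> Hom D C (L K2)" "La u2 \<cdot> k2 = h2"
    using liftsE[OF l(2) h(2)] .
  obtain K s t where K: "K \<in> \<T>" "s \<in> Hom D K1 K" "t \<in> Hom D K2 K"
    "\<And>N f g. f \<in> Hom D K1 N \<Longrightarrow> g \<in> Hom D K2 N \<Longrightarrow> \<exists>h\<in>Hom D K N. h \<cdot> s = f \<and> h \<cdot> t = g"
    using weak_biproduct[OF T_sub 1(1) 2(1)] by metis
  obtain u where u: "u \<in> Hom D K N" "u \<cdot> s = u1" "u \<cdot> t = u2" using K(4)[OF 1(2) 2(2)] by blast
  have La1: "La u \<cdot> La s = La u1" using La_comp[OF K(2) u(1)] u(2) by simp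
  have La2: "La u \<cdot> La t = La u2" using La_comp[OF K(3) u(1)] u(3) by simp
  let ?k = "La s \<cdot> k1 \<boxplus> La t \<cdot> k2"
  have "La u \<cdot> (La s \<cdot> k1) = h1"
    unfolding 1(4)[symmetric]
    by (rule assoc_subst[OF La1 La(1)[OF K(2)] La(1)[OF u(1)]]) (use 1(3) in simp_all)
  moreover have "La u \<cdot> (La t \<cdot> k2) = h2"
    unfolding 2(4)[symmetric]
    by (rule assoc_subst[OF La2 La(1)[OF K(3)] La(1)[OF u(1)]]) (use 2(3) in simp_all)
  moreover have "La s \<cdot> k1 \<in> Hom D C (L K)" "La t \<cdot> k2 \<in> Hom D C (L K)" using 1(3) 2(3) K(2,3) by simp_all
  moreover from this have "La u \<cdot> ?k = La u \<cdot> (La s \<cdot> k1) \<boxplus> La u \<cdot> (La t \<cdot> k2)"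
    by (intro comp_plus) (use u(1) in auto)
  ultimately show ?thesis using liftsI[OF K(1) u(1), of ?k C] h by simp
qed

lemma lifts_comp:
  assumes h: "h \<in> Hom D C (L N)" "lifts N h" and g: "g \<in> Hom D N N'" shows "lifts N' (La g \<cdot> h)"
proof -
  obtain K u k where K: "K \<in> \<T>" "u \<in> Hom D K N" "k \<in> Hom D C (L K)" "La u \<cdot> k = h"
    using liftsE[OF h(2,1)] .
  have "La (g \<cdot> u) \<cdot> k = La g \<cdot> h" unfolding La_comp[OF K(2) g] K(4)[symmetric] using K(2,3) g by simp
  then show ?thesis by - (rule liftsI[OF K(1) _ K(3)], use K(2) g h(1) in simp_all)
qed

lemma lifts_zero:
  assumes "C \<in> \<T>" "N \<in> Ob D" shows "lifts N (Zero D C (L N))"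
  by (rule liftsI[OF assms(1), of "Zero D C N" _ "Zero D C (L C)" C]) (use assms T_Ob in simp_all)

lemma T_onto_T: "N \<in> \<T> \<Longrightarrow> T_onto N"
  unfolding T_onto_def by (auto intro!: liftsI[of N "Id D N"] simp: T_Ob)

lemma killsI:
  "K' \<in> \<T> \<Longrightarrow> a \<in> Hom D K K' \<Longrightarrow> b \<in> Hom D K' N \<Longrightarrow> b \<cdot> a = f \<Longrightarrow> f \<in> Hom D K N
   \<Longrightarrow> k \<in> Hom D C (L K) \<Longrightarrow> La a \<cdot> k = Zero D C (L K') \<Longrightarrow> kills k f"
  unfolding kills_def by (intro bexI[of _ K'] bexI[of _ a] bexI[of _ b]) simp_all

lemma killsE:
  assumes "kills k f" "f \<in> Hom D K N" "k \<in> Hom D C (L K)"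
  obtains K' a b where "K' \<in> \<T>" "a \<in> Hom D K K'" "b \<in> Hom D K' N" "b \<cdot> a = f" "La a \<cdot> k = Zero D C (L K')"
proof -
  have "Dom D k = C" "Dom D f = K" "Cod D f = N" using assms(2,3) by simp_all
  from assms(1)[unfolded kills_def this] show thesis using that by blast
qed

lemma kills_plus:
  assumes k: "k \<in> Hom D C (L K)" and f: "f1 \<in> Hom D K N" "f2 \<in> Hom D K N"
    and l: "kills k f1" "kills k f2"
  shows "kills k (f1 \<boxplus> f2)"
proof -
  have Ob: "C \<in> Ob D" "K \<in> Ob D" "N \<in> Ob D" using k f Hom_Ob by blast+
  obtain K1 a1 b1 where 1: "K1 \<in> \<T>" "a1 \<in> Hom D K K1" "b1 \<in> Hom D K1 N" "b1 \<cdot> a1 = f1"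
    "La a1 \<cdot> k = Zero D C (L K1)" using killsE[OF l(1) f(1) k] .
  obtain K2 a2 b2 where 2: "K2 \<in> \<T>" "a2 \<in> Hom D K K2" "b2 \<in> Hom D K2 N" "b2 \<cdot> a2 = f2"
    "La a2 \<cdot> k = Zero D C (L K2)" using killsE[OF l(2) f(2) k] .
  obtain K' s t where K': "K' \<in> \<T>" "s \<in> Hom D K1 K'" "t \<in> Hom D K2 K'"
    "\<And>N f g. f \<in> Hom D K1 N \<Longrightarrow> g \<in> Hom D K2 N \<Longrightarrow> \<exists>h\<in>Hom D K' N. h \<cdot> s = f \<and> h \<cdot> t = g"
    using weak_biproduct[OF T_sub 1(1) 2(1)] by metis
  obtain b where b: "b \<in> Hom D K' N" "b \<cdot> s = b1" "b \<cdot> t = b2" using K'(4)[OF 1(3) 2(3)] by blast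
  let ?a = "s \<cdot> a1 \<boxplus> t \<cdot> a2"
  have sa: "s \<cdot> a1 \<in> Hom D K K'" "t \<cdot> a2 \<in> Hom D K K'" using 1(2) 2(2) K'(2,3) by simp_all
  have "b \<cdot> (s \<cdot> a1) = f1"
    unfolding 1(4)[symmetric] by (rule assoc_subst[OF b(2) K'(2) b(1)]) (use 1(2) in simp_all)
  moreover have "b \<cdot> (t \<cdot> a2) = f2"
    unfolding 2(4)[symmetric] by (rule assoc_subst[OF b(3) K'(3) b(1)]) (use 2(2) in simp_all)
  moreover have "b \<cdot> ?a = b \<cdot> (s \<cdot> a1) \<boxplus> b \<cdot> (t \<cdot> a2)"
    by (rule comp_plus) (use sa b(1) in auto)
  ultimately have ba: "b \<cdot> ?a = f1 \<boxplus> f2" by simp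
  have "La ?a \<cdot> k = La (s \<cdot> a1) \<cdot> k \<boxplus> La (t \<cdot> a2) \<cdot> k"
    unfolding La_plus[OF sa] by (rule plus_comp) (use sa k in auto)
  also have "La (s \<cdot> a1) \<cdot> k = La s \<cdot> (La a1 \<cdot> k)"
    unfolding La_comp[OF 1(2) K'(2)] by (rule assoc) (use 1(2) K'(2) k in auto)
  also have "La (t \<cdot> a2) \<cdot> k = La t \<cdot> (La a2 \<cdot> k)"
    unfolding La_comp[OF 2(2) K'(3)] by (rule assoc) (use 2(2) K'(3) k in auto)
  finally have "La ?a \<cdot> k = Zero D C (L K')"
    unfolding 1(5) 2(5) using Ob K'(1-3) T_Ob by simp
  then show ?thesis by - (rule killsI[OF K'(1) _ b(1) ba _ k], use sa f in simp_all)
qed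

lemma kills_comp:
  assumes k: "k \<in> Hom D C (L K)" and f: "f \<in> Hom D K N" "kills k f" and g: "g \<in> Hom D N N'"
  shows "kills k (g \<cdot> f)"
proof -
  obtain K1 a b where K: "K1 \<in> \<T>" "a \<in> Hom D K K1" "b \<in> Hom D K1 N" "b \<cdot> a = f"
    "La a \<cdot> k = Zero D C (L K1)" using killsE[OF f(2,1) k] .
  have "(g \<cdot> b) \<cdot> a = g \<cdot> f" unfolding K(4)[symmetric] using K(2,3) g by simp
  then show ?thesis by - (rule killsI[OF K(1,2) _ _ _ k K(5)], use K(3) f(1) g in simp_all)
qed

lemma kills_zero:
  assumes k: "k \<in> Hom D C (L K)" and K: "K \<in> Ob D" and N: "N \<in> Ob D"
  shows "kills k (Zero D K N)"
proof -
  have C: "C \<in> Ob D" using k Hom_Ob by blast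
  obtain Z where Z: "Z \<in> \<T>" using sub_zero[OF T_sub] .
  show ?thesis
    by (rule killsI[OF Z, of "Zero D K Z" K "Zero D Z N" N _ k C])
      (use T_Ob[OF Z] k K N C in simp_all)
qed

text \<open>Half of a five lemma for the comparison maps. The image in \<open>L N''\<close> of a map
  \<open>h : C \<rightarrow> L N\<close> comes from some \<open>K \<rightarrow> N''\<close>; injectivity for \<open>\<Sigma> N'\<close> allows \<open>K\<close> to be replaced by an object \<open>K3\<close> whose arrow to \<open>N''\<close>
  lifts to \<open>N\<close>. The difference between \<open>h\<close> and the resulting map comes from \<open>L N'\<close>.\<close>

lemma T_onto_extension:
  assumes T: "tri N' N N'' u v w" and N': "T_onto N'" and N'': "T_onto N''" and into: "T_into (\<Sigma> N')"
  shows "T_onto N"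
  unfolding T_onto_def
proof (intro ballI)
  note t = tri_Hom[OF T]
  fix C h assume C: "C \<in> \<T>" and h: "h \<in> Hom D C (L N)"
  have Lvh: "La v \<cdot> h \<in> Hom D C (L N'')" using h t by simp
  then have "lifts N'' (La v \<cdot> h)" using N'' C unfolding T_onto_def by blast
  then obtain K p k where K: "K \<in> \<T>" "p \<in> Hom D K N''" "k \<in> Hom D C (L K)" "La p \<cdot> k = La v \<cdot> h"
    using liftsE[OF _ Lvh] by metis
  let ?f = "w \<cdot> p"
  have f: "?f \<in> Hom D K (\<Sigma> N')" using K(2) t by simp
  have "La ?f \<cdot> k = La w \<cdot> (La p \<cdot> k)" unfolding La_comp[OF K(2) t(6)] using K(2,3) t by simp
  also have "\<dots> = La (w \<cdot> v) \<cdot> h" unfolding K(4) La_comp[OF t(5,6)] using t h by simp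
  also have "\<dots> = Zero D C (L (\<Sigma> N'))" unfolding comp_tri_2[OF T] using t h by simp
  finally have "kills k ?f" using into C K(1,3) f unfolding T_into_def by blast
  then obtain K2 a b where a: "K2 \<in> \<T>" "a \<in> Hom D K K2" "b \<in> Hom D K2 (\<Sigma> N')" "b \<cdot> a = ?f"
    "La a \<cdot> k = Zero D C (L K2)" using killsE[OF _ f K(3)] by metis
  obtain K3 r s where R: "tri K3 K K2 r a s" using fibre_exists[OF a(2)] .
  have K3: "K3 \<in> \<T>" by (rule sub_fibre[OF T_sub R K(1) a(1)])
  note r = tri_Hom[OF R]
  obtain k3 where k3: "k3 \<in> Hom D C (L K3)" "La r \<cdot> k3 = k" using L_exact[OF R K(3) a(5)] .
  have "w \<cdot> (p \<cdot> r) = b \<cdot> (a \<cdot> r)" using assoc_subst[OF a(4,2,3), of r] r K(2) t by simp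
  also have "\<dots> = Zero D K3 (\<Sigma> N')" unfolding comp_tri_1[OF R] using a(3) r by simp
  finally obtain m where m: "m \<in> Hom D K3 N" "v \<cdot> m = p \<cdot> r"
    using lift_2[OF T, of "p \<cdot> r" K3] K(2) r by auto
  let ?d = "h \<boxminus> La m \<cdot> k3"
  have mk: "La m \<cdot> k3 \<in> Hom D C (L N)" using m(1) k3(1) by simp
  have d: "?d \<in> Hom D C (L N)" using h mk by simp
  have "La v \<cdot> (La m \<cdot> k3) = La p \<cdot> (La r \<cdot> k3)"
  proof -
    have "La v \<cdot> (La m \<cdot> k3) = La (v \<cdot> m) \<cdot> k3" unfolding La_comp[OF m(1) t(5)] using m(1) t k3(1) by simp
    also have "\<dots> = La p \<cdot> (La r \<cdot> k3)" unfolding m(2) La_comp[OF r(4) K(2)] using K(2) r k3(1) by simp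
    finally show ?thesis .
  qed
  also have "\<dots> = La v \<cdot> h" unfolding k3(2) K(4) ..
  finally have vmk: "La v \<cdot> (La m \<cdot> k3) = La v \<cdot> h" .
  have "La v \<cdot> ?d = La v \<cdot> h \<boxminus> La v \<cdot> (La m \<cdot> k3)"
    using h mk La(1)[OF t(5)] by (simp del: assoc)
  then have "La v \<cdot> ?d = Zero D C (L N'')" unfolding vmk using Lvh by simp
  then obtain h' where h': "h' \<in> Hom D C (L N')" "La u \<cdot> h' = ?d" using L_exact[OF T d] by blast
  have "lifts N' h'" using N' C h'(1) unfolding T_onto_def by blast
  then have "lifts N ?d" using lifts_comp[OF h'(1) _ t(4)] h'(2) by simp
  moreover have "lifts N (La m \<cdot> k3)" by (rule liftsI[OF K3 m(1) k3(1) refl mk])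
  ultimately have "lifts N (?d \<boxplus> La m \<cdot> k3)" using lifts_plus[OF d mk] by blast
  then show "lifts N h" using minus_plus_cancel(1)[OF h mk] by simp
qed

text \<open>Injectivity follows from surjectivity for fibres: if \<open>k : C \<rightarrow> L K\<close> dies in \<open>L N\<close>, it comes from
  \<open>L Q\<close> for the fibre \<open>Q\<close> of \<open>K \<rightarrow> N\<close>, hence from \<open>L J\<close> for some \<open>J \<rightarrow> Q\<close> with \<open>J\<close> in \<open>\<T>\<close>, and then \<open>k\<close> dies
  in the cone of \<open>J \<rightarrow> Q \<rightarrow> K\<close>, over which \<open>K \<rightarrow> N\<close> factors.\<close>

lemma T_into_if_fibres:
  assumes N: "N \<in> Ob D" and Q: "\<And>K Q q f s. K \<in> \<T> \<Longrightarrow> tri Q K N q f s \<Longrightarrow> T_onto Q"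
  shows "T_into N"
  unfolding T_into_def
proof (intro ballI impI)
  fix C K k f assume C: "C \<in> \<T>" and K: "K \<in> \<T>" and k: "k \<in> Hom D C (L K)" and f: "f \<in> Hom D K N"
    and z: "La f \<cdot> k = Zero D C (L N)"
  obtain Q q s where T: "tri Q K N q f s" using fibre_exists[OF f] .
  note t = tri_Hom[OF T]
  obtain j where j: "j \<in> Hom D C (L Q)" "La q \<cdot> j = k" using L_exact[OF T k z] .
  have "lifts Q j" using Q[OF K T] C j(1) unfolding T_onto_def by blast
  then obtain J u i where J: "J \<in> \<T>" "u \<in> Hom D J Q" "i \<in> Hom D C (L J)" "La u \<cdot> i = j"
    using liftsE[OF _ j(1)] by metis
  have qu: "q \<cdot> u \<in> Hom D J K" using J(2) t by simp
  obtain K' a w where R: "tri J K K' (q \<cdot> u) a w" using Tri_extend[OF T_Ob[OF J(1)] T_Ob[OF K] qu] by blast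
  note r = tri_Hom[OF R]
  have K': "K' \<in> \<T>" by (rule sub_cone[OF T_sub R J(1) K])
  have "f \<cdot> (q \<cdot> u) = Zero D Q N \<cdot> u"
    by (rule assoc_subst[OF comp_tri_1[OF T] t(4,5)]) (use J(2) in simp_all)
  then have "f \<cdot> (q \<cdot> u) = Zero D J N" using J(2) N by simp
  then obtain b where b: "b \<in> Hom D K' N" "b \<cdot> a = f" using extend_1[OF R f] by blast
  have "k = La (q \<cdot> u) \<cdot> i"
    unfolding La_comp[OF J(2) t(4)] using J(2,3) t by (simp add: J(4) j(2))
  then have "La a \<cdot> k = La (a \<cdot> (q \<cdot> u)) \<cdot> i"
    unfolding La_comp[OF qu r(5)] using qu r(5) J(3) by simp
  also have "\<dots> = Zero D C (L K')" unfolding comp_tri_1[OF R] using J(3) r by simp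
  finally show "kills k f" by (rule killsI[OF K' r(5) b(1,2) f k])
qed

lemma T_stable_onto: "N \<in> Ob D \<Longrightarrow> T_stable N \<Longrightarrow> T_onto N"
proof -
  assume N: "N \<in> Ob D" "T_stable N"
  obtain Z where Z: "Z \<in> \<T>" "zero_object D Z" using sub_zero[OF T_sub] .
  show "T_onto N" using Tri_Id[OF N(1) Z(2)] N(2) Z(1) unfolding T_stable_def by blast
qed

lemma T_stable_into:
  assumes N: "N \<in> Ob D" "T_stable N" shows "T_into (\<Sigma> N)"
proof (rule T_into_if_fibres)
  show "\<Sigma> N \<in> Ob D" using N(1) by simp
  fix K Q q f s assume K: "K \<in> \<T>" and T: "tri Q K (\<Sigma> N) q f s"
  obtain i where "tri N Q K i q f" using unrotate[OF T N(1)] .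
  then show "T_onto Q" using N(2) K unfolding T_stable_def by blast
qed

lemma T_stableI: "T_onto N \<Longrightarrow> T_into (\<Sigma> N) \<Longrightarrow> T_stable N"
  unfolding T_stable_def using T_onto_extension T_onto_T by blast

text \<open>For an extension \<open>N \<rightarrow> Q \<rightarrow> K\<close> of \<open>K\<close> in \<open>\<T>\<close>, the cone of \<open>N' \<rightarrow> N \<rightarrow> Q\<close> is an extension of \<open>K\<close> by
  \<open>N''\<close>, so \<open>Q\<close> is an extension of objects to which \<open>T_onto_extension\<close> applies.\<close>

lemma T_stable_extension:
  assumes T: "tri N' N N'' u v w" and N': "T_stable N'" and N'': "T_stable N''"
  shows "T_stable N"
  unfolding T_stable_def
proof (intro allI impI)
  note t = tri_Hom[OF T]
  fix Q K i q f assume Q: "tri N Q K i q f" and K: "K \<in> \<T>"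
  note s = tri_Hom[OF Q]
  have iu: "i \<cdot> u \<in> Hom D N' Q" using t s by simp
  obtain E c c' where E: "tri N' Q E (i \<cdot> u) c c'" using Tri_extend[OF t(1) s(2) iu] by blast
  obtain p r where "tri N'' E K p r (\<Sigma>\<^sub>a v \<cdot> f)" using Tri_octahedral[OF T Q E] by blast
  then have "T_onto E" using N'' K unfolding T_stable_def by blast
  then show "T_onto Q"
    using T_onto_extension[OF E T_stable_onto[OF t(1) N'] _ T_stable_into[OF t(1) N']] by blast
qed

text \<open>This is where \<open>\<X>\<close> is required to be smashing: the coproduct \<open>P\<close> of the objects \<open>L (N i)\<close> is
  again local, which makes \<open>L S\<close> a retract of it; and a map from the compact object \<open>C\<close> to \<open>P\<close> is a
  finite sum of maps to summands.\<close>

lemma T_onto_coproduct: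
  assumes A: "A \<prec> U" and cop: "is_coproduct D A N S \<iota>" and onto: "\<And>i. i \<in> A \<Longrightarrow> T_onto (N i)"
  shows "T_onto S"
  unfolding T_onto_def
proof (intro ballI)
  fix C h assume C: "C \<in> \<T>" and h: "h \<in> Hom D C (L S)"
  note c = coproduct_Hom[OF cop]
  obtain P \<kappa> where P: "is_coproduct D A (\<lambda>i. L (N i)) P \<kappa>"
    using small_coproduct[OF A, of "\<lambda>i. L (N i)"] c(2) by auto
  note p = coproduct_Hom[OF P]
  have Pp: "P \<in> perp"
    by (rule small_coproduct_closed[OF _ universe_axioms A P])
      (use smashing c(2) L_perp in \<open>auto simp: smashing_subcategory_def\<close>)
  have \<kappa>\<eta>: "\<kappa> i \<cdot> \<eta> (N i) \<in> Hom D (N i) P" if "i \<in> A" for i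
    using p(3)[OF that] c(2)[OF that] by simp
  obtain t where t: "t \<in> Hom D S P" "\<And>i. i \<in> A \<Longrightarrow> t \<cdot> \<iota> i = \<kappa> i \<cdot> \<eta> (N i)"
    by (rule coproduct_map[where g = "\<lambda>i. \<kappa> i \<cdot> \<eta> (N i)", OF cop p(1) \<kappa>\<eta>], assumption, rule that)
  obtain t' where t': "t' \<in> Hom D (L S) P" "t' \<cdot> \<eta> S = t" using eta_extend[OF t(1) Pp] .
  obtain r where r: "r \<in> Hom D P (L S)" "\<And>i. i \<in> A \<Longrightarrow> r \<cdot> \<kappa> i = La (\<iota> i)"
    by (rule coproduct_map[where g = "\<lambda>i. La (\<iota> i)", OF P L_Ob[OF c(1)] La(1)[OF c(3)]], assumption, rule that)
  have rt: "r \<cdot> t = \<eta> S"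
  proof (rule coproduct_unique[OF cop])
    show "r \<cdot> t \<in> Hom D S (L S)" "\<eta> S \<in> Hom D S (L S)" using r(1) t(1) c(1) by simp_all
    fix i assume i: "i \<in> A"
    have "(r \<cdot> t) \<cdot> \<iota> i = r \<cdot> (\<kappa> i \<cdot> \<eta> (N i))" using r(1) t(1) c(3)[OF i] by (simp add: t(2)[OF i])
    also have "\<dots> = La (\<iota> i) \<cdot> \<eta> (N i)"
      by (rule assoc_subst[OF r(2)[OF i] p(3)[OF i] r(1)]) (use c(2)[OF i] in simp_all)
    finally show "(r \<cdot> t) \<cdot> \<iota> i = \<eta> S \<cdot> \<iota> i" using La(2)[OF c(3)[OF i]] by simp
  qed
  have "r \<cdot> t' = Id D (L S)"
    by (rule eta_cancel[OF _ _ c(1) L_perp[OF c(1)]]) (use r(1) t' c(1) rt in simp_all)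
  then have rth: "r \<cdot> (t' \<cdot> h) = h" using assoc_subst[OF _ t'(1) r(1), of "Id D (L S)" h] h by simp
  have t'h: "t' \<cdot> h \<in> Hom D C P" using t'(1) h by simp
  let ?B = "{x \<in> Hom D C P. lifts S (r \<cdot> x)}"
  have "t' \<cdot> h \<in> ?B"
  proof (rule finitely_supported_mem[OF P compact_object_finitely_supported[OF universe_axioms T_compact[OF C] A P t'h] t'h])
    show "Zero D C P \<in> ?B" using lifts_zero[OF C c(1)] r(1) p(1) T_Ob[OF C] by simp
    show "x \<boxplus> y \<in> ?B" if x: "x \<in> ?B" and y: "y \<in> ?B" for x y
    proof -
      have "lifts S (r \<cdot> x \<boxplus> r \<cdot> y)" by (rule lifts_plus[of _ C]) (use x y r(1) in simp_all)
      then show ?thesis using x y r(1) by simp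
    qed
    fix i q assume i: "i \<in> A" and q: "q \<in> Hom D P (L (N i))"
    have y: "q \<cdot> (t' \<cdot> h) \<in> Hom D C (L (N i))" using q t'h by simp
    have "lifts (N i) (q \<cdot> (t' \<cdot> h))" using onto[OF i] C y unfolding T_onto_def by blast
    then have "lifts S (La (\<iota> i) \<cdot> (q \<cdot> (t' \<cdot> h)))" by (rule lifts_comp[OF y _ c(3)[OF i]])
    moreover have "r \<cdot> (\<kappa> i \<cdot> (q \<cdot> (t' \<cdot> h))) = La (\<iota> i) \<cdot> (q \<cdot> (t' \<cdot> h))"
      by (rule assoc_subst[OF r(2)[OF i] p(3)[OF i] r(1)]) (use y in simp_all)
    moreover have "\<kappa> i \<cdot> (q \<cdot> (t' \<cdot> h)) \<in> Hom D C P" using p(3)[OF i] y by simp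
    ultimately show "\<kappa> i \<cdot> (q \<cdot> (t' \<cdot> h)) \<in> ?B" by simp
  qed
  then show "lifts S h" using rth by simp
qed

text \<open>The compact object \<open>K\<close> maps to finitely many summands; the components of \<open>f\<close> are projections of
  \<open>f\<close>, so they send \<open>k\<close> to zero as well.\<close>

lemma T_into_coproduct:
  assumes A: "A \<prec> U" and cop: "is_coproduct D A N S \<iota>" and into: "\<And>i. i \<in> A \<Longrightarrow> T_into (N i)"
  shows "T_into S"
  unfolding T_into_def
proof (intro ballI impI)
  fix C K k f assume C: "C \<in> \<T>" and K: "K \<in> \<T>" and k: "k \<in> Hom D C (L K)" and f: "f \<in> Hom D K S"
    and z: "La f \<cdot> k = Zero D C (L S)"
  note c = coproduct_Hom[OF cop]
  let ?B = "{f \<in> Hom D K S. kills k f}"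
  have "f \<in> ?B"
  proof (rule finitely_supported_mem[OF cop compact_object_finitely_supported[OF universe_axioms T_compact[OF K] A cop f] f])
    show "Zero D K S \<in> ?B" using kills_zero[OF k T_Ob[OF K] c(1)] T_Ob[OF K] c(1) by simp
    show "g \<boxplus> h \<in> ?B" if "g \<in> ?B" "h \<in> ?B" for g h
      using that kills_plus[OF k, of g S h] by simp
    fix i p assume i: "i \<in> A" and p: "p \<in> Hom D S (N i)"
    have pf: "p \<cdot> f \<in> Hom D K (N i)" using p f by simp
    have "La (p \<cdot> f) \<cdot> k = La p \<cdot> (La f \<cdot> k)" unfolding La_comp[OF f p] using p f k by simp
    also have "\<dots> = Zero D C (L (N i))" unfolding z using p c(1) T_Ob[OF C] by simp
    finally have "kills k (p \<cdot> f)" using into[OF i] C K k pf unfolding T_into_def by blast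
    then have "kills k (\<iota> i \<cdot> (p \<cdot> f))" by (rule kills_comp[OF k pf _ c(3)[OF i]])
    then show "\<iota> i \<cdot> (p \<cdot> f) \<in> ?B" using c(3)[OF i] pf by simp
  qed
  then show "kills k f" by simp
qed

lemma T_stable_coproduct:
  assumes A: "A \<prec> U" and cop: "is_coproduct D A N S \<iota>" and s: "\<And>i. i \<in> A \<Longrightarrow> T_stable (N i)"
  shows "T_stable S"
proof (rule T_stableI)
  note c = coproduct_Hom[OF cop]
  show "T_onto S" by (rule T_onto_coproduct[OF A cop]) (use T_stable_onto c(2) s in blast)
  show "T_into (\<Sigma> S)" by (rule T_into_coproduct[OF A coproduct_shift[OF cop]]) (use T_stable_into c(2) s in blast)
qed

text \<open>The objects all of whose positive shifts are stable form a suspended class that is closed under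
  coproducts and contains the generators, so they are all the objects of the category.\<close>

lemma all_T_stable:
  assumes N: "N \<in> Ob D" shows "T_stable N"
proof -
  obtain \<K> where K: "\<K> \<prec> U" "\<K> \<subseteq> \<T>" "\<And>C. C \<in> \<T> \<Longrightarrow> \<exists>K\<in>\<K>. isomorphic D C K"
    using T_skeleton by blast
  let ?Y = "{N \<in> Ob D. \<forall>n. T_stable ((\<Sigma> ^^ n) N)}"
  have T_Y: "C \<in> ?Y" if C: "C \<in> \<T>" for C
  proof -
    have "(\<Sigma> ^^ n) C \<in> \<T>" for n by (induction n) (use C sub_shift[OF T_sub] T_Ob in auto)
    moreover have "T_stable C" if "C \<in> \<T>" for C
      unfolding T_stable_def using that sub_mid[OF T_sub] T_onto_T by blast
    ultimately show ?thesis using T_Ob[OF C] by blast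
  qed
  have "Ob D \<subseteq> ?Y"
  proof (rule devissage[where \<S> = \<T> and \<P> = \<K>])
    show "suspended ?Y"
      unfolding suspended_def
    proof (intro conjI allI impI ballI)
      show "?Y \<subseteq> Ob D" by blast
      show "Z \<in> ?Y" if "zero_object D Z" for Z using T_Y sub_zero_object[OF T_sub that] by blast
      show "\<Sigma> X \<in> ?Y" if X: "X \<in> ?Y" for X
      proof -
        have "T_stable ((\<Sigma> ^^ n) (\<Sigma> X))" for n
          using X by (auto simp flip: funpow_Suc_right[unfolded o_def, THEN fun_cong] dest: spec[of _ "Suc n"])
        then show ?thesis using X by simp
      qed
      show "Y \<in> ?Y" if T: "tri X Y Z u v w" and X: "X \<in> ?Y" and Z: "Z \<in> ?Y" for X Y Z u v w
      proof -
        have "\<exists>u v w. tri ((\<Sigma> ^^ n) X) ((\<Sigma> ^^ n) Y) ((\<Sigma> ^^ n) Z) u v w" for n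
        proof (induction n)
          case 0
          then show ?case using T by auto
        next
          case (Suc n)
          then show ?case using rotate[OF rotate[OF rotate]] by (simp only: funpow.simps o_apply) blast
        qed
        then have "T_stable ((\<Sigma> ^^ n) Y)" for n using T_stable_extension X Z by blast
        then show ?thesis using tri_Hom(2)[OF T] by blast
      qed
    qed
    show "closed_under_small_coproducts D U ?Y"
      unfolding closed_under_small_coproducts_def
    proof (intro allI impI, elim conjE)
      fix I :: "'u set" and M S \<iota>
      assume I: "I \<prec> U" "\<forall>i\<in>I. M i \<in> ?Y" "is_coproduct D I M S \<iota>"
      have "\<exists>\<kappa>. is_coproduct D I (\<lambda>i. (\<Sigma> ^^ n) (M i)) ((\<Sigma> ^^ n) S) \<kappa>" for n
      proof (induction n)
        case 0
        then show ?case using I(3) by auto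
      next
        case (Suc n)
        then show ?case using coproduct_shift by (simp only: funpow.simps o_apply) blast
      qed
      then have "T_stable ((\<Sigma> ^^ n) S)" for n using T_stable_coproduct[OF I(1)] I(2) by blast
      then show "S \<in> ?Y" using coproduct_Hom(1)[OF I(3)] by blast
    qed
    show "\<K> \<subseteq> ?Y" using T_Y K(2) by blast
    fix Q M x assume Q: "Q \<in> \<T>" "M \<in> Ob D" "x \<in> Hom D Q M"
    obtain R where R: "R \<in> \<K>" "isomorphic D Q R" using K(3)[OF Q(1)] by blast
    obtain a b where ab: "a \<in> Hom D Q R" "b \<in> Hom D R Q" "b \<cdot> a = Id D Q" "a \<cdot> b = Id D R"
      using iso_obtain[OF R(2)] .
    have "(x \<cdot> b) \<cdot> a = x" using Q(3) ab by simp
    moreover have "x \<cdot> b \<in> Hom D R M" using Q(3) ab(2) by simp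
    ultimately show "\<exists>R\<in>\<K>. \<exists>a\<in>Hom D Q R. \<exists>b\<in>Hom D R M. b \<cdot> a = x" using R(1) ab(1) by blast
  qed (use T_compact T_generates sub_shift[OF T_sub] sub_iso[OF T_sub] triangulated_subcategory_Ob K(1)
      in blast)+
  then have "T_stable ((\<Sigma> ^^ 0) N)" using N by blast
  then show ?thesis by simp
qed

text \<open>The injectivity \<open>T_into M\<close> is applied to \<open>k = \<eta> C\<close>. The arrow \<open>f\<close> sends it to \<open>\<eta> M \<cdot> f = 0\<close>, because
  there are no non-zero arrows from \<open>M\<close> to \<open>L M\<close>.\<close>

lemma factor_through_X:
  assumes C: "C \<in> \<T>" and M: "M \<in> \<X>" and f: "f \<in> Hom D C M"
  obtains K a b G p q where "K \<in> \<T>" "a \<in> Hom D C K" "b \<in> Hom D K M" "b \<cdot> a = f"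
    "G \<in> \<X>" "p \<in> Hom D C G" "q \<in> Hom D G K" "q \<cdot> p = a"
proof -
  note Ob = T_Ob[OF C] X_Ob[OF M]
  have into: "T_into M"
    by (rule T_into_if_fibres[OF Ob(2)]) (use all_T_stable T_stable_onto tri_Hom(1) in blast)
  have "\<eta> M = Zero D M (L M)" by (rule perp_zero[OF L_perp[OF Ob(2)] M]) (use Ob in simp)
  then have "La f \<cdot> \<eta> C = Zero D C (L M)" using La(2)[OF f] f Ob by simp
  then have "kills (\<eta> C) f" using into C f Ob unfolding T_into_def by simp
  moreover have "\<eta> C \<in> Hom D C (L C)" using Ob by simp
  ultimately obtain K a b where K: "K \<in> \<T>" "a \<in> Hom D C K" "b \<in> Hom D K M" "b \<cdot> a = f"
    "La a \<cdot> \<eta> C = Zero D C (L K)" using killsE[OF _ f] by metis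
  have "\<eta> K \<cdot> a = Zero D C (L K)" using La(2)[OF K(2)] K(5) by simp
  then obtain G p q where "G \<in> \<X>" "p \<in> Hom D C G" "q \<in> Hom D G K" "q \<cdot> p = a"
    using eta_zero_factors[OF K(2)] by blast
  then show thesis using that K by blast
qed

end

section \<open>Smashing subcategories are generated by Milnor colimits\<close>

context smashing_with_compacts
begin

text \<open>Iterating \<open>factor_through_X\<close> produces a sequence of compact objects over \<open>M\<close> whose transition
  maps factor through \<open>\<X>\<close>, so that the map to \<open>M\<close> extends to a Milnor colimit lying in \<open>\<X>\<close>.\<close>

lemma sequence_over:
  assumes K: "\<K> \<subseteq> \<T>" "\<And>C. C \<in> \<T> \<Longrightarrow> \<exists>K\<in>\<K>. isomorphic D C K"
    and C: "C \<in> \<K>" and M: "M \<in> \<X>" and x: "x \<in> Hom D C M"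
  obtains X a y where "\<And>n. X n \<in> \<K>" "\<And>n. a n \<in> Hom D (X n) (X (Suc n))"
    "\<And>n. \<exists>G\<in>\<X>. \<exists>p\<in>Hom D (X n) G. \<exists>q\<in>Hom D G (X (Suc n)). q \<cdot> p = a n"
    "\<And>n. y n \<in> Hom D (X n) M" "\<And>n. y (Suc n) \<cdot> a n = y n" "X 0 = C" "y 0 = x"
proof -
  define over where "over n s \<longleftrightarrow> fst s \<in> \<K> \<and> snd s \<in> Hom D (fst s) M \<and> (n = 0 \<longrightarrow> s = (C, x))"
    for n :: nat and s
  define next' where "next' s s' a \<longleftrightarrow> a \<in> Hom D (fst s) (fst s') \<and> snd s' \<cdot> a = snd s \<and>
      (\<exists>G\<in>\<X>. \<exists>p\<in>Hom D (fst s) G. \<exists>q\<in>Hom D G (fst s'). q \<cdot> p = a)" for s s' a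
  have "\<exists>\<phi>. \<forall>n. over n (\<phi> n) \<and> (\<exists>a. next' (\<phi> n) (\<phi> (Suc n)) a)"
  proof (rule dependent_nat_choice)
    show "\<exists>s. over 0 s" using C x unfolding over_def by (intro exI[of _ "(C, x)"]) simp
    fix s n assume "over n s"
    then have s: "fst s \<in> \<T>" "snd s \<in> Hom D (fst s) M" unfolding over_def using K(1) by blast+
    obtain K' a b G p q where f: "K' \<in> \<T>" "a \<in> Hom D (fst s) K'" "b \<in> Hom D K' M" "b \<cdot> a = snd s"
      "G \<in> \<X>" "p \<in> Hom D (fst s) G" "q \<in> Hom D G K'" "q \<cdot> p = a"
      using factor_through_X[OF s(1) M s(2)] .
    obtain R where R: "R \<in> \<K>" "isomorphic D K' R" using K(2)[OF f(1)] by blast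
    obtain c d where cd: "c \<in> Hom D K' R" "d \<in> Hom D R K'" "d \<cdot> c = Id D K'" "c \<cdot> d = Id D R"
      using iso_obtain[OF R(2)] .
    have "(b \<cdot> d) \<cdot> (c \<cdot> a) = b \<cdot> ((d \<cdot> c) \<cdot> a)" using f(2,3) cd(1,2) by (simp del: cd(3))
    then have 1: "(b \<cdot> d) \<cdot> (c \<cdot> a) = snd s" unfolding cd(3) using f(2,4) by simp
    have 2: "(c \<cdot> q) \<cdot> p = c \<cdot> a" unfolding f(8)[symmetric] using cd(1) f(6,7) by simp
    have "over (Suc n) (R, b \<cdot> d)" unfolding over_def using R(1) f(3) cd(2) by simp
    moreover have "next' s (R, b \<cdot> d) (c \<cdot> a)"
      unfolding next'_def fst_conv snd_conv
    proof (intro conjI)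
      show "c \<cdot> a \<in> Hom D (fst s) R" using cd(1) f(2) by simp
      have "c \<cdot> q \<in> Hom D G R" using cd(1) f(7) by simp
      then show "\<exists>G\<in>\<X>. \<exists>p\<in>Hom D (fst s) G. \<exists>q\<in>Hom D G R. q \<cdot> p = c \<cdot> a" using f(5,6) 2 by blast
    qed (fact 1)
    ultimately show "\<exists>s'. over (Suc n) s' \<and> (\<exists>a. next' s s' a)" by blast
  qed
  then obtain \<phi> where \<phi>: "\<And>n. over n (\<phi> n)" "\<And>n. \<exists>a. next' (\<phi> n) (\<phi> (Suc n)) a" by blast
  obtain a where a: "\<And>n. next' (\<phi> n) (\<phi> (Suc n)) (a n)" using \<phi>(2) by metis
  show thesis
  proof (rule that[of "\<lambda>n. fst (\<phi> n)" a "\<lambda>n. snd (\<phi> n)"])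
    show "fst (\<phi> n) \<in> \<K>" "snd (\<phi> n) \<in> Hom D (fst (\<phi> n)) M" for n
      using \<phi>(1)[of n] unfolding over_def by blast+
    show "a n \<in> Hom D (fst (\<phi> n)) (fst (\<phi> (Suc n)))" "snd (\<phi> (Suc n)) \<cdot> a n = snd (\<phi> n)"
      "\<exists>G\<in>\<X>. \<exists>p\<in>Hom D (fst (\<phi> n)) G. \<exists>q\<in>Hom D G (fst (\<phi> (Suc n))). q \<cdot> p = a n" for n
      using a[of n] unfolding next'_def by blast+
    show "fst (\<phi> 0) = C" "snd (\<phi> 0) = x" using \<phi>(1)[of 0] unfolding over_def by simp_all
  qed
qed

text \<open>The sequences are taken in a small skeleton \<open>\<K>\<close> of \<open>\<T>\<close>, so that they form a small set, and one
  Milnor colimit is chosen for each.\<close>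

lemma generated_by_Milnor_colimits:
  shows "\<exists>\<P>. \<P> \<prec> U \<and>
           (\<forall>C\<in>\<P>. \<exists>M f. (\<forall>n. compact_object D U (M n)) \<and> is_Milnor_colimit D M f C) \<and>
           \<X> = Tria D U \<P>"
proof -
  obtain \<K> where K: "\<K> \<prec> U" "\<K> \<subseteq> \<T>" "\<And>C. C \<in> \<T> \<Longrightarrow> \<exists>K\<in>\<K>. isomorphic D C K"
    using T_skeleton by blast
  have KOb: "C \<in> Ob D" if "C \<in> \<K>" for C using that K(2) T_Ob by blast
  define A where "A = (\<Union>C\<in>\<K>. \<Union>C'\<in>\<K>. Hom D C C')"
  have "A \<prec> U" unfolding A_def by (intro small_Union K(1) locally_small KOb)
  then have seq_small: "{a :: nat \<Rightarrow> 'm. range a \<subseteq> A} \<prec> U" by (rule small_sequences)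
  define seqs where "seqs = {a. range a \<subseteq> A \<and> (\<forall>n. Dom D (a (Suc n)) = Cod D (a n)) \<and>
    (\<forall>n. \<exists>G\<in>\<X>. \<exists>p\<in>Hom D (Dom D (a n)) G. \<exists>q\<in>Hom D G (Cod D (a n)). q \<cdot> p = a n)}"
  have "\<exists>C. is_Milnor_colimit D (\<lambda>n. Dom D (a n)) a C" if "a \<in> seqs" for a
  proof -
    have "a n \<in> Hom D (Dom D (a n)) (Dom D (a (Suc n)))" for n
    proof -
      have "a n \<in> A" "Dom D (a (Suc n)) = Cod D (a n)" using that unfolding seqs_def by blast+
      then show ?thesis unfolding A_def by auto
    qed
    then show ?thesis using Milnor_colimit_exists[of a "\<lambda>n. Dom D (a n)"] by blast
  qed
  then obtain mc where mc: "\<And>a. a \<in> seqs \<Longrightarrow> is_Milnor_colimit D (\<lambda>n. Dom D (a n)) a (mc a)" by metis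
  have "seqs \<prec> U" by (rule small_subset[OF _ seq_small]) (auto simp: seqs_def)
  then have P_small: "mc ` seqs \<prec> U" by (rule small_image)
  have compact: "compact_object D U (Dom D (a n))" if "a \<in> seqs" for a n
  proof -
    have "a n \<in> A" using that unfolding seqs_def by blast
    then have "Dom D (a n) \<in> \<K>" unfolding A_def by auto
    then show ?thesis using K(2) T_compact by blast
  qed
  have P_X: "mc ` seqs \<subseteq> \<X>"
  proof clarify
    fix a assume a: "a \<in> seqs"
    show "mc a \<in> \<X>"
    proof (rule Milnor_colimit_in_X[OF mc[OF a]])
      show "\<exists>G\<in>\<X>. \<exists>p\<in>Hom D (Dom D (a n)) G. \<exists>q\<in>Hom D G (Dom D (a (Suc n))). q \<cdot> p = a n" for n
        using a unfolding seqs_def by (simp del: Hom_iff)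
    qed
  qed
  have "\<X> = Tria D U (mc ` seqs)"
  proof (rule Tria_eqI[where \<S> = \<T>])
    show "\<exists>R\<in>mc ` seqs. \<exists>a\<in>Hom D Q R. \<exists>b\<in>Hom D R M. b \<cdot> a = x"
      if Q: "Q \<in> \<T>" and M: "M \<in> \<X>" and x: "x \<in> Hom D Q M" for Q M x
    proof -
      obtain C where C: "C \<in> \<K>" "isomorphic D Q C" using K(3)[OF Q] by blast
      obtain c d where cd: "c \<in> Hom D Q C" "d \<in> Hom D C Q" "d \<cdot> c = Id D Q" "c \<cdot> d = Id D C"
        using iso_obtain[OF C(2)] .
      have xd: "x \<cdot> d \<in> Hom D C M" using x cd(2) by simp
      obtain X a y where s: "\<And>n. X n \<in> \<K>" "\<And>n. a n \<in> Hom D (X n) (X (Suc n))"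
        "\<And>n. \<exists>G\<in>\<X>. \<exists>p\<in>Hom D (X n) G. \<exists>q\<in>Hom D G (X (Suc n)). q \<cdot> p = a n"
        "\<And>n. y n \<in> Hom D (X n) M" "\<And>n. y (Suc n) \<cdot> a n = y n" "X 0 = C" "y 0 = x \<cdot> d"
        by (rule sequence_over[OF K(2,3) C(1) M xd], assumption, rule that)
      have dom: "Dom D (a n) = X n" "Cod D (a n) = X (Suc n)" for n using s(2)[of n] by simp_all
      have "a n \<in> A" for n unfolding A_def using s(1)[of n] s(1)[of "Suc n"] s(2)[of n] by blast
      then have a: "a \<in> seqs" unfolding seqs_def mem_Collect_eq dom using s(3) by blast
      have C': "is_Milnor_colimit D X a (mc a)" using mc[OF a] unfolding dom .
      obtain S \<iota> \<sigma> v w where "Milnor_colimit D U X a (mc a) S \<iota> \<sigma> v w" using Milnor_colimit_data[OF C'] .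
      then interpret C: Milnor_colimit D U X a "mc a" S \<iota> \<sigma> v w .
      obtain h where h: "h \<in> Hom D (mc a) M" "\<And>n. h \<cdot> (v \<cdot> \<iota> n) = y n"
        by (rule C.extend[where g = y, OF X_Ob[OF M] s(4,5)], rule that)
      have leg: "v \<cdot> \<iota> 0 \<in> Hom D C (mc a)" using C.leg[of 0] s(6) by simp
      have "h \<cdot> ((v \<cdot> \<iota> 0) \<cdot> c) = (x \<cdot> d) \<cdot> c"
        using assoc_subst[OF h(2)[of 0] leg h(1), of c] cd(1) s(7) by simp
      also have "\<dots> = x" using x cd by simp
      finally have "h \<cdot> ((v \<cdot> \<iota> 0) \<cdot> c) = x" .
      moreover have "(v \<cdot> \<iota> 0) \<cdot> c \<in> Hom D Q (mc a)" using leg cd(1) by simp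
      ultimately show ?thesis using a h(1) by blast
    qed
  qed (use T_compact T_generates sub_shift[OF T_sub] sub_iso[OF T_sub] X_sub X_coproducts P_small P_X
      in blast)+
  moreover have "\<forall>C\<in>mc ` seqs. \<exists>M f. (\<forall>n. compact_object D U (M n)) \<and> is_Milnor_colimit D M f C"
  proof clarify
    fix a assume a: "a \<in> seqs"
    show "\<exists>M f. (\<forall>n. compact_object D U (M n)) \<and> is_Milnor_colimit D M f (mc a)"
      using mc[OF a] compact[OF a] by (intro exI[of _ "\<lambda>n. Dom D (a n)"] exI[of _ a]) simp
  qed
  ultimately show ?thesis using P_small by blast
qed

end

text \<open>The smallest triangulated subcategory containing the given generators is a category \<open>\<T>\<close> of test
  objects as above.\<close>

lemma (in compactly_generated_triangulated_category) compact_test_objects: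
  obtains \<T> where "triangulated_subcategory D \<T>" "\<And>C. C \<in> \<T> \<Longrightarrow> compact_object D U C"
    "\<And>M. M \<in> Ob D \<Longrightarrow> \<forall>C\<in>\<T>. Hom D C M = {Zero D C M} \<Longrightarrow> zero_object D M"
    "\<exists>\<K>. \<K> \<prec> U \<and> \<K> \<subseteq> \<T> \<and> (\<forall>C\<in>\<T>. \<exists>K\<in>\<K>. isomorphic D C K)"
proof -
  obtain \<G> where G: "\<G> \<prec> U" "\<forall>P\<in>\<G>. compact_object D U P"
    "\<forall>M\<in>Ob D. (\<forall>P\<in>\<G>. \<forall>Q. is_shift D P Q \<longrightarrow> Hom D Q M = {Zero D Q M}) \<longrightarrow> zero_object D M"
    using compact_generators by blast
  let ?F = "{\<Y>. triangulated_subcategory D \<Y> \<and> \<G> \<subseteq> \<Y>}"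
  let ?c = "{P. compact_object D U P}"
  have c: "?c \<in> ?F" using triangulated_subcategory_compact G(2) by blast
  define \<T> where "\<T> = \<Inter> ?F"
  have T: "triangulated_subcategory D \<T>"
    unfolding \<T>_def by (rule triangulated_subcategory_Inter) (use c in blast)+
  have GT: "\<G> \<subseteq> \<T>" unfolding \<T>_def by blast
  have Tc: "compact_object D U C" if "C \<in> \<T>" for C using that c unfolding \<T>_def by blast
  have gen: "zero_object D M" if M: "M \<in> Ob D" and z: "\<forall>C\<in>\<T>. Hom D C M = {Zero D C M}" for M
  proof -
    have "Hom D Q M = {Zero D Q M}" if "P \<in> \<G>" "is_shift D P Q" for P Q
      using z sub_is_shift[OF T _ that(2)] GT that(1) by blast
    then show ?thesis using G(3) M by blast
  qed
  have "\<G> \<subseteq> Ob D" using G(2) compact_object_Ob by blast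
  then obtain \<K> where K: "\<K> \<prec> U" "\<K> \<subseteq> Ob D" "\<G> \<subseteq> \<K>"
    "triangulated_subcategory D {Q. \<exists>R\<in>\<K>. isomorphic D R Q}" using essentially_small_hull[OF G(1)] by blast
  have "\<G> \<subseteq> {Q. \<exists>R\<in>\<K>. isomorphic D R Q}" using K(2,3) iso_refl by blast
  then have hull: "\<T> \<subseteq> {Q. \<exists>R\<in>\<K>. isomorphic D R Q}" using K(4) unfolding \<T>_def by blast
  have "\<exists>K\<in>\<K> \<inter> \<T>. isomorphic D C K" if C: "C \<in> \<T>" for C
  proof -
    obtain R where R: "R \<in> \<K>" "isomorphic D R C" using C hull by blast
    then have "isomorphic D C R" using iso_sym by blast
    then show ?thesis using R(1) sub_iso[OF T C] by blast
  qed
  moreover have "\<K> \<inter> \<T> \<prec> U" by (rule small_subset[OF _ K(1)]) blast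
  ultimately have "\<exists>\<K>. \<K> \<prec> U \<and> \<K> \<subseteq> \<T> \<and> (\<forall>C\<in>\<T>. \<exists>K\<in>\<K>. isomorphic D C K)"
    by (intro exI[of _ "\<K> \<inter> \<T>"]) blast
  with T Tc gen show thesis by (rule that)
qed

theorem corollary5p5p17:
  fixes D :: "('o, 'm) triangulated_data" and U :: "'u set" and \<X> :: "'o set"
  assumes "compactly_generated_triangulated_category D U"
    and "smashing_subcategory D U \<X>"
  shows "\<exists>\<P>. \<P> \<prec> U \<and>
           (\<forall>C\<in>\<P>. \<exists>M f. (\<forall>n. compact_object D U (M n)) \<and> is_Milnor_colimit D M f C) \<and>
           \<X> = Tria D U \<P>"
proof -
  interpret compactly_generated_triangulated_category D U by (fact assms(1))
  obtain \<T> where T: "triangulated_subcategory D \<T>" "\<And>C. C \<in> \<T> \<Longrightarrow> compact_object D U C"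
    "\<And>M. M \<in> Ob D \<Longrightarrow> \<forall>C\<in>\<T>. Hom D C M = {Zero D C M} \<Longrightarrow> zero_object D M"
    "\<exists>\<K>. \<K> \<prec> U \<and> \<K> \<subseteq> \<T> \<and> (\<forall>C\<in>\<T>. \<exists>K\<in>\<K>. isomorphic D C K)"
    by (rule compact_test_objects, rule that)
  interpret smashing_with_compacts D U \<X> \<T>
    by unfold_locales (fact assms(2) T)+
  show ?thesis by (rule generated_by_Milnor_colimits)
qed

end
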